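(* Fix a positive integer $s$ and a real number $\alpha$ with $\alpha/(2\pi)\notin\mathbb{Q}$. Let $$\Sigma=\{a=(a_{i,j})_{i,j\ge 0,\ i+j>2s}:\ a_{j,i}=\overline{a_{i,j}},\ |a_{i,j}|<1\},$$ and for $a\in\Sigma$ put $\tilde a(z,\bar z)=\sum_{i+j>2s}a_{i,j}z^i\bar z^j$, $\phi_a(z)=z\,e^{i\tilde a(z,\bar z)}$, $T(z)=z\,e^{i(\alpha+(z\bar z)^s)}$, $\tau(z)=\bar z$, and $$\varphi_a=\phi_a\circ T\circ\tau\circ\phi_a^{-1}\circ\tau,$$ a real analytic map of a neighborhood of $0$ in $\mathbb{R}^2=\mathbb{C}$ fixing $0$. Then there exists a sequence $(H_k)_{k\ge 1}$ of functionally independent power series in the variables $a_{i,j}$, each converging for $a\in\Sigma$, with the following property: if $a\in\Sigma$ is fixed and $H_k(a)\neq0$ for some $k$, then there is a closed interval $I_k$ of positive length such that for each $r\in I_k$, $\varphi_a$ has a periodic point on the circle $|z|=r$. Furthermore, for any given $\epsilon>0$, $I_k\subset(0,\epsilon)$ for all sufficiently large $k$.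
   Context: A periodic point of $\varphi_a$ is a fixed point of some iterate $\varphi_a^n$, $n\ge1$. Convergence of a power series in infinitely many variables means absolute convergence. *)

theory Defs
  imports "HOL-Analysis.Analysis" "HOL-Combinatorics.Permutations"
begin

text \<open>A monomial is a finitely supported exponent function on the variable indices (i,j);
 a formal power series is its coefficient function.\<close>

type_synonym monom = "nat \<times> nat \<Rightarrow> nat"
type_synonym pseries = "monom \<Rightarrow> complex"

definition fin_monom :: "monom \<Rightarrow> bool" where
  "fin_monom m \<longleftrightarrow> finite {v. m v \<noteq> 0}"

definition is_pseries :: "nat \<Rightarrow> pseries \<Rightarrow> bool" where
  "is_pseries s c \<longleftrightarrow>
     (\<forall>m. c m \<noteq> 0 \<longrightarrow> fin_monom m \<and> (\<forall>v. m v \<noteq> 0 \<longrightarrow> 2 * s < fst v + snd v))"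

definition monom_val :: "(nat \<times> nat \<Rightarrow> complex) \<Rightarrow> monom \<Rightarrow> complex" where
  "monom_val a m = (\<Prod>v\<in>{v. m v \<noteq> 0}. a v ^ m v)"

definition ps_converges :: "pseries \<Rightarrow> (nat \<times> nat \<Rightarrow> complex) \<Rightarrow> bool" where
  "ps_converges c a \<longleftrightarrow> (\<lambda>m. norm (c m * monom_val a m)) summable_on {m. fin_monom m}"

definition ps_eval :: "pseries \<Rightarrow> (nat \<times> nat \<Rightarrow> complex) \<Rightarrow> complex" where
  "ps_eval c a = (\<Sum>\<^sub>\<infinity>m\<in>{m. fin_monom m}. c m * monom_val a m)"

definition ps_mul :: "pseries \<Rightarrow> pseries \<Rightarrow> pseries" where
  "ps_mul f g m = (\<Sum>p\<in>{p. \<forall>v. p v \<le> m v}. f p * g (\<lambda>v. m v - p v))"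

definition ps_one :: pseries where
  "ps_one m = (if m = (\<lambda>_. 0) then 1 else 0)"

definition ps_deriv :: "nat \<times> nat \<Rightarrow> pseries \<Rightarrow> pseries" where
  "ps_deriv v c m = of_nat (m v + 1) * c (m(v := m v + 1))"

definition ps_det :: "nat \<Rightarrow> (nat \<Rightarrow> nat \<Rightarrow> pseries) \<Rightarrow> pseries" where
  "ps_det n M m =
     (\<Sum>\<sigma> | \<sigma> permutes {..<n}.
        of_int (sign \<sigma>) * foldr (\<lambda>i acc. ps_mul (M i (\<sigma> i)) acc) [0..<n] ps_one m)"

text \<open>Functional independence of a sequence: every finite subfamily has a Jacobian matrix
 (with respect to the variables a_(i,j)) of full rank, i.e. some maximal minor is a nonzero
 formal power series.\<close>
definition func_indep :: "(nat \<Rightarrow> pseries) \<Rightarrow> bool" where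
  "func_indep H \<longleftrightarrow>
     (\<forall>ks. distinct ks \<longrightarrow>
        (\<exists>vs. length vs = length ks \<and>
              ps_det (length ks) (\<lambda>i j. ps_deriv (vs ! j) (H (ks ! i))) \<noteq> (\<lambda>_. 0)))"

definition Sigma_set :: "nat \<Rightarrow> (nat \<times> nat \<Rightarrow> complex) set" where
  "Sigma_set s = {a. (\<forall>i j. i + j \<le> 2 * s \<longrightarrow> a (i,j) = 0) \<and>
                     (\<forall>i j. 2 * s < i + j \<longrightarrow> a (j,i) = cnj (a (i,j)) \<and> norm (a (i,j)) < 1)}"

definition a_tilde :: "nat \<Rightarrow> (nat \<times> nat \<Rightarrow> complex) \<Rightarrow> complex \<Rightarrow> complex" where
  "a_tilde s a z = (\<Sum>\<^sub>\<infinity>(i,j)\<in>{(i,j). 2 * s < i + j}. a (i,j) * z ^ i * cnj z ^ j)"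

definition phi_map :: "nat \<Rightarrow> (nat \<times> nat \<Rightarrow> complex) \<Rightarrow> complex \<Rightarrow> complex" where
  "phi_map s a z = z * exp (\<i> * a_tilde s a z)"

definition T_map :: "nat \<Rightarrow> real \<Rightarrow> complex \<Rightarrow> complex" where
  "T_map s \<alpha> z = z * exp (\<i> * (of_real \<alpha> + (z * cnj z) ^ s))"

definition local_inverse :: "(complex \<Rightarrow> complex) \<Rightarrow> (complex \<Rightarrow> complex) \<Rightarrow> real \<Rightarrow> bool" where
  "local_inverse f \<psi> \<rho> \<longleftrightarrow>
     (\<forall>z\<in>ball 0 \<rho>. f z \<in> ball 0 \<rho> \<and> \<psi> (f z) = z) \<and>
     (\<forall>w\<in>ball 0 \<rho>. \<psi> w \<in> ball 0 \<rho> \<and> f (\<psi> w) = w)"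

definition varphi_map ::
  "nat \<Rightarrow> real \<Rightarrow> (nat \<times> nat \<Rightarrow> complex) \<Rightarrow> (complex \<Rightarrow> complex) \<Rightarrow> complex \<Rightarrow> complex" where
  "varphi_map s \<alpha> a \<psi> = phi_map s a \<circ> T_map s \<alpha> \<circ> cnj \<circ> \<psi> \<circ> cnj"

definition periodic_point :: "(complex \<Rightarrow> complex) \<Rightarrow> complex \<Rightarrow> bool" where
  "periodic_point f z \<longleftrightarrow> (\<exists>n\<ge>1. (f ^^ n) z = z)"

end

theory Submission
  imports Defs "HOL-Library.Poly_Mapping" "HOL-Analysis.Kronecker_Approximation_Theorem"
begin

text \<open>Since \<open>a_tilde\<close> is real, every factor of the map preserves the circles \<open>|z| = r\<close>, on which the map is
  conjugate to a perturbation \<open>G\<close> of the rotation by \<open>\<alpha> + r^(2s)\<close>. For \<open>2\<pi>p/q\<close> slightly above \<open>\<alpha>\<close> with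
  \<open>p - q\<alpha>/(2\<pi>)\<close> small, and for every starting angle \<open>x\<close>, there is exactly one \<open>r\<close> near the root \<open>r0\<close> of
  \<open>\<alpha> + r^(2s) = 2\<pi>p/q\<close> with \<open>G^q x = x + 2\<pi>p\<close>; call it \<open>r(x)\<close>. For \<open>r\<close> between \<open>r(0)\<close> and \<open>r(\<pi>/q)\<close> the
  displacements of \<open>0\<close> and \<open>\<pi>/q\<close> under \<open>G^q - 2\<pi>p\<close> have opposite signs, so there is a periodic point.
  The obstruction \<open>H\<close> is the difference of \<open>2s ln (r(x)/r0)\<close> at \<open>x = 0\<close> and \<open>x = \<pi>/q\<close>. That it is a power
  series converging on all of \<open>\<Sigma>\<close> follows by solving the periodicity equations for the whole orbit by one
  contraction, uniformly in \<open>a\<close>, in the Banach algebra of absolutely summable power series: evaluation at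
  \<open>a\<close> is a homomorphism, and the solution over the complex numbers is unique. To first order, only the
  coefficients \<open>a(i,j)\<close> with \<open>q\<close> dividing \<open>i - j\<close> contribute to \<open>H\<close>, which makes the Jacobian with respect
  to the variables \<open>a(q,0)\<close> triangular.\<close>

subsection \<open>The Banach algebra of absolutely summable series\<close>

text \<open>The coefficients fill all of Sigma while q tends to infinity, so only the radius is
  small. Two facts give one contraction for every q. Terms of \<open>a_tilde\<close> have degree
  above 2s, so a kick is of order r0^(2s+1), a factor r0 smaller than the twist scale r0^(2s) that
  has to balance it. And q r0^(2s) = 2 pi p - q \<alpha> is at most 1, so q kicks still add up to
  order r0. The inverse of \<open>phi_map\<close> is never expanded. Conjugation by the reflected
  \<open>phi_map\<close> turns a step into X' = X + angle + disp(X + angle) + disp(-X'), where the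
  inverse survives only as the unknown X'; this is why the orbit is solved for as a whole. Complex
  conjugation, not an algebraic operation, becomes a second argument with negated angle. Over the
  reals, periodic radii come from the intermediate value theorem; the contraction supplies existence
  for formal coefficients, and uniqueness joins the two. The angles 0 and pi/q are extremes of cos(q
  x), the shape of the resonant first-order term. The l1 norm gives every variable norm 1, so that
  members of the algebra converge wherever all coefficients have modulus at most 1.\<close>

typedef 'm ell1 = "{f :: 'm \<Rightarrow> complex. (\<lambda>m. cmod (f m)) summable_on UNIV}"
  morphisms coeff Abs_ell1
  by (rule exI[of _ "\<lambda>_. 0"]) simp

setup_lifting type_definition_ell1

lemma coeff_abs_summable [simp]: "(\<lambda>m. cmod (coeff f m)) summable_on UNIV"
  using coeff[of f] by simp

lemma ell1_eqI: "(\<And>m. coeff f m = coeff g m) \<Longrightarrow> f = g"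
  by (metis coeff_inject ext)

instantiation ell1 :: (type) real_normed_vector
begin

lift_definition zero_ell1 :: "'a ell1" is "\<lambda>_. 0" by simp

lift_definition plus_ell1 :: "'a ell1 \<Rightarrow> 'a ell1 \<Rightarrow> 'a ell1" is "\<lambda>f g m. f m + g m"
  by (rule Infinite_Sum.abs_summable_on_comparison_test'[OF summable_on_add], assumption, assumption,
      rule norm_triangle_ineq)

lift_definition uminus_ell1 :: "'a ell1 \<Rightarrow> 'a ell1" is "\<lambda>f m. - f m" by simp

lift_definition minus_ell1 :: "'a ell1 \<Rightarrow> 'a ell1 \<Rightarrow> 'a ell1" is "\<lambda>f g m. f m - g m"
  by (rule Infinite_Sum.abs_summable_on_comparison_test'[OF summable_on_add], assumption, assumption,
      rule norm_triangle_ineq4)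

lift_definition scaleR_ell1 :: "real \<Rightarrow> 'a ell1 \<Rightarrow> 'a ell1" is "\<lambda>r f m. r *\<^sub>R f m"
  by (simp add: summable_on_cmult_right)

lift_definition norm_ell1 :: "'a ell1 \<Rightarrow> real" is "\<lambda>f. \<Sum>\<^sub>\<infinity>m. cmod (f m)" .

definition dist_ell1 :: "'a ell1 \<Rightarrow> 'a ell1 \<Rightarrow> real" where "dist_ell1 f g = norm (f - g)"
definition sgn_ell1 :: "'a ell1 \<Rightarrow> 'a ell1" where "sgn_ell1 f = inverse (norm f) *\<^sub>R f"
definition uniformity_ell1 :: "('a ell1 \<times> 'a ell1) filter"
  where "uniformity_ell1 = (INF e\<in>{0<..}. principal {(f, g). dist f g < e})"
definition open_ell1 :: "'a ell1 set \<Rightarrow> bool"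
  where "open_ell1 U = (\<forall>f\<in>U. eventually (\<lambda>(f', g). f' = f \<longrightarrow> g \<in> U) uniformity)"

instance
proof
  fix f g h :: "'a ell1" and x y :: real
  show "f + g + h = f + (g + h)" "f + g = g + f" "0 + f = f" "- f + f = 0" "f - g = f + - g"
    by (transfer; simp add: fun_eq_iff)+
  show "x *\<^sub>R (f + g) = x *\<^sub>R f + x *\<^sub>R g" "(x + y) *\<^sub>R f = x *\<^sub>R f + y *\<^sub>R f"
    "x *\<^sub>R y *\<^sub>R f = (x * y) *\<^sub>R f" "1 *\<^sub>R f = f"
    by (transfer; simp add: fun_eq_iff algebra_simps)+
  show "norm f = 0 \<longleftrightarrow> f = 0"
  proof
    assume "norm f = 0"
    then have "cmod (coeff f m) = 0" for m
      by (intro nonneg_infsum_le_0D[where A = UNIV]) (simp_all add: norm_ell1.rep_eq)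
    then show "f = 0"
      by (intro ell1_eqI) (simp add: zero_ell1.rep_eq)
  qed (simp add: norm_ell1.rep_eq zero_ell1.rep_eq)
  show "norm (f + g) \<le> norm f + norm g"
    unfolding norm_ell1.rep_eq
    by (subst infsum_add[symmetric]; (intro infsum_mono summable_on_add coeff_abs_summable)?)
      (simp add: plus_ell1.rep_eq norm_triangle_ineq)
  show "norm (x *\<^sub>R f) = \<bar>x\<bar> * norm f"
    by (simp add: norm_ell1.rep_eq scaleR_ell1.rep_eq infsum_cmult_right')
qed (rule dist_ell1_def sgn_ell1_def uniformity_ell1_def open_ell1_def)+

end

lemma norm_coeff_le: "cmod (coeff f m) \<le> norm f"
  using finite_sum_le_infsum[of "\<lambda>m. cmod (coeff f m)" UNIV "{m}"]
  by (simp add: norm_ell1.rep_eq)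

lemma bounded_linear_coeff: "bounded_linear (\<lambda>f. coeff f m)"
  by (rule bounded_linear_intro[where K = 1])
    (simp_all add: plus_ell1.rep_eq scaleR_ell1.rep_eq norm_coeff_le)

lemma sum_coeff_le_norm: "finite F \<Longrightarrow> (\<Sum>m\<in>F. cmod (coeff f m)) \<le> norm f"
  unfolding norm_ell1.rep_eq by (rule finite_sum_le_infsum) auto

text \<open>The limit is formed coefficientwise. The Cauchy condition bounds all finite partial sums
  of the differences uniformly, and this survives the pointwise limit; it yields both summability of
  the limit and convergence in norm.\<close>

instance ell1 :: (type) banach
proof
  fix X :: "nat \<Rightarrow> 'a ell1"
  assume X: "Cauchy X"
  define l where "l m = lim (\<lambda>n. coeff (X n) m)" for m
  have l: "(\<lambda>n. coeff (X n) m) \<longlonglongrightarrow> l m" for m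
    unfolding l_def using bounded_linear.Cauchy[OF bounded_linear_coeff X]
    using Cauchy_convergent convergent_LIMSEQ_iff by blast
  have tail: "\<exists>N. \<forall>n\<ge>N. \<forall>F. finite F \<longrightarrow> (\<Sum>m\<in>F. cmod (l m - coeff (X n) m)) \<le> e" if e: "e > 0" for e
  proof -
    obtain N where N: "\<And>m n. m \<ge> N \<Longrightarrow> n \<ge> N \<Longrightarrow> norm (X m - X n) < e"
      using X e unfolding Cauchy_iff by blast
    have "(\<Sum>m\<in>F. cmod (l m - coeff (X n) m)) \<le> e" if n: "n \<ge> N" and F: "finite F" for n F
    proof (rule tendsto_upperbound)
      show "(\<lambda>k. \<Sum>m\<in>F. cmod (coeff (X k) m - coeff (X n) m)) \<longlonglongrightarrow> (\<Sum>m\<in>F. cmod (l m - coeff (X n) m))"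
        by (intro tendsto_sum tendsto_norm tendsto_diff l tendsto_const)
      show "\<forall>\<^sub>F k in sequentially. (\<Sum>m\<in>F. cmod (coeff (X k) m - coeff (X n) m)) \<le> e"
      proof (rule eventually_sequentiallyI[of N])
        fix k assume k: "N \<le> k"
        have "(\<Sum>m\<in>F. cmod (coeff (X k) m - coeff (X n) m)) \<le> norm (X k - X n)"
          using sum_coeff_le_norm[OF F, of "X k - X n"] by (simp add: minus_ell1.rep_eq)
        also have "\<dots> \<le> e" using N[OF k n] by simp
        finally show "(\<Sum>m\<in>F. cmod (coeff (X k) m - coeff (X n) m)) \<le> e" .
      qed
    qed simp
    then show ?thesis by blast
  qed
  obtain N where N: "\<forall>n\<ge>N. \<forall>F. finite F \<longrightarrow> (\<Sum>m\<in>F. cmod (l m - coeff (X n) m)) \<le> 1"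
    using tail[of 1] by auto
  have "(\<lambda>m. cmod (l m - coeff (X N) m)) summable_on UNIV"
    unfolding abs_summable_iff_bdd_above using N by (intro bdd_aboveI2[where M = 1]) auto
  from summable_on_add[OF this coeff_abs_summable[of "X N"]] have "(\<lambda>m. cmod (l m)) summable_on UNIV"
    by (rule Infinite_Sum.abs_summable_on_comparison_test') (metis add.commute norm_triangle_sub)
  then obtain L where L: "coeff L = l"
    using Abs_ell1_inverse[of l] by blast
  have "X \<longlonglongrightarrow> L"
  proof (rule LIMSEQ_I)
    fix e :: real assume "e > 0"
    then obtain N where N: "\<And>n F. n \<ge> N \<Longrightarrow> finite F \<Longrightarrow> (\<Sum>m\<in>F. cmod (l m - coeff (X n) m)) \<le> e / 2"
      using tail[of "e / 2"] by auto
    have "norm (X n - L) \<le> e / 2" if "n \<ge> N" for n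
    proof -
      have "norm (L - X n) \<le> e / 2"
        unfolding norm_ell1.rep_eq
      proof (rule infsum_le_finite_sums)
        show "(\<lambda>m. cmod (coeff (L - X n) m)) summable_on UNIV" by simp
      qed (use N[OF that] in \<open>simp add: minus_ell1.rep_eq L\<close>)
      then show ?thesis by (simp add: norm_minus_commute)
    qed
    then show "\<exists>N. \<forall>n\<ge>N. norm (X n - L) < e"
      using \<open>e > 0\<close> by (intro exI[of _ N]) (force dest: order_le_less_trans)
  qed
  then show "convergent X" by (rule convergentI)
qed

subsection \<open>Convolution\<close>

text \<open>The duality between l1 and bounded weights \<open>w\<close>. An indicator as weight
  extracts a coefficient; a multiplicative weight gives a ring homomorphism.\<close>

definition pairing :: "'m ell1 \<Rightarrow> ('m \<Rightarrow> complex) \<Rightarrow> complex" where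
  "pairing f w = (\<Sum>\<^sub>\<infinity>m. coeff f m * w m)"

lemma pairing_abs_summable:
  assumes "\<And>m. cmod (w m) \<le> C"
  shows "(\<lambda>m. cmod (coeff f m * w m)) summable_on UNIV"
proof (rule Infinite_Sum.abs_summable_on_comparison_test')
  show "(\<lambda>m. cmod (coeff f m) * C) summable_on UNIV"
    by (intro summable_on_cmult_left) simp
qed (simp add: norm_mult mult_left_mono assms)

lemma norm_pairing_le:
  assumes "\<And>m. cmod (w m) \<le> C"
  shows "cmod (pairing f w) \<le> norm f * C"
proof -
  have "cmod (pairing f w) \<le> (\<Sum>\<^sub>\<infinity>m. cmod (coeff f m * w m))"
    unfolding pairing_def by (rule norm_infsum_bound[OF pairing_abs_summable[OF assms]])
  also have "\<dots> \<le> (\<Sum>\<^sub>\<infinity>m. cmod (coeff f m) * C)"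
    by (intro infsum_mono pairing_abs_summable[OF assms] summable_on_cmult_left)
      (simp_all add: norm_mult mult_left_mono assms)
  also have "\<dots> = norm f * C"
    by (simp add: infsum_cmult_left' norm_ell1.rep_eq)
  finally show ?thesis .
qed

lemma pairing_add:
  assumes "\<And>m. cmod (w m) \<le> C"
  shows "pairing (f + g) w = pairing f w + pairing g w"
  unfolding pairing_def plus_ell1.rep_eq distrib_right
  by (intro infsum_add abs_summable_summable[OF pairing_abs_summable[OF assms]])

lemma pairing_scaleR: "pairing (r *\<^sub>R f) w = r *\<^sub>R pairing f w"
  unfolding pairing_def scaleR_ell1.rep_eq by (simp add: scaleR_conv_of_real mult.assoc infsum_cmult_right')

lemma bounded_linear_pairing:
  assumes "\<And>m. cmod (w m) \<le> C"
  shows "bounded_linear (\<lambda>f. pairing f w)"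
  by (rule bounded_linear_intro[where K = C])
    (simp_all add: pairing_add[OF assms] pairing_scaleR norm_pairing_le[OF assms])

lemma pairing_point: "pairing f (\<lambda>m. of_bool (m = k)) = coeff f k"
proof -
  have "pairing f (\<lambda>m. of_bool (m = k)) = (\<Sum>\<^sub>\<infinity>m\<in>{k}. coeff f m * of_bool (m = k))"
    unfolding pairing_def by (rule infsum_cong_neutral) auto
  then show ?thesis by simp
qed

lemma prod_abs_summable:
  fixes f g :: "'m ell1"
  shows "(\<lambda>(p, p'). cmod (coeff f p * coeff g p')) summable_on UNIV"
  unfolding UNIV_Times_UNIV[symmetric]
  by (rule summable_on_SigmaI[where g = "\<lambda>p. cmod (coeff f p) * norm g"])
    (simp_all add: norm_mult norm_ell1.rep_eq has_sum_cmult_right summable_on_cmult_left)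

lemma has_sum_if_eq:
  fixes c :: "'a \<Rightarrow> 'b :: {comm_monoid_add, t2_space}"
  shows "((\<lambda>m. if m = k then c m else 0) has_sum c k) UNIV"
  by (rule has_sum_finite_neutralI[of "{k}"]) auto

text \<open>Spreading the product over triples concentrated on m = p + p' prepares the exchange of
  the sums over m and over pairs.\<close>

lemma conv_abs_summable:
  fixes f g :: "'m::comm_monoid_add ell1"
  assumes "\<And>m. cmod (w m) \<le> C"
  shows "(\<lambda>(m, (p, p')). cmod (coeff f p * coeff g p' * (if m = p + p' then w m else 0))) summable_on UNIV \<times> UNIV"
proof -
  have "0 \<le> C" using assms order_trans norm_ge_zero by blast
  have "(\<lambda>(x, m). case x of (p, p') \<Rightarrow> if m = p + p' then cmod (coeff f p * coeff g p') * C else 0)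
      summable_on UNIV \<times> UNIV" (is "?h summable_on _")
  proof (rule summable_on_SigmaI[where g = "\<lambda>(p, p'). cmod (coeff f p * coeff g p') * C"])
    show "(\<lambda>(p, p'). cmod (coeff f p * coeff g p') * C) summable_on UNIV"
      using summable_on_cmult_left[OF prod_abs_summable[of f g], of C] by (simp add: case_prod_unfold)
    show "((\<lambda>m. ?h (x, m)) has_sum (case x of (p, p') \<Rightarrow> cmod (coeff f p * coeff g p') * C)) UNIV" for x
      by (cases x) (simp, rule has_sum_if_eq[where c = "\<lambda>_. _"])
  qed (use \<open>0 \<le> C\<close> in \<open>auto split: prod.splits\<close>)
  then have "(\<lambda>(m, x). case x of (p, p') \<Rightarrow> if m = p + p' then cmod (coeff f p * coeff g p') * C else 0)
      summable_on UNIV \<times> UNIV"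
    by (subst (asm) summable_on_swap) (simp add: case_prod_unfold cong: if_cong)
  then show ?thesis
    by (rule summable_on_comparison_test) (auto simp: norm_mult mult_left_mono assms split: prod.splits)
qed

lift_definition delta :: "'m \<Rightarrow> complex \<Rightarrow> 'm ell1" is "\<lambda>k c m. if m = k then c else 0"
proof -
  fix k :: 'm and c :: complex
  have "((\<lambda>m. if m = k then cmod c else 0) has_sum cmod c) UNIV"
    by (rule has_sum_if_eq)
  then show "(\<lambda>m. cmod (if m = k then c else 0)) summable_on UNIV"
    by (simp add: summable_on_def if_distrib[of cmod] cong: if_cong) blast
qed

lemma norm_delta [simp]: "norm (delta k c) = cmod c"
  using has_sum_if_eq[of k "\<lambda>_. cmod c"]
  by (simp add: norm_ell1.rep_eq delta.rep_eq if_distrib[of cmod] infsumI cong: if_cong)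

lemma pairing_delta: "pairing (delta k c) w = c * w k"
  unfolding pairing_def delta.rep_eq using has_sum_if_eq[of k "\<lambda>m. c * w m"]
  by (simp add: infsumI if_distrib[of "\<lambda>x. x * _"] cong: if_cong)

instantiation ell1 :: (comm_monoid_add) "{times, one}"
begin

definition one_ell1 :: "'a ell1" where "one_ell1 = delta 0 1"

text \<open>The sum runs over all pairs with an indicator, because in a general monoid infinitely
  many pairs may have the same sum m.\<close>

lift_definition times_ell1 :: "'a ell1 \<Rightarrow> 'a ell1 \<Rightarrow> 'a ell1" is
  "\<lambda>f g m. infsum (\<lambda>(p, p'). f p * g p' * (if m = p + p' then 1 else 0)) UNIV"
proof -
  fix f g :: "'a \<Rightarrow> complex"
  assume "(\<lambda>m. cmod (f m)) summable_on UNIV" "(\<lambda>m. cmod (g m)) summable_on UNIV"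
  then obtain f' g' where fg: "f = coeff f'" "g = coeff g'"
    by (metis Abs_ell1_inverse mem_Collect_eq)
  define h where "h = (\<lambda>(m, p, p'). f p * g p' * (if m = p + p' then 1 else 0 :: complex))"
  have "(\<lambda>x. norm (h x)) summable_on UNIV \<times> UNIV"
    unfolding h_def fg using conv_abs_summable[of "\<lambda>_. 1" 1 f' g'] by (simp add: case_prod_unfold)
  from Infinite_Sum.abs_summable_on_Sigma_iff[THEN iffD1, OF this]
  have *: "\<And>m. (\<lambda>x. norm (h (m, x))) summable_on UNIV"
    and **: "(\<lambda>m. norm (infsum (\<lambda>x. norm (h (m, x))) UNIV)) summable_on UNIV" by auto
  have "(\<lambda>m. norm (infsum (\<lambda>x. h (m, x)) UNIV)) summable_on UNIV"
    using norm_infsum_bound[OF *]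
    by (intro Infinite_Sum.abs_summable_on_comparison_test'[OF **]) (simp add: order_trans[OF _ abs_ge_self])
  then show "(\<lambda>m. cmod (infsum (\<lambda>(p, p'). f p * g p' * (if m = p + p' then 1 else 0)) UNIV)) summable_on UNIV"
    by (simp add: h_def case_prod_unfold)
qed

instance ..

end

text \<open>All ring laws follow from this identity, applied to indicator functions.\<close>

lemma pairing_times:
  fixes f g :: "'m::comm_monoid_add ell1"
  assumes w: "\<And>m. cmod (w m) \<le> C"
  shows "pairing (f * g) w = pairing f (\<lambda>p. pairing g (\<lambda>p'. w (p + p')))"
proof -
  have "pairing (f * g) w = (\<Sum>\<^sub>\<infinity>m. \<Sum>\<^sub>\<infinity>x. case x of (p, p') \<Rightarrow> coeff f p * coeff g p' * (if m = p + p' then w m else 0))"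
    unfolding pairing_def times_ell1.rep_eq
    by (intro infsum_cong, unfold infsum_cmult_left'[symmetric], intro infsum_cong) (auto split: prod.splits)
  also have "\<dots> = (\<Sum>\<^sub>\<infinity>x. \<Sum>\<^sub>\<infinity>m. case x of (p, p') \<Rightarrow> coeff f p * coeff g p' * (if m = p + p' then w m else 0))"
  proof (rule infsum_swap_banach)
    let ?h = "\<lambda>(m, x). case x of (p, p') \<Rightarrow> coeff f p * coeff g p' * (if m = p + p' then w m else 0)"
    have "(\<lambda>y. norm (?h y)) summable_on UNIV \<times> UNIV"
      using conv_abs_summable[OF w, of f g] by (simp only: case_prod_unfold fst_conv snd_conv)
    then show "?h summable_on UNIV \<times> UNIV" by (rule abs_summable_summable)
  qed
  also have "\<dots> = (\<Sum>\<^sub>\<infinity>(p, p'). coeff f p * coeff g p' * w (p + p'))"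
  proof (rule infsum_cong)
    fix x :: "'m \<times> 'm"
    have "((\<lambda>m. if m = fst x + snd x then coeff f (fst x) * coeff g (snd x) * w m else 0) has_sum
      coeff f (fst x) * coeff g (snd x) * w (fst x + snd x)) UNIV"
      by (rule has_sum_if_eq)
    then show "(\<Sum>\<^sub>\<infinity>m. case x of (p, p') \<Rightarrow> coeff f p * coeff g p' * (if m = p + p' then w m else 0)) =
      (case x of (p, p') \<Rightarrow> coeff f p * coeff g p' * w (p + p'))"
      by (simp add: infsumI case_prod_unfold if_distrib[of "\<lambda>x. _ * x"] cong: if_cong)
  qed
  also have "\<dots> = (\<Sum>\<^sub>\<infinity>p. \<Sum>\<^sub>\<infinity>p'. coeff f p * coeff g p' * w (p + p'))"
  proof -
    have "(\<lambda>(p, p'). cmod (coeff f p * coeff g p') * C) summable_on UNIV"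
      using summable_on_cmult_left[OF prod_abs_summable[of f g], of C] by (simp add: case_prod_unfold)
    then have "(\<lambda>x. norm (case x of (p, p') \<Rightarrow> coeff f p * coeff g p' * w (p + p'))) summable_on UNIV"
      by (rule Infinite_Sum.abs_summable_on_comparison_test') (auto simp: norm_mult mult_left_mono w)
    then show ?thesis
      using infsum_Sigma'_banach[of "\<lambda>p p'. coeff f p * coeff g p' * w (p + p')" UNIV "\<lambda>_. UNIV"]
      by (simp add: abs_summable_summable)
  qed
  also have "\<dots> = pairing f (\<lambda>p. pairing g (\<lambda>p'. w (p + p')))"
    unfolding pairing_def infsum_cmult_right'[symmetric] by (intro infsum_cong) (simp add: mult.assoc)
  finally show ?thesis .
qed

text \<open>The same double sum in the other order (Fubini); this is the source of
  commutativity.\<close>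

lemma pairing_times_swap:
  fixes f g :: "'m::comm_monoid_add ell1"
  assumes w: "\<And>m. cmod (w m) \<le> C"
  shows "pairing (f * g) w = pairing g (\<lambda>p'. pairing f (\<lambda>p. w (p + p')))"
proof -
  have "(\<lambda>(p, p'). cmod (coeff f p * coeff g p') * C) summable_on UNIV"
    using summable_on_cmult_left[OF prod_abs_summable[of f g], of C] by (simp add: case_prod_unfold)
  then have "(\<lambda>x. norm (case x of (p, p') \<Rightarrow> coeff f p * coeff g p' * w (p + p'))) summable_on UNIV"
    by (rule Infinite_Sum.abs_summable_on_comparison_test') (auto simp: norm_mult mult_left_mono w)
  then have "(\<Sum>\<^sub>\<infinity>p. \<Sum>\<^sub>\<infinity>p'. coeff f p * coeff g p' * w (p + p')) =
    (\<Sum>\<^sub>\<infinity>p'. \<Sum>\<^sub>\<infinity>p. coeff f p * coeff g p' * w (p + p'))"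
    by (intro infsum_swap_banach) (simp add: abs_summable_summable)
  moreover have "(\<Sum>\<^sub>\<infinity>p. coeff f p * coeff g p' * w (p + p')) =
      coeff g p' * pairing f (\<lambda>p. w (p + p'))" for p'
    unfolding pairing_def infsum_cmult_right'[symmetric] by (intro infsum_cong) simp
  moreover have "(\<Sum>\<^sub>\<infinity>p'. coeff f p * coeff g p' * w (p + p')) =
      coeff f p * pairing g (\<lambda>p'. w (p + p'))" for p
    unfolding pairing_def infsum_cmult_right'[symmetric] by (intro infsum_cong) simp
  ultimately have "(\<Sum>\<^sub>\<infinity>p. coeff f p * pairing g (\<lambda>p'. w (p + p'))) =
      (\<Sum>\<^sub>\<infinity>p'. coeff g p' * pairing f (\<lambda>p. w (p + p')))" by simp
  then show ?thesis
    unfolding pairing_times[OF w] by (subst (1 3) pairing_def)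
qed

lemma ell1_eqI_pairing:
  assumes "\<And>w. (\<And>m. cmod (w m) \<le> 1) \<Longrightarrow> pairing f w = pairing g w"
  shows "f = g"
proof (rule ell1_eqI)
  show "coeff f m = coeff g m" for m
    using assms[of "\<lambda>n. of_bool (n = m)"] by (simp add: pairing_point)
qed

lemma pairing_one: "pairing (1 :: 'm::comm_monoid_add ell1) w = w 0"
  by (simp add: one_ell1_def pairing_delta)

instance ell1 :: (comm_monoid_add) "{comm_ring_1, real_normed_algebra_1}"
proof
  fix f g h :: "'a ell1" and r :: real
  show fg: "f * g = g * f" for f g :: "'a ell1"
    by (rule ell1_eqI_pairing) (simp add: pairing_times[of _ 1 f g] pairing_times_swap[of _ 1 g f] add.commute)
  show "f * g * h = f * (g * h)"
  proof (rule ell1_eqI_pairing)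
    fix w :: "'a \<Rightarrow> complex" assume w: "\<And>m. cmod (w m) \<le> 1"
    have "cmod (pairing h (\<lambda>m. w (p + m))) \<le> norm h" for p
      using norm_pairing_le[of "\<lambda>m. w (p + m)" 1 h] w by simp
    then show "pairing (f * g * h) w = pairing (f * (g * h)) w"
      by (simp add: pairing_times[OF w] pairing_times[of "\<lambda>p. pairing h (\<lambda>m. w (p + m))" "norm h"]
          pairing_times[of "\<lambda>m. w (_ + m)" 1] w add.assoc)
  qed
  show one: "1 * f = f" for f :: "'a ell1"
    by (rule ell1_eqI_pairing) (simp add: pairing_times[of _ 1] pairing_one)
  show dist: "(f + g) * h = f * h + g * h" for f g h :: "'a ell1"
  proof (rule ell1_eqI_pairing)
    fix w :: "'a \<Rightarrow> complex" assume w: "\<And>m. cmod (w m) \<le> 1"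
    have "cmod (pairing h (\<lambda>m. w (p + m))) \<le> norm h" for p
      using norm_pairing_le[of "\<lambda>m. w (p + m)" 1 h] w by simp
    then show "pairing ((f + g) * h) w = pairing (f * h + g * h) w"
      by (simp add: pairing_times[OF w] pairing_add[OF w] pairing_add[of _ "norm h"])
  qed
  show "f * (g + h) = f * g + f * h" by (simp add: fg[of f] dist)
  show "f * 1 = f" by (simp add: fg[of f] one)
  show scale: "(r *\<^sub>R f) * g = r *\<^sub>R (f * g)" for f g :: "'a ell1"
    by (rule ell1_eqI_pairing) (simp add: pairing_times[of _ 1] pairing_scaleR)
  show "f * (r *\<^sub>R g) = r *\<^sub>R (f * g)" by (simp add: fg[of f] scale)
  show "norm (1 :: 'a ell1) = 1" by (simp add: one_ell1_def)
  then show "(0 :: 'a ell1) \<noteq> 1" by (metis norm_zero zero_neq_one)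
  show "norm (f * g) \<le> norm f * norm g"
  proof -
    \<comment> \<open>Conjugate signs attain the l1 norm in the duality, which reduces
      submultiplicativity to two applications of the bound on a pairing.\<close>
    define w where "w m = cnj (sgn (coeff (f * g) m))" for m
    have w: "cmod (w m) \<le> 1" for m by (simp add: w_def norm_sgn)
    have "complex_of_real (norm (f * g)) = pairing (f * g) w"
    proof -
      have "coeff (f * g) m * w m = of_real (cmod (coeff (f * g) m))" for m
        by (simp add: w_def sgn_eq complex_norm_square[symmetric] power2_eq_square)
      then have "pairing (f * g) w = (\<Sum>\<^sub>\<infinity>m. complex_of_real (cmod (coeff (f * g) m)))"
        by (simp add: pairing_def)
      also have "\<dots> = of_real (norm (f * g))"
        unfolding norm_ell1.rep_eq by (intro infsumI has_sum_of_real has_sum_infsum) simp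
      finally show ?thesis by simp
    qed
    also have "cmod \<dots> \<le> norm f * norm g"
      unfolding pairing_times[OF w]
      using norm_pairing_le[of "\<lambda>m. w (_ + m)" 1 g] w by (intro norm_pairing_le) auto
    finally show ?thesis by simp
  qed
qed

text \<open>The factor w p leaves the inner pairing. Evaluation at a point whose coordinates have
  modulus at most 1 is of this kind.\<close>

lemma pairing_character:
  fixes f g :: "'m::comm_monoid_add ell1"
  assumes "\<And>m. cmod (w m) \<le> 1" "\<And>p p'. w (p + p') = w p * w p'"
  shows "pairing (f * g) w = pairing f w * pairing g w"
proof -
  have "pairing g (\<lambda>p'. w p * w p') = w p * pairing g w" for p
    unfolding pairing_def infsum_cmult_right'[symmetric] by (intro infsum_cong) simp
  then show ?thesis
    unfolding pairing_times[OF assms(1)] assms(2)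
    by (simp add: pairing_def[of f] infsum_cmult_left'[symmetric] mult.assoc)
qed

text \<open>If 0 splits only trivially, its indicator is a multiplicative weight.\<close>

lemma coeff_times_zero:
  fixes f g :: "'m::comm_monoid_add ell1"
  assumes "\<And>p p' :: 'm. p + p' = 0 \<longleftrightarrow> p = 0 \<and> p' = 0"
  shows "coeff (f * g) 0 = coeff f 0 * coeff g 0"
  using pairing_character[of "\<lambda>m. of_bool (m = 0)" f g] by (simp add: pairing_point assms of_bool_conj)

text \<open>The Leibniz rule at an indecomposable index. With \<open>X_var v\<close> for
  \<open>e\<close> it computes first derivatives at the origin.\<close>

lemma coeff_times_atom:
  fixes f g :: "'m::comm_monoid_add ell1"
  assumes e: "\<And>p p' :: 'm. p + p' = e \<longleftrightarrow> p = 0 \<and> p' = e \<or> p = e \<and> p' = 0" "e \<noteq> 0"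
  shows "coeff (f * g) e = coeff f 0 * coeff g e + coeff f e * coeff g 0"
proof -
  have "coeff (f * g) e = pairing f (\<lambda>p. pairing g (\<lambda>p'. of_bool (p + p' = e)))"
    by (simp add: pairing_times[of _ 1] flip: pairing_point)
  also have "\<dots> = (\<Sum>\<^sub>\<infinity>p\<in>{0, e}. coeff f p * pairing g (\<lambda>p'. of_bool (p + p' = e)))"
    unfolding pairing_def by (intro infsum_cong_neutral) (auto simp: e)
  also have "\<dots> = coeff f 0 * coeff g e + coeff f e * coeff g 0"
    using e(2) by (simp add: e(1) pairing_point)
  finally show ?thesis .
qed

subsection \<open>Lipschitz estimates in commutative Banach algebras\<close>

lemma norm_power_diff_le:
  fixes x y :: "'a::{real_normed_algebra_1,comm_ring_1}"
  assumes "norm x \<le> K" "norm y \<le> K"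
  shows "norm (x ^ n - y ^ n) \<le> real n * K ^ (n - 1) * norm (x - y)"
proof (induction n)
  case (Suc n)
  have K: "0 \<le> K" using assms(1) norm_ge_zero order_trans by blast
  have "x ^ Suc n - y ^ Suc n = x * (x ^ n - y ^ n) + (x - y) * y ^ n"
    by (simp add: algebra_simps)
  also have "norm \<dots> \<le> norm x * norm (x ^ n - y ^ n) + norm (x - y) * norm (y ^ n)"
    by (intro norm_triangle_le add_mono norm_mult_ineq)
  also have "\<dots> \<le> K * (real n * K ^ (n - 1) * norm (x - y)) + norm (x - y) * K ^ n"
    using assms Suc K
    by (intro add_mono mult_mono order_trans[OF norm_power_ineq power_mono]) auto
  also have "\<dots> = real (Suc n) * K ^ (Suc n - 1) * norm (x - y)"
    by (cases n) (simp_all add: algebra_simps)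
  finally show ?case .
qed simp

text \<open>Without the linear term the Lipschitz bound is the sum of K^(n-1)/(n-1)! over n >= 2,
  that is exp K - 1, which is small with K. The equation for the modulus is arranged so that only
  this remainder of exp occurs in it.\<close>

lemma norm_exp_minus_id_diff_le:
  fixes x y :: "'a::{real_normed_algebra_1,banach,comm_ring_1}"
  assumes "norm x \<le> K" "norm y \<le> K"
  shows "norm ((exp x - x) - (exp y - y)) \<le> (exp K - 1) * norm (x - y)"
proof -
  have K: "0 \<le> K" using assms(1) norm_ge_zero order_trans by blast
  let ?f = "\<lambda>n. (x ^ n - y ^ n) /\<^sub>R fact n"
  have "?f sums (exp x - exp y)"
    unfolding scaleR_diff_right exp_def by (intro sums_diff summable_sums summable_exp_generic)
  from sums_split_initial_segment[OF this, of 2]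
  have f: "(\<lambda>n. ?f (n + 2)) sums ((exp x - x) - (exp y - y))"
    by (simp add: numeral_2_eq_2 algebra_simps)
  have "(\<lambda>n. K ^ n /\<^sub>R fact n) sums exp K"
    unfolding exp_def by (intro summable_sums summable_exp_generic)
  from sums_mult2[OF sums_split_initial_segment[OF this, of 1], of "norm (x - y)"]
  have g: "(\<lambda>n. K ^ (n + 1) /\<^sub>R fact (n + 1) * norm (x - y)) sums ((exp K - 1) * norm (x - y))"
    by simp
  have "norm (?f (n + 2)) \<le> K ^ (n + 1) /\<^sub>R fact (n + 1) * norm (x - y)" for n
  proof -
    have "norm (?f (n + 2)) = norm (x ^ (n + 2) - y ^ (n + 2)) / fact (n + 2)"
      by (simp add: divide_inverse)
    also have "\<dots> \<le> (real (n + 2) * K ^ (n + 2 - 1) * norm (x - y)) / fact (n + 2)"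
      by (intro divide_right_mono norm_power_diff_le assms) simp
    also have "\<dots> = K ^ (n + 1) /\<^sub>R fact (n + 1) * norm (x - y)"
      by (simp add: divide_simps del: of_nat_Suc of_nat_add power_Suc)
    finally show ?thesis .
  qed
  with f g show ?thesis by (rule norm_sums_le)
qed

lemma norm_exp_diff_le:
  fixes x y :: "'a::{real_normed_algebra_1,banach,comm_ring_1}"
  assumes "norm x \<le> K" "norm y \<le> K"
  shows "norm (exp x - exp y) \<le> exp K * norm (x - y)"
proof -
  have "norm (exp x - exp y) \<le> norm ((exp x - x) - (exp y - y)) + norm (x - y)"
    using norm_triangle_ineq[of "(exp x - x) - (exp y - y)" "x - y"] by (simp add: algebra_simps)
  then show ?thesis using norm_exp_minus_id_diff_le[OF assms] by (simp add: algebra_simps)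
qed

subsection \<open>The double series\<close>

text \<open>\<open>a_tilde\<close> with the conjugate variable made independent, so that it makes
  sense in an algebra without conjugation and commutes with homomorphisms.\<close>

definition double_series :: "nat \<Rightarrow> (nat \<times> nat \<Rightarrow> 'a) \<Rightarrow> 'a \<Rightarrow> 'a \<Rightarrow> 'a::{real_normed_algebra_1,banach,comm_ring_1}"
  where "double_series s a Z W = (\<Sum>\<^sub>\<infinity>(i,j)\<in>{(i,j). 2 * s < i + j}. a (i,j) * Z ^ i * W ^ j)"

lemma double_geometric:
  "((\<lambda>(i,j). (1/4) ^ i * (1/4) ^ j) has_sum (16/9 :: real)) (UNIV \<times> UNIV)"
proof -
  have geo: "((\<lambda>i. (1/4) ^ i) has_sum (4/3 :: real)) UNIV"
    using geometric_sums[of "1/4 :: real"] by (intro sums_nonneg_imp_has_sum) auto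
  have inner: "((\<lambda>j. (1/4) ^ i * (1/4) ^ j) has_sum ((1/4) ^ i * (4/3 :: real))) UNIV" for i
    by (rule has_sum_cmult_right[OF geo])
  have outer: "((\<lambda>i. (1/4) ^ i * (4/3 :: real)) has_sum (4/3 * (4/3))) UNIV"
    by (rule has_sum_cmult_left[OF geo])
  show ?thesis
  proof (rule has_sum_SigmaI[where g = "\<lambda>i. (1/4) ^ i * (4/3)"])
    show "(\<lambda>(i,j). (1/4) ^ i * (1/4) ^ j :: real) summable_on UNIV \<times> UNIV"
    proof (rule summable_on_SigmaI[OF _ has_sum_imp_summable[OF outer]])
      show "((\<lambda>j. case (i, j) of (i,j) \<Rightarrow> (1/4) ^ i * (1/4) ^ j) has_sum (1/4) ^ i * (4/3 :: real)) UNIV" for i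
        using inner[of i] by simp
    qed auto
    show "((\<lambda>j. case (i, j) of (i,j) \<Rightarrow> (1/4) ^ i * (1/4) ^ j) has_sum (1/4) ^ i * (4/3 :: real)) UNIV" for i
      using inner[of i] by simp
  qed (use outer in auto)
qed

lemma double_geometric_subset:
  "(\<lambda>(i,j). (1/4) ^ i * (1/4) ^ j :: real) summable_on A"
  "(\<Sum>\<^sub>\<infinity>(i,j)\<in>A. (1/4) ^ i * (1/4) ^ j :: real) \<le> 2"
proof -
  show *: "(\<lambda>(i,j). (1/4) ^ i * (1/4) ^ j :: real) summable_on A"
    using summable_on_subset_banach[OF has_sum_imp_summable[OF double_geometric], of A] by auto
  have "(\<Sum>\<^sub>\<infinity>(i,j)\<in>A. (1/4) ^ i * (1/4) ^ j :: real) \<le> (\<Sum>\<^sub>\<infinity>(i,j)\<in>UNIV \<times> UNIV. (1/4) ^ i * (1/4) ^ j)"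
    using * has_sum_imp_summable[OF double_geometric] by (rule infsum_mono2) auto
  also have "\<dots> = 16/9" by (rule infsumI[OF double_geometric])
  finally show "(\<Sum>\<^sub>\<infinity>(i,j)\<in>A. (1/4) ^ i * (1/4) ^ j :: real) \<le> 2" by simp
qed

lemma double_series_summable:
  fixes Z W :: "'a::{real_normed_algebra_1,banach,comm_ring_1}"
  assumes "\<And>v. norm (a v) \<le> 1" "norm Z \<le> 1/8" "norm W \<le> 1/8"
  shows "(\<lambda>(i,j). a (i,j) * Z ^ i * W ^ j) summable_on A"
proof (rule abs_summable_summable, rule Infinite_Sum.abs_summable_on_comparison_test'[OF double_geometric_subset(1)])
  fix x :: "nat \<times> nat"
  obtain i j where x: "x = (i, j)" by (cases x)
  have "norm (a (i,j) * Z ^ i * W ^ j) \<le> norm (a (i,j)) * norm Z ^ i * norm W ^ j"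
    by (intro order_trans[OF norm_mult_ineq] mult_mono norm_power_ineq) auto
  also have "\<dots> \<le> 1 * (1/4) ^ i * (1/4) ^ j"
    using assms by (intro mult_mono power_mono) auto
  finally show "norm (case x of (i,j) \<Rightarrow> a (i,j) * Z ^ i * W ^ j) \<le> (case x of (i,j) \<Rightarrow> (1/4) ^ i * (1/4) ^ j)"
    by (simp add: x)
qed

lemma norm_monomial_diff_le:
  fixes Z W Z' W' :: "'a::{real_normed_algebra_1,comm_ring_1}"
  assumes "norm Z \<le> K" "norm W \<le> K" "norm Z' \<le> K" "norm W' \<le> K"
  shows "norm (Z ^ i * W ^ j - Z' ^ i * W' ^ j)
    \<le> real (i + j) * K ^ (i + j - 1) * (norm (Z - Z') + norm (W - W'))"
proof -
  have K: "0 \<le> K" using assms(1) norm_ge_zero order_trans by blast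
  have "Z ^ i * W ^ j - Z' ^ i * W' ^ j = (Z ^ i - Z' ^ i) * W ^ j + Z' ^ i * (W ^ j - W' ^ j)"
    by (simp add: algebra_simps)
  also have "norm \<dots> \<le> norm (Z ^ i - Z' ^ i) * norm (W ^ j) + norm (Z' ^ i) * norm (W ^ j - W' ^ j)"
    by (intro norm_triangle_le add_mono norm_mult_ineq)
  also have "\<dots> \<le> (real i * K ^ (i - 1) * norm (Z - Z')) * K ^ j + K ^ i * (real j * K ^ (j - 1) * norm (W - W'))"
    using assms K
    by (intro add_mono mult_mono norm_power_diff_le order_trans[OF norm_power_ineq power_mono]) auto
  also have "\<dots> = real i * K ^ (i + j - 1) * norm (Z - Z') + real j * K ^ (i + j - 1) * norm (W - W')"
    by (cases i; cases j) (simp_all add: power_add algebra_simps)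
  also have "\<dots> \<le> real (i + j) * K ^ (i + j - 1) * norm (Z - Z') + real (i + j) * K ^ (i + j - 1) * norm (W - W')"
    using K by (intro add_mono mult_right_mono) auto
  finally show ?thesis by (simp add: algebra_simps)
qed

text \<open>Put n = i + j and l = n - 2s - 1. For K <= 1/8 the factor n K^(n-1) is at most K^(2s)
  2^n 8^(-l) = 8^(2s+1) K^(2s) 4^(-n), and the sum of 4^(-i) 4^(-j) is 16/9, rounded up to
  2.\<close>

definition lip_const :: "nat \<Rightarrow> real" where "lip_const s = 2 * 8 ^ (2 * s + 1)"

lemma lip_const_pos: "lip_const s > 0"
  by (simp add: lip_const_def)

lemma double_series_diff_le:
  fixes Z W Z' W' :: "'a::{real_normed_algebra_1,banach,comm_ring_1}"
  assumes a: "\<And>v. norm (a v) \<le> 1"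
    and K: "norm Z \<le> K" "norm W \<le> K" "norm Z' \<le> K" "norm W' \<le> K" "K \<le> 1/8"
  shows "norm (double_series s a Z W - double_series s a Z' W')
    \<le> lip_const s * K ^ (2 * s) * (norm (Z - Z') + norm (W - W'))"
proof -
  let ?A = "{(i,j). 2 * s < i + j}" and ?d = "norm (Z - Z') + norm (W - W')"
  have K0: "0 \<le> K" using K(1) norm_ge_zero order_trans by blast
  let ?t = "\<lambda>(i,j). a (i,j) * Z ^ i * W ^ j - a (i,j) * Z' ^ i * W' ^ j"
  let ?g = "\<lambda>(i,j). (1/4) ^ i * (1/4) ^ j :: real"
  have t: "norm (?t x) \<le> K ^ (2 * s) * 8 ^ (2 * s + 1) * ?d * ?g x" if "x \<in> ?A" for x
  proof -
    obtain i j where x: "x = (i, j)" by (cases x)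
    with that have ij: "2 * s < i + j" by simp
    then obtain l where l: "i + j = 2 * s + 1 + l"
      by (metis Suc_eq_plus1 Suc_leI le_iff_add)
    have "norm (?t x) = norm (a (i,j) * (Z ^ i * W ^ j - Z' ^ i * W' ^ j))"
      by (simp add: x algebra_simps)
    also have "\<dots> \<le> norm (a (i,j)) * norm (Z ^ i * W ^ j - Z' ^ i * W' ^ j)" by (rule norm_mult_ineq)
    also have "\<dots> \<le> 1 * (real (i + j) * K ^ (i + j - 1) * ?d)"
      using a K by (intro mult_mono norm_monomial_diff_le) auto
    also have "\<dots> = (real (i + j) * K ^ l) * (K ^ (2 * s) * ?d)"
      by (simp add: l power_add)
    also have "\<dots> \<le> (2 ^ (i + j) * (1/8) ^ l) * (K ^ (2 * s) * ?d)"
      using K0 K less_imp_le[OF of_nat_less_two_power[of "i + j", where 'a = real]]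
      by (intro mult_right_mono mult_mono power_mono) auto
    also have "(2 :: real) ^ (i + j) * (1/8) ^ l = 8 ^ (2 * s + 1) * ((2 * (1/8)) ^ (i + j))"
      unfolding power_mult_distrib unfolding l by (simp add: power_add power_divide)
    also have "((2 :: real) * (1/8)) ^ (i + j) = ?g x" by (simp add: x power_add)
    finally show ?thesis by (simp add: mult_ac)
  qed
  have g: "(\<lambda>x. K ^ (2 * s) * 8 ^ (2 * s + 1) * ?d * ?g x) summable_on ?A"
    by (intro summable_on_cmult_right double_geometric_subset)
  have "norm Z \<le> 1/8" "norm W \<le> 1/8" "norm Z' \<le> 1/8" "norm W' \<le> 1/8" using K by auto
  note sm = double_series_summable[of a, OF a this(1,2), of ?A] double_series_summable[of a, OF a this(3,4), of ?A]
  have "double_series s a Z W - double_series s a Z' W' = infsum ?t ?A"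
    unfolding double_series_def
    using has_sum_add[OF has_sum_infsum[OF sm(1)] has_sum_uminusI[OF has_sum_infsum[OF sm(2)]]]
    by (simp add: case_prod_unfold infsumI)
  then have "norm (double_series s a Z W - double_series s a Z' W') = norm (infsum ?t ?A)" by simp
  moreover have le: "norm (infsum ?t ?A) \<le> (\<Sum>\<^sub>\<infinity>x\<in>?A. K ^ (2 * s) * 8 ^ (2 * s + 1) * ?d * ?g x)"
  proof (rule norm_infsum_le)
    have "?t summable_on ?A"
      by (rule abs_summable_summable, rule Infinite_Sum.abs_summable_on_comparison_test'[OF g t])
    then show "(?t has_sum infsum ?t ?A) ?A" by (rule has_sum_infsum)
    show "((\<lambda>x. K ^ (2 * s) * 8 ^ (2 * s + 1) * ?d * ?g x) has_sum
        (\<Sum>\<^sub>\<infinity>x\<in>?A. K ^ (2 * s) * 8 ^ (2 * s + 1) * ?d * ?g x)) ?A"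
      by (rule has_sum_infsum[OF g])
  qed (rule t)
  moreover have "K ^ (2 * s) * 8 ^ (2 * s + 1) * ?d * infsum ?g ?A \<le> K ^ (2 * s) * 8 ^ (2 * s + 1) * ?d * 2"
    using K0 by (intro mult_left_mono double_geometric_subset) auto
  ultimately have "norm (double_series s a Z W - double_series s a Z' W') \<le> K ^ (2 * s) * 8 ^ (2 * s + 1) * ?d * 2"
    using le[unfolded infsum_cmult_right'] by linarith
  then show ?thesis by (simp add: lip_const_def mult_ac)
qed

lemma double_series_zero [simp]: "double_series s a 0 0 = 0"
proof -
  have "double_series s a 0 0 = (\<Sum>\<^sub>\<infinity>x\<in>{(i,j). 2 * s < i + j}. 0)"
    unfolding double_series_def by (intro infsum_cong) (auto simp: power_0_left)
  then show ?thesis by simp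
qed

lemma norm_double_series_le:
  fixes Z W :: "'a::{real_normed_algebra_1,banach,comm_ring_1}"
  assumes "\<And>v. norm (a v) \<le> 1" "norm Z \<le> K" "norm W \<le> K" "K \<le> 1/8"
  shows "norm (double_series s a Z W) \<le> 2 * lip_const s * K ^ (2 * s + 1)"
proof -
  have K0: "0 \<le> K" using assms(2) norm_ge_zero order_trans by blast
  have "norm (double_series s a Z W) \<le> lip_const s * K ^ (2 * s) * (norm Z + norm W)"
    using double_series_diff_le[of a Z K W 0 0 s] assms K0 by simp
  also have "\<dots> \<le> lip_const s * K ^ (2 * s) * (K + K)"
    using assms K0 lip_const_pos[of s] by (intro mult_left_mono add_mono) auto
  finally show ?thesis by (simp add: mult_ac)
qed

lemma double_series_homomorphism:
  fixes h :: "'a::{real_normed_algebra_1,banach,comm_ring_1} \<Rightarrow> 'b::{real_normed_algebra_1,banach,comm_ring_1}"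
  assumes "bounded_linear h" "\<And>x y. h (x * y) = h x * h y" "h 1 = 1"
    and "\<And>v. norm (a v) \<le> 1" "norm Z \<le> 1/8" "norm W \<le> 1/8"
  shows "h (double_series s a Z W) = double_series s (\<lambda>v. h (a v)) (h Z) (h W)"
proof -
  have pow: "h (x ^ n) = h x ^ n" for x n
    by (induction n) (simp_all add: assms)
  have "((\<lambda>x. h (case x of (i,j) \<Rightarrow> a (i,j) * Z ^ i * W ^ j)) has_sum h (double_series s a Z W)) {(i,j). 2 * s < i + j}"
    unfolding double_series_def
    by (intro has_sum_bounded_linear[OF assms(1)] has_sum_infsum double_series_summable assms)
  then show ?thesis
    unfolding double_series_def by (simp add: infsumI case_prod_unfold assms pow)
qed

lemma exp_homomorphism:
  fixes h :: "'a::{real_normed_algebra_1,banach} \<Rightarrow> 'b::{real_normed_algebra_1,banach}"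
  assumes "bounded_linear h" "\<And>x y. h (x * y) = h x * h y" "h 1 = 1"
  shows "h (exp x) = exp (h x)"
proof -
  have pow: "h (x ^ n) = h x ^ n" for n
    by (induction n) (simp_all add: assms)
  show ?thesis
    unfolding exp_def using bounded_linear.suminf[OF assms(1) summable_exp_generic[of x]]
    by (simp add: linear_scale[OF bounded_linear.linear[OF assms(1)]] pow)
qed

subsection \<open>A contraction principle for finite tuples\<close>

text \<open>A tuple is a function of which only the arguments up to N count; the common bound
  \<open>d\<close> plays the part of the maximum norm.\<close>

lemma tuple_fixed_point_unique:
  fixes F :: "(nat \<Rightarrow> 'a::real_normed_vector) \<Rightarrow> nat \<Rightarrow> 'a"
  assumes contr: "\<And>\<xi> \<xi>' d m. \<lbrakk>\<And>m. m \<le> N \<Longrightarrow> norm (\<xi> m) \<le> \<eta>; \<And>m. m \<le> N \<Longrightarrow> norm (\<xi>' m) \<le> \<eta>;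
      \<And>m. m \<le> N \<Longrightarrow> norm (\<xi> m - \<xi>' m) \<le> d; m \<le> N\<rbrakk> \<Longrightarrow> norm (F \<xi> m - F \<xi>' m) \<le> d / 2"
    and ball: "\<And>m. m \<le> N \<Longrightarrow> norm (\<xi> m) \<le> \<eta>" "\<And>m. m \<le> N \<Longrightarrow> norm (\<xi>' m) \<le> \<eta>"
    and fp: "\<And>m. m \<le> N \<Longrightarrow> F \<xi> m = \<xi> m" "\<And>m. m \<le> N \<Longrightarrow> F \<xi>' m = \<xi>' m"
    and m: "m \<le> N"
  shows "\<xi> m = \<xi>' m"
proof -
  define d where "d = Max ((\<lambda>m. norm (\<xi> m - \<xi>' m)) ` {..N})"
  have d: "norm (\<xi> m - \<xi>' m) \<le> d" if "m \<le> N" for m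
    unfolding d_def using that by (intro Max_ge) auto
  have "d \<in> (\<lambda>m. norm (\<xi> m - \<xi>' m)) ` {..N}"
    unfolding d_def by (intro Max_in) auto
  then obtain k where k: "k \<le> N" "d = norm (\<xi> k - \<xi>' k)" by auto
  have "norm (F \<xi> k - F \<xi>' k) \<le> d / 2"
    by (rule contr) (use ball d k in auto)
  then have "d \<le> 0" using k fp by simp
  with d[OF m] have "norm (\<xi> m - \<xi>' m) \<le> 0" by linarith
  then show ?thesis by simp
qed

lemma tuple_fixed_point_exists:
  fixes F :: "(nat \<Rightarrow> 'a::banach) \<Rightarrow> nat \<Rightarrow> 'a"
  assumes self: "\<And>\<xi> m. \<lbrakk>\<And>m. m \<le> N \<Longrightarrow> norm (\<xi> m) \<le> \<eta>; m \<le> N\<rbrakk> \<Longrightarrow> norm (F \<xi> m) \<le> \<eta>"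
    and contr: "\<And>\<xi> \<xi>' d m. \<lbrakk>\<And>m. m \<le> N \<Longrightarrow> norm (\<xi> m) \<le> \<eta>; \<And>m. m \<le> N \<Longrightarrow> norm (\<xi>' m) \<le> \<eta>;
      \<And>m. m \<le> N \<Longrightarrow> norm (\<xi> m - \<xi>' m) \<le> d; m \<le> N\<rbrakk> \<Longrightarrow> norm (F \<xi> m - F \<xi>' m) \<le> d / 2"
    and "0 \<le> \<eta>"
  obtains \<xi> where "\<And>m. m \<le> N \<Longrightarrow> norm (\<xi> m) \<le> \<eta>" "\<And>m. m \<le> N \<Longrightarrow> F \<xi> m = \<xi> m"
proof -
  define X where "X k = (F ^^ k) (\<lambda>_. 0)" for k
  have X0: "X 0 = (\<lambda>_. 0)" and XS: "X (Suc k) = F (X k)" for k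
    by (simp_all add: X_def)
  have ball: "m \<le> N \<Longrightarrow> norm (X k m) \<le> \<eta>" for k m
    by (induction k arbitrary: m) (use \<open>0 \<le> \<eta>\<close> self in \<open>auto simp: X0 XS\<close>)
  have diff: "m \<le> N \<Longrightarrow> norm (X (Suc k) m - X k m) \<le> \<eta> * (1/2) ^ k" for k m
  proof (induction k arbitrary: m)
    case 0
    then show ?case using ball[OF 0, of "Suc 0"] by (simp add: X0)
  next
    case (Suc k)
    have "norm (F (X (Suc k)) m - F (X k) m) \<le> \<eta> * (1/2) ^ k / 2"
      by (rule contr) (use ball Suc in auto)
    then show ?case by (simp add: XS)
  qed
  define L where "L m = suminf (\<lambda>k. X (Suc k) m - X k m)" for m
  have lim: "(\<lambda>k. X k m) \<longlonglongrightarrow> L m" if "m \<le> N" for m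
  proof -
    have "summable (\<lambda>k. X (Suc k) m - X k m)"
      by (rule summable_comparison_test'[where g = "\<lambda>k. \<eta> * (1/2) ^ k" and N = 0])
        (use diff[OF that] in \<open>auto intro!: summable_mult summable_geometric\<close>)
    then have "(\<lambda>n. \<Sum>k<n. X (Suc k) m - X k m) \<longlonglongrightarrow> L m"
      unfolding L_def by (rule summable_LIMSEQ)
    then show ?thesis using sum_lessThan_telescope[of "\<lambda>k. X k m"] by (simp add: X0)
  qed
  have ballL: "norm (L m) \<le> \<eta>" if "m \<le> N" for m
    using lim[OF that] ball[OF that] by (intro Lim_norm_ubound[OF _ lim[OF that]]) auto
  have "F L m = L m" if m: "m \<le> N" for m
  proof -
    have "norm (F L m - L m) \<le> e" if "e > 0" for e
    proof -
      have "\<forall>\<^sub>F k in sequentially. \<forall>m\<in>{..N}. norm (X k m - L m) < e / 2"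
      proof (intro eventually_ball_finite ballI)
        show "\<forall>\<^sub>F k in sequentially. norm (X k m - L m) < e / 2" if "m \<in> {..N}" for m
          using tendstoD[OF lim, of m "e / 2"] that \<open>e > 0\<close> by (simp add: dist_norm)
      qed simp
      then obtain k0 where k0: "\<And>k m. k \<ge> k0 \<Longrightarrow> m \<le> N \<Longrightarrow> norm (X k m - L m) < e / 2"
        unfolding eventually_sequentially by (metis atMost_iff)
      have "norm (F L m - F (X k0) m) \<le> e / 2 / 2"
        by (rule contr) (use ball ballL k0[of k0] m in \<open>auto simp: norm_minus_commute less_imp_le\<close>)
      moreover have "norm (X (Suc k0) m - L m) < e / 2"
        using k0[of "Suc k0"] m by simp
      moreover have "norm (F L m - L m) \<le> norm (F L m - F (X k0) m) + norm (X (Suc k0) m - L m)"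
        using norm_triangle_ineq[of "F L m - F (X k0) m" "X (Suc k0) m - L m"] by (simp add: XS)
      ultimately show ?thesis using \<open>e > 0\<close> by linarith
    qed
    then have "norm (F L m - L m) \<le> 0" by (rule field_le_epsilon[of _ 0, simplified])
    then show ?thesis by simp
  qed
  with ballL show ?thesis by (rule that)
qed

subsection \<open>The periodicity equation\<close>

text \<open>Chosen for \<open>norm_kick_diff_le\<close>: if the modulus parameter moves by d and the
  angle by 2d, each of the two points moves by at most 6 r0 d, and lip_const (2 r0)^(2s) times 12 r0
  d is half of kick_const r0^(2s+1) d. A defect consists of two kicks.\<close>

definition kick_const :: "nat \<Rightarrow> real" where
  "kick_const s = 24 * 4 ^ s * lip_const s"

text \<open>kick_const r0 measures a kick against the twist scale, and q r0^(2s) controls the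
  accumulation over q steps. Neither condition depends on the coefficients.\<close>

definition small_radius :: "nat \<Rightarrow> nat \<Rightarrow> real \<Rightarrow> bool" where
  "small_radius s q r0 \<longleftrightarrow> 0 < s \<and> 0 < q \<and> 0 < r0 \<and> 16 * kick_const s * r0 \<le> 1 \<and> real q * r0 ^ (2 * s) \<le> 1"

lemma kick_const_ge: "kick_const s \<ge> 1"
proof -
  have "1 * 1 * 1 \<le> 24 * 4 ^ s * lip_const s"
    unfolding lip_const_def using one_le_power[of "4::real" s] one_le_power[of "8::real" "2 * s + 1"]
    by (intro mult_mono) linarith+
  then show ?thesis by (simp add: kick_const_def)
qed

lemma small_radiusD:
  assumes "small_radius s q r0"
  shows "0 < s" "0 < q" "0 < r0" "kick_const s * r0 \<le> 1/16" "real q * r0 ^ (2 * s) \<le> 1"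
    "r0 \<le> 1/16" "r0 ^ (2 * s) \<le> 1/16"
proof -
  show s: "0 < s" "0 < q" "0 < r0" and k: "kick_const s * r0 \<le> 1/16" and "real q * r0 ^ (2 * s) \<le> 1"
    using assms by (auto simp: small_radius_def)
  have "1 * r0 \<le> kick_const s * r0" using kick_const_ge s by (intro mult_right_mono) auto
  with k show r: "r0 \<le> 1/16" by simp
  have "r0 ^ (2 * s) \<le> r0 ^ 1" using r s by (intro power_decreasing) auto
  with r show "r0 ^ (2 * s) \<le> 1/16" by simp
qed

section \<open>Numerical bounds for the exponential\<close>

lemma exp_half_le: "x \<le> 1/2 \<Longrightarrow> exp x \<le> (2 :: real)"
proof -
  assume "x \<le> 1/2"
  then have "exp x \<le> exp (1/2)" by simp
  also have "\<dots> \<le> 1 + 1/2 + (1/2)\<^sup>2" by (rule exp_bound) auto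
  also have "\<dots> \<le> 2" by (simp add: power2_eq_square)
  finally show ?thesis .
qed

lemma exp_eighth_le: "exp (1/8) \<le> (1 + 9/64 :: real)"
  using exp_bound[of "1/8"] by (simp add: power2_eq_square)

lemma norm_exp_diff_small:
  fixes \<sigma> \<sigma>' :: "'a::{real_normed_algebra_1,banach,comm_ring_1}"
  assumes "norm \<sigma> \<le> 1/8" "norm \<sigma>' \<le> 1/8"
  shows "norm (exp \<sigma> - exp \<sigma>') \<le> 2 * norm (\<sigma> - \<sigma>')"
    "norm ((exp \<sigma> - \<sigma>) - (exp \<sigma>' - \<sigma>')) \<le> 9/64 * norm (\<sigma> - \<sigma>')"
proof -
  have "exp (1/8) * norm (\<sigma> - \<sigma>') \<le> 2 * norm (\<sigma> - \<sigma>')"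
    using exp_eighth_le by (intro mult_right_mono) auto
  then show "norm (exp \<sigma> - exp \<sigma>') \<le> 2 * norm (\<sigma> - \<sigma>')"
    using norm_exp_diff_le[OF assms] by simp
  have "(exp (1/8) - 1) * norm (\<sigma> - \<sigma>') \<le> 9/64 * norm (\<sigma> - \<sigma>')"
    using exp_eighth_le by (intro mult_right_mono) auto
  then show "norm ((exp \<sigma> - \<sigma>) - (exp \<sigma>' - \<sigma>')) \<le> 9/64 * norm (\<sigma> - \<sigma>')"
    using norm_exp_minus_id_diff_le[OF assms] by simp
qed


text \<open>\<open>emb\<close> supplies the complex scalars, since there is no class of complex Banach algebras.\<close>

locale complex_scalars =
  fixes emb :: "complex \<Rightarrow> 'a::{real_normed_algebra_1,banach,comm_ring_1}"
  assumes norm_emb: "norm (emb c) \<le> cmod c"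
begin

text \<open>\<open>point s r0 t \<sigma> y\<close> stands for the point of modulus \<open>r0 exp (\<sigma>/2s)\<close> and angle \<open>t + y\<close>.\<close>

definition point :: "nat \<Rightarrow> real \<Rightarrow> real \<Rightarrow> 'a \<Rightarrow> 'a \<Rightarrow> 'a" where
  "point s r0 t \<sigma> y = r0 *\<^sub>R (emb (cis t) * exp (\<sigma> /\<^sub>R (2 * real s) + emb \<i> * y))"

text \<open>The angular displacement \<open>disp\<close> as an analytic function of the modulus and
  angle parameters. For real \<open>\<sigma>\<close> and \<open>y\<close> over the complex numbers,
  negating the angle produces the conjugate point.\<close>

definition kick :: "nat \<Rightarrow> real \<Rightarrow> (nat \<times> nat \<Rightarrow> 'a) \<Rightarrow> real \<Rightarrow> 'a \<Rightarrow> 'a \<Rightarrow> 'a" where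
  "kick s r0 a t \<sigma> y = double_series s a (point s r0 t \<sigma> y) (point s r0 (- t) \<sigma> (- y))"

text \<open>This is r^(2s) - r0^(2s) for r = r0 exp(\<sigma>/2s), the excess of the rotation angle
  over \<beta>. The logarithmic parameter makes its derivative at 0 exactly r0^(2s), the factor
  divided out in \<open>orbit_map\<close>.\<close>

definition twist :: "nat \<Rightarrow> real \<Rightarrow> 'a \<Rightarrow> 'a" where
  "twist s r0 \<sigma> = r0 ^ (2 * s) *\<^sub>R (exp \<sigma> - 1)"

text \<open>An unknown \<open>\<xi>\<close> codes the modulus in \<open>\<xi> 0\<close>; for \<open>n \<le> q\<close>, \<open>\<xi> (Suc n)\<close> is the deviation of
  the \<open>n\<close>-th orbit point from the rigid rotation \<open>x + n \<beta>\<close>.\<close>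

definition defect ::
  "nat \<Rightarrow> real \<Rightarrow> real \<Rightarrow> real \<Rightarrow> (nat \<times> nat \<Rightarrow> 'a) \<Rightarrow> (nat \<Rightarrow> 'a) \<Rightarrow> nat \<Rightarrow> 'a" where
  "defect s r0 \<beta> x a \<xi> n =
     kick s r0 a (x + real (Suc n) * \<beta>) (\<xi> 0) (\<xi> (Suc n) + twist s r0 (\<xi> 0)) +
     kick s r0 a (- (x + real (Suc n) * \<beta>)) (\<xi> 0) (- \<xi> (Suc (Suc n)))"

definition mean_defect ::
  "nat \<Rightarrow> real \<Rightarrow> real \<Rightarrow> real \<Rightarrow> nat \<Rightarrow> (nat \<times> nat \<Rightarrow> 'a) \<Rightarrow> (nat \<Rightarrow> 'a) \<Rightarrow> 'a" where
  "mean_defect s r0 \<beta> x q a \<xi> = (\<Sum>n<q. defect s r0 \<beta> x a \<xi> n) /\<^sub>R real q"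

text \<open>Closing up after q steps means that the twist is minus the mean defect. Dividing by
  r0^(2s) and moving the nonlinear part of exp to the right gives the equation at index 0. Replacing
  the twist by minus the mean in the recursion for the deviations gives the sums; the deviation at n
  = q then vanishes automatically.\<close>

definition orbit_map ::
  "nat \<Rightarrow> real \<Rightarrow> real \<Rightarrow> real \<Rightarrow> nat \<Rightarrow> (nat \<times> nat \<Rightarrow> 'a) \<Rightarrow> (nat \<Rightarrow> 'a) \<Rightarrow> nat \<Rightarrow> 'a" where
  "orbit_map s r0 \<beta> x q a \<xi> m = (case m of
     0 \<Rightarrow> - (mean_defect s r0 \<beta> x q a \<xi> /\<^sub>R r0 ^ (2 * s)) - (exp (\<xi> 0) - 1 - \<xi> 0)
   | Suc n \<Rightarrow> \<Sum>k<n. defect s r0 \<beta> x a \<xi> k - mean_defect s r0 \<beta> x q a \<xi>)"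

lemma norm_emb_cis: "norm (emb (cis t)) \<le> 1" "norm (emb \<i>) \<le> 1"
  using norm_emb[of "cis t"] norm_emb[of \<i>] by simp_all

lemma norm_exponent_le:
  assumes "0 < s"
  shows "norm (\<sigma> /\<^sub>R (2 * real s) + emb \<i> * y) \<le> norm \<sigma> / 2 + norm y"
proof -
  have 1: "norm (\<sigma> /\<^sub>R (2 * real s)) \<le> norm \<sigma> / 2"
  proof -
    have "norm (\<sigma> /\<^sub>R (2 * real s)) = norm \<sigma> / (2 * real s)"
      by (subst norm_scaleR, subst divide_inverse) simp
    also have "\<dots> \<le> norm \<sigma> / 2" using assms by (intro divide_left_mono) auto
    finally show ?thesis .
  qed
  have "norm (emb \<i> * y) \<le> norm (emb \<i>) * norm y" by (rule norm_mult_ineq)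
  also have "\<dots> \<le> 1 * norm y" by (rule mult_right_mono[OF norm_emb_cis(2) norm_ge_zero])
  finally have 2: "norm (emb \<i> * y) \<le> norm y" by simp
  show ?thesis by (rule norm_triangle_le[OF add_mono[OF 1 2]])
qed

section \<open>Self-map and contraction estimates for the orbit equations\<close>

context
  fixes s q :: nat and r0 :: real
  assumes small: "small_radius s q r0"
begin

lemma norm_point_le:
  assumes "norm \<sigma> \<le> 1/8" "norm y \<le> 1/4"
  shows "norm (point s r0 t \<sigma> y) \<le> 2 * r0"
proof -
  have "norm (point s r0 t \<sigma> y) \<le> r0 * (norm (emb (cis t)) * norm (exp (\<sigma> /\<^sub>R (2 * real s) + emb \<i> * y)))"
    using small_radiusD(3)[OF small] by (simp add: point_def norm_mult_ineq)
  also have "\<dots> \<le> r0 * (1 * 2)"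
  proof (intro mult_left_mono mult_mono norm_emb_cis)
    have "norm (\<sigma> /\<^sub>R (2 * real s) + emb \<i> * y) \<le> 1/2"
      using norm_exponent_le[OF small_radiusD(1)[OF small], of \<sigma> y] assms by simp
    then show "norm (exp (\<sigma> /\<^sub>R (2 * real s) + emb \<i> * y)) \<le> 2"
      by (intro order_trans[OF norm_exp exp_half_le])
  qed (use small_radiusD(3)[OF small] in auto)
  finally show ?thesis by simp
qed

lemma norm_point_diff_le:
  assumes "norm \<sigma> \<le> 1/8" "norm y \<le> 1/4" "norm \<sigma>' \<le> 1/8" "norm y' \<le> 1/4"
  shows "norm (point s r0 t \<sigma> y - point s r0 t \<sigma>' y') \<le> 2 * r0 * (norm (\<sigma> - \<sigma>') + norm (y - y'))"
proof -
  let ?e = "\<sigma> /\<^sub>R (2 * real s) + emb \<i> * y" and ?e' = "\<sigma>' /\<^sub>R (2 * real s) + emb \<i> * y'"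
  note s = small_radiusD(1)[OF small]
  have "point s r0 t \<sigma> y - point s r0 t \<sigma>' y' = r0 *\<^sub>R (emb (cis t) * (exp ?e - exp ?e'))"
    by (simp add: point_def algebra_simps)
  also have "norm \<dots> \<le> r0 * (norm (emb (cis t)) * norm (exp ?e - exp ?e'))"
    using small_radiusD(3)[OF small] by (simp add: norm_mult_ineq)
  also have "\<dots> \<le> r0 * (1 * (2 * norm (?e - ?e')))"
  proof (intro mult_left_mono mult_mono norm_emb_cis)
    have "norm ?e \<le> 1/2" "norm ?e' \<le> 1/2"
      using norm_exponent_le[OF s, of \<sigma> y] norm_exponent_le[OF s, of \<sigma>' y'] assms by simp_all
    then have "norm (exp ?e - exp ?e') \<le> exp (1/2) * norm (?e - ?e')"
      by (rule norm_exp_diff_le)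
    also have "\<dots> \<le> 2 * norm (?e - ?e')" by (intro mult_right_mono exp_half_le) auto
    finally show "norm (exp ?e - exp ?e') \<le> 2 * norm (?e - ?e')" .
  qed (use small_radiusD(3)[OF small] in auto)
  also have "?e - ?e' = (\<sigma> - \<sigma>') /\<^sub>R (2 * real s) + emb \<i> * (y - y')"
    by (simp add: algebra_simps)
  also have "r0 * (1 * (2 * norm \<dots>)) \<le> r0 * (1 * (2 * (norm (\<sigma> - \<sigma>') + norm (y - y'))))"
    using norm_exponent_le[OF s, of "\<sigma> - \<sigma>'" "y - y'"] small_radiusD(3)[OF small] norm_ge_zero[of "\<sigma> - \<sigma>'"]
    by (intro mult_left_mono) linarith+
  finally show ?thesis by (simp add: algebra_simps)
qed

lemma norm_kick_le:
  assumes "\<And>v. norm (a v) \<le> 1" "norm \<sigma> \<le> 1/8" "norm y \<le> 1/4"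
  shows "norm (kick s r0 a t \<sigma> y) \<le> kick_const s * r0 ^ (2 * s + 1) / 2"
proof -
  have "norm (kick s r0 a t \<sigma> y) \<le> 2 * lip_const s * (2 * r0) ^ (2 * s + 1)"
    unfolding kick_def using assms small_radiusD(6)[OF small]
    by (intro norm_double_series_le norm_point_le) auto
  also have "\<dots> = 4 * (4 ^ s * lip_const s * r0 ^ (2 * s + 1))"
    by (simp add: power_mult_distrib power_mult)
  also have "\<dots> \<le> 12 * (4 ^ s * lip_const s * r0 ^ (2 * s + 1))"
    using lip_const_pos[of s] small_radiusD(3)[OF small] by (intro mult_right_mono) auto
  finally show ?thesis by (simp add: kick_const_def mult_ac)
qed

text \<open>The angle may move by 2 d because it is a deviation plus a twist, each of which changes
  by at most d.\<close>

lemma norm_kick_diff_le: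
  assumes a: "\<And>v. norm (a v) \<le> 1"
    and b: "norm \<sigma> \<le> 1/8" "norm y \<le> 1/4" "norm \<sigma>' \<le> 1/8" "norm y' \<le> 1/4"
    and d: "norm (\<sigma> - \<sigma>') \<le> d" "norm (y - y') \<le> 2 * d"
  shows "norm (kick s r0 a t \<sigma> y - kick s r0 a t \<sigma>' y') \<le> kick_const s * r0 ^ (2 * s + 1) * d / 2"
proof -
  note r = small_radiusD(3)[OF small]
  have 1: "norm (point s r0 t \<sigma> y - point s r0 t \<sigma>' y') \<le> 2 * r0 * (d + 2 * d)"
    using r by (intro order_trans[OF norm_point_diff_le[OF b]] mult_left_mono add_mono d) auto
  have "norm (point s r0 (- t) \<sigma> (- y) - point s r0 (- t) \<sigma>' (- y')) \<le> 2 * r0 * (norm (\<sigma> - \<sigma>') + norm (- y - - y'))"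
    using b by (intro norm_point_diff_le) auto
  also have "\<dots> \<le> 2 * r0 * (d + 2 * d)"
    using r d by (intro mult_left_mono add_mono) (auto simp: norm_minus_commute)
  finally have 2: "norm (point s r0 (- t) \<sigma> (- y) - point s r0 (- t) \<sigma>' (- y')) \<le> 2 * r0 * (d + 2 * d)" .
  have "norm (kick s r0 a t \<sigma> y - kick s r0 a t \<sigma>' y') \<le> lip_const s * (2 * r0) ^ (2 * s) *
      (norm (point s r0 t \<sigma> y - point s r0 t \<sigma>' y') + norm (point s r0 (- t) \<sigma> (- y) - point s r0 (- t) \<sigma>' (- y')))"
    unfolding kick_def using b small_radiusD(6)[OF small]
    by (intro double_series_diff_le norm_point_le a) auto
  also have "\<dots> \<le> lip_const s * (2 * r0) ^ (2 * s) * (2 * r0 * (d + 2 * d) + 2 * r0 * (d + 2 * d))"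
    using lip_const_pos[of s] r 1 2 by (intro mult_left_mono add_mono) auto
  also have "\<dots> = kick_const s * r0 ^ (2 * s + 1) * d / 2"
    by (simp add: kick_const_def power_mult_distrib power_mult)
  finally show ?thesis .
qed

lemma norm_twist_diff_le:
  assumes "norm \<sigma> \<le> 1/8" "norm (\<sigma>' :: 'a) \<le> 1/8"
  shows "norm (twist s r0 \<sigma> - twist s r0 \<sigma>') \<le> norm (\<sigma> - \<sigma>')"
proof -
  note r = small_radiusD(3,7)[OF small]
  have "twist s r0 \<sigma> - twist s r0 \<sigma>' = r0 ^ (2 * s) *\<^sub>R (exp \<sigma> - exp \<sigma>')"
    by (simp add: twist_def algebra_simps)
  then have "norm (twist s r0 \<sigma> - twist s r0 \<sigma>') = r0 ^ (2 * s) * norm (exp \<sigma> - exp \<sigma>')"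
    using r by simp
  also have "\<dots> \<le> 1/16 * (2 * norm (\<sigma> - \<sigma>'))"
    using r by (intro mult_mono norm_exp_diff_small assms) auto
  finally show ?thesis using norm_ge_zero[of "\<sigma> - \<sigma>'"] by linarith
qed

lemma norm_twist_le: "norm \<sigma> \<le> 1/8 \<Longrightarrow> norm (twist s r0 \<sigma>) \<le> 1/8"
  using norm_twist_diff_le[of \<sigma> 0] by (simp add: twist_def)

lemma norm_angle_le:
  assumes "\<And>m. m \<le> Suc q \<Longrightarrow> norm (\<xi> m) \<le> 1/8" "n < q"
  shows "norm (\<xi> (Suc n) + twist s r0 (\<xi> 0)) \<le> 1/4" "norm (- \<xi> (Suc (Suc n))) \<le> 1/4"
proof -
  have "norm (\<xi> (Suc n) + twist s r0 (\<xi> 0)) \<le> 1/8 + 1/8"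
    by (intro norm_triangle_le[OF add_mono] norm_twist_le assms(1)) (use assms(2) in auto)
  then show "norm (\<xi> (Suc n) + twist s r0 (\<xi> 0)) \<le> 1/4" by simp
  show "norm (- \<xi> (Suc (Suc n))) \<le> 1/4" using assms(1)[of "Suc (Suc n)"] assms(2) by simp
qed

lemma norm_defect_le:
  assumes "\<And>v. norm (a v) \<le> 1" "\<And>m. m \<le> Suc q \<Longrightarrow> norm (\<xi> m) \<le> 1/8" "n < q"
  shows "norm (defect s r0 \<beta> x a \<xi> n) \<le> kick_const s * r0 ^ (2 * s + 1)"
proof -
  have "norm (defect s r0 \<beta> x a \<xi> n) \<le> kick_const s * r0 ^ (2 * s + 1) / 2 + kick_const s * r0 ^ (2 * s + 1) / 2"
    unfolding defect_def using assms
    by (intro norm_triangle_le[OF add_mono] norm_kick_le norm_angle_le) auto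
  then show ?thesis unfolding field_sum_of_halves .
qed

lemma norm_defect_diff_le:
  assumes a: "\<And>v. norm (a v) \<le> 1"
    and b: "\<And>m. m \<le> Suc q \<Longrightarrow> norm (\<xi> m) \<le> 1/8" "\<And>m. m \<le> Suc q \<Longrightarrow> norm (\<xi>' m) \<le> 1/8"
    and d: "\<And>m. m \<le> Suc q \<Longrightarrow> norm (\<xi> m - \<xi>' m) \<le> d" and n: "n < q"
  shows "norm (defect s r0 \<beta> x a \<xi> n - defect s r0 \<beta> x a \<xi>' n) \<le> kick_const s * r0 ^ (2 * s + 1) * d"
proof -
  let ?y = "\<lambda>\<xi>. \<xi> (Suc n) + twist s r0 (\<xi> 0)"
  note y = norm_angle_le(1)[OF b(1) n] norm_angle_le(1)[OF b(2) n]
  have d0: "0 \<le> d" using d[of 0] norm_ge_zero order_trans by blast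
  have "?y \<xi> - ?y \<xi>' = (\<xi> (Suc n) - \<xi>' (Suc n)) + (twist s r0 (\<xi> 0) - twist s r0 (\<xi>' 0))" by simp
  also have "norm \<dots> \<le> d + d"
    using b d n by (intro norm_triangle_le add_mono order_trans[OF norm_twist_diff_le]) auto
  finally have "norm (?y \<xi> - ?y \<xi>') \<le> 2 * d" by simp
  then have 1: "norm (kick s r0 a t (\<xi> 0) (?y \<xi>) - kick s r0 a t (\<xi>' 0) (?y \<xi>')) \<le> kick_const s * r0 ^ (2 * s + 1) * d / 2" for t
    using b(1)[of 0] b(2)[of 0] d[of 0] y by (intro norm_kick_diff_le a) auto
  have "norm (- \<xi> (Suc (Suc n)) - - \<xi>' (Suc (Suc n))) \<le> 2 * d"
    using d[of "Suc (Suc n)"] n d0 by (simp add: norm_minus_commute)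
  then have 2: "norm (kick s r0 a t (\<xi> 0) (- \<xi> (Suc (Suc n))) - kick s r0 a t (\<xi>' 0) (- \<xi>' (Suc (Suc n))))
      \<le> kick_const s * r0 ^ (2 * s + 1) * d / 2" for t
    using b(1)[of 0] b(2)[of 0] d[of 0] b(1)[of "Suc (Suc n)"] b(2)[of "Suc (Suc n)"] n
    by (intro norm_kick_diff_le a) auto
  show ?thesis
    unfolding defect_def add_diff_add by (rule order_trans[OF norm_triangle_mono[OF 1 2]]) simp
qed

lemma norm_mean_le:
  fixes f :: "nat \<Rightarrow> 'a"
  assumes "\<And>n. n < q \<Longrightarrow> norm (f n) \<le> C"
  shows "norm ((\<Sum>n<q. f n) /\<^sub>R real q) \<le> C"
proof -
  have "norm (\<Sum>n<q. f n) \<le> (\<Sum>n<q. C)" using assms by (intro sum_norm_le) auto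
  then show ?thesis using small_radiusD(2)[OF small] by (simp add: field_simps)
qed

lemma norm_mean_defect_le:
  assumes "\<And>v. norm (a v) \<le> 1" "\<And>m. m \<le> Suc q \<Longrightarrow> norm (\<xi> m) \<le> 1/8"
  shows "norm (mean_defect s r0 \<beta> x q a \<xi>) \<le> kick_const s * r0 ^ (2 * s + 1)"
  unfolding mean_defect_def by (intro norm_mean_le norm_defect_le assms)

lemma norm_mean_defect_diff_le:
  assumes "\<And>v. norm (a v) \<le> 1"
    and "\<And>m. m \<le> Suc q \<Longrightarrow> norm (\<xi> m) \<le> 1/8" "\<And>m. m \<le> Suc q \<Longrightarrow> norm (\<xi>' m) \<le> 1/8"
    and "\<And>m. m \<le> Suc q \<Longrightarrow> norm (\<xi> m - \<xi>' m) \<le> d"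
  shows "norm (mean_defect s r0 \<beta> x q a \<xi> - mean_defect s r0 \<beta> x q a \<xi>') \<le> kick_const s * r0 ^ (2 * s + 1) * d"
  unfolding mean_defect_def scaleR_diff_right[symmetric] sum_subtractf[symmetric]
  by (intro norm_mean_le norm_defect_diff_le assms)

text \<open>The source of uniformity in q: q r0^(2s) <= 1 absorbs the number of steps and leaves 2
  kick_const r0 d, at most d/8.\<close>

lemma kick_sum_le:
  assumes "0 \<le> d" "n \<le> q"
  shows "real n * (2 * (kick_const s * r0 ^ (2 * s + 1) * d)) \<le> d / 8"
proof -
  note r = small_radiusD[OF small]
  have "real n * (2 * (kick_const s * r0 ^ (2 * s + 1) * d)) \<le> real q * (2 * (kick_const s * r0 ^ (2 * s + 1) * d))"
    using assms r kick_const_ge[of s] by (intro mult_right_mono) auto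
  also have "\<dots> = (real q * r0 ^ (2 * s)) * (2 * (kick_const s * r0) * d)" by simp
  also have "\<dots> \<le> 1 * (2 * (1/16) * d)"
    using assms r kick_const_ge[of s] by (intro mult_mono) auto
  finally show ?thesis by simp
qed

text \<open>Division by the twist scale leaves the spare factor r0 of the kicks, which makes
  kick_const r0 at most 1/16.\<close>

lemma norm_mean_scaled:
  assumes "0 \<le> d" "norm (v :: 'a) \<le> kick_const s * r0 ^ (2 * s + 1) * d"
  shows "norm (v /\<^sub>R r0 ^ (2 * s)) \<le> d / 16"
proof -
  note r = small_radiusD[OF small]
  have "norm (v /\<^sub>R r0 ^ (2 * s)) = norm v / r0 ^ (2 * s)"
    using r(3) by (subst norm_scaleR, subst divide_inverse) simp
  also have "\<dots> \<le> (kick_const s * r0 ^ (2 * s + 1) * d) / r0 ^ (2 * s)"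
    using assms r(3) by (intro divide_right_mono) auto
  also have "\<dots> = (kick_const s * r0) * d" using r(3) by simp
  also have "\<dots> \<le> 1/16 * d" using assms r by (intro mult_right_mono) auto
  finally show ?thesis by simp
qed

lemma norm_orbit_map_le:
  assumes a: "\<And>v. norm (a v) \<le> 1" and b: "\<And>m. m \<le> Suc q \<Longrightarrow> norm (\<xi> m) \<le> 1/8" and m: "m \<le> Suc q"
  shows "norm (orbit_map s r0 \<beta> x q a \<xi> m) \<le> 1/8"
proof (cases m)
  case 0
  have "norm ((exp (\<xi> 0) - \<xi> 0) - (exp 0 - 0)) \<le> 9/64 * norm (\<xi> 0 - 0)"
    using b by (intro norm_exp_diff_small) auto
  then have e: "norm (exp (\<xi> 0) - 1 - \<xi> 0) \<le> 9/64 * (1/8)"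
    using b[of 0] by (simp add: algebra_simps)
  have "norm (mean_defect s r0 \<beta> x q a \<xi> /\<^sub>R r0 ^ (2 * s)) \<le> 1 / 16"
    using norm_mean_scaled[of 1] norm_mean_defect_le[OF a b] by simp
  then have "norm (orbit_map s r0 \<beta> x q a \<xi> m) \<le> 1/16 + 9/64 * (1/8)"
    unfolding orbit_map_def 0 nat.case using e
    by (intro order_trans[OF norm_triangle_ineq4 add_mono]) auto
  then show ?thesis by simp
next
  case (Suc n)
  have "norm (orbit_map s r0 \<beta> x q a \<xi> m) \<le> (\<Sum>k<n. 2 * (kick_const s * r0 ^ (2 * s + 1) * 1))"
    unfolding orbit_map_def Suc nat.case
  proof (rule sum_norm_le)
    fix k assume "k \<in> {..<n}"
    then have "k < q" using m Suc by simp
    then have "norm (defect s r0 \<beta> x a \<xi> k) \<le> kick_const s * r0 ^ (2 * s + 1)"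
      by (intro norm_defect_le a b)
    moreover have "norm (mean_defect s r0 \<beta> x q a \<xi>) \<le> kick_const s * r0 ^ (2 * s + 1)"
      by (intro norm_mean_defect_le a b)
    ultimately show "norm (defect s r0 \<beta> x a \<xi> k - mean_defect s r0 \<beta> x q a \<xi>) \<le> 2 * (kick_const s * r0 ^ (2 * s + 1) * 1)"
      using norm_triangle_ineq4[of "defect s r0 \<beta> x a \<xi> k" "mean_defect s r0 \<beta> x q a \<xi>"] by linarith
  qed
  also have "\<dots> \<le> 1 / 8" using kick_sum_le[of 1 n] m Suc by simp
  finally show ?thesis .
qed

text \<open>Index 0 has Lipschitz constant at most 1/16 + 9/64, from the mean and from the remainder
  of exp; the other indices have at most 1/8.\<close>

lemma norm_orbit_map_diff_le:
  assumes a: "\<And>v. norm (a v) \<le> 1"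
    and b: "\<And>m. m \<le> Suc q \<Longrightarrow> norm (\<xi> m) \<le> 1/8" "\<And>m. m \<le> Suc q \<Longrightarrow> norm (\<xi>' m) \<le> 1/8"
    and d: "\<And>m. m \<le> Suc q \<Longrightarrow> norm (\<xi> m - \<xi>' m) \<le> d" and m: "m \<le> Suc q"
  shows "norm (orbit_map s r0 \<beta> x q a \<xi> m - orbit_map s r0 \<beta> x q a \<xi>' m) \<le> d / 2"
proof -
  have d0: "0 \<le> d" using d[of 0] norm_ge_zero order_trans by blast
  let ?M = "mean_defect s r0 \<beta> x q a"
  have M: "norm (?M \<xi> - ?M \<xi>') \<le> kick_const s * r0 ^ (2 * s + 1) * d"
    by (intro norm_mean_defect_diff_le a b d)
  show ?thesis
  proof (cases m)
    case 0
    have "norm ((exp (\<xi> 0) - \<xi> 0) - (exp (\<xi>' 0) - \<xi>' 0)) \<le> 9/64 * norm (\<xi> 0 - \<xi>' 0)"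
      using b by (intro norm_exp_diff_small) auto
    then have e: "norm ((exp (\<xi> 0) - \<xi> 0) - (exp (\<xi>' 0) - \<xi>' 0)) \<le> 9/64 * d"
      using d[of 0] by simp
    have "orbit_map s r0 \<beta> x q a \<xi> m - orbit_map s r0 \<beta> x q a \<xi>' m =
        - ((?M \<xi> - ?M \<xi>') /\<^sub>R r0 ^ (2 * s)) - ((exp (\<xi> 0) - \<xi> 0) - (exp (\<xi>' 0) - \<xi>' 0))"
      unfolding orbit_map_def 0 nat.case by (simp add: algebra_simps)
    also have "norm \<dots> \<le> d / 16 + 9/64 * d"
      using norm_mean_scaled[OF d0 M] e by (intro order_trans[OF norm_triangle_ineq4 add_mono]) auto
    finally show ?thesis using d0 by linarith
  next
    case (Suc n)
    have "norm (orbit_map s r0 \<beta> x q a \<xi> m - orbit_map s r0 \<beta> x q a \<xi>' m)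
        \<le> (\<Sum>k<n. 2 * (kick_const s * r0 ^ (2 * s + 1) * d))"
      unfolding orbit_map_def Suc nat.case sum_subtractf[symmetric]
    proof (rule sum_norm_le)
      fix k assume "k \<in> {..<n}"
      then have k: "k < q" using m Suc by simp
      have "norm ((defect s r0 \<beta> x a \<xi> k - defect s r0 \<beta> x a \<xi>' k) - (?M \<xi> - ?M \<xi>'))
          \<le> 2 * (kick_const s * r0 ^ (2 * s + 1) * d)"
        using norm_triangle_ineq4[of "defect s r0 \<beta> x a \<xi> k - defect s r0 \<beta> x a \<xi>' k" "?M \<xi> - ?M \<xi>'"]
          norm_defect_diff_le[of a \<xi> \<xi>' d k \<beta> x, OF a b d k] M by linarith
      then show "norm (defect s r0 \<beta> x a \<xi> k - ?M \<xi> - (defect s r0 \<beta> x a \<xi>' k - ?M \<xi>'))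
          \<le> 2 * (kick_const s * r0 ^ (2 * s + 1) * d)"
        by (simp add: algebra_simps)
    qed
    also have "\<dots> \<le> d / 8" using kick_sum_le[OF d0, of n] m Suc by simp
    finally show ?thesis using d0 by linarith
  qed
qed

end

text \<open>The bound 1/8 belongs to the notion: inside this ball the map is a contraction, so
  solutions are unique.\<close>

definition orbit_solution ::
  "nat \<Rightarrow> real \<Rightarrow> real \<Rightarrow> real \<Rightarrow> nat \<Rightarrow> (nat \<times> nat \<Rightarrow> 'a) \<Rightarrow> (nat \<Rightarrow> 'a) \<Rightarrow> bool" where
  "orbit_solution s r0 \<beta> x q a \<xi> \<longleftrightarrow>
     (\<forall>m\<le>Suc q. norm (\<xi> m) \<le> 1/8 \<and> orbit_map s r0 \<beta> x q a \<xi> m = \<xi> m)"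

lemma orbit_solution_exists:
  assumes "small_radius s q r0" "\<And>v. norm (a v) \<le> 1"
  shows "\<exists>\<xi>. orbit_solution s r0 \<beta> x q a \<xi>"
proof -
  obtain \<xi> where "\<And>m. m \<le> Suc q \<Longrightarrow> norm (\<xi> m) \<le> 1/8"
    "\<And>m. m \<le> Suc q \<Longrightarrow> orbit_map s r0 \<beta> x q a \<xi> m = \<xi> m"
  proof (rule tuple_fixed_point_exists[of "Suc q" "1/8" "orbit_map s r0 \<beta> x q a"])
    show "norm (orbit_map s r0 \<beta> x q a \<xi> m) \<le> 1/8"
      if "\<And>m. m \<le> Suc q \<Longrightarrow> norm (\<xi> m) \<le> 1/8" "m \<le> Suc q" for \<xi> m
      using norm_orbit_map_le[OF assms that] .
    show "norm (orbit_map s r0 \<beta> x q a \<xi> m - orbit_map s r0 \<beta> x q a \<xi>' m) \<le> d / 2"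
      if "\<And>m. m \<le> Suc q \<Longrightarrow> norm (\<xi> m) \<le> 1/8" "\<And>m. m \<le> Suc q \<Longrightarrow> norm (\<xi>' m) \<le> 1/8"
        "\<And>m. m \<le> Suc q \<Longrightarrow> norm (\<xi> m - \<xi>' m) \<le> d" "m \<le> Suc q" for \<xi> \<xi>' d m
      using norm_orbit_map_diff_le[OF assms that] .
  qed auto
  then show ?thesis unfolding orbit_solution_def by blast
qed

lemma orbit_solution_unique:
  assumes "small_radius s q r0" "\<And>v. norm (a v) \<le> 1"
    and "orbit_solution s r0 \<beta> x q a \<xi>" "orbit_solution s r0 \<beta> x q a \<xi>'" "m \<le> Suc q"
  shows "\<xi> m = \<xi>' m"
proof (rule tuple_fixed_point_unique[of "Suc q" "1/8" "orbit_map s r0 \<beta> x q a" \<xi> \<xi>' m])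
  show "norm (orbit_map s r0 \<beta> x q a \<xi> m - orbit_map s r0 \<beta> x q a \<xi>' m) \<le> d / 2"
    if "\<And>m. m \<le> Suc q \<Longrightarrow> norm (\<xi> m) \<le> 1/8" "\<And>m. m \<le> Suc q \<Longrightarrow> norm (\<xi>' m) \<le> 1/8"
      "\<And>m. m \<le> Suc q \<Longrightarrow> norm (\<xi> m - \<xi>' m) \<le> d" "m \<le> Suc q" for \<xi> \<xi>' d m
    using norm_orbit_map_diff_le[OF assms(1,2) that] .
qed (use assms(3-5) in \<open>auto simp: orbit_solution_def\<close>)

end

subsection \<open>Solutions under homomorphisms\<close>

context complex_scalars
begin

context
  fixes emb' :: "complex \<Rightarrow> 'b::{real_normed_algebra_1,banach,comm_ring_1}" and h :: "'a \<Rightarrow> 'b"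
    and s q :: nat and r0 :: real and a :: "nat \<times> nat \<Rightarrow> 'a"
  assumes emb': "complex_scalars emb'"
    and h: "bounded_linear h" "\<And>x y. h (x * y) = h x * h y" "h 1 = 1" "\<And>c. h (emb c) = emb' c"
    and small: "small_radius s q r0" and a: "\<And>v. norm (a v) \<le> 1"
begin

interpretation B: complex_scalars emb' by (rule emb')

lemma point_hom: "h (point s r0 t \<sigma> y) = B.point s r0 t (h \<sigma>) (h y)"
  unfolding point_def B.point_def
  by (simp add: linear_simps[OF h(1)] h exp_homomorphism[of h, OF h(1-3)])

lemma kick_hom:
  assumes "norm \<sigma> \<le> 1/8" "norm y \<le> 1/4"
  shows "h (kick s r0 a t \<sigma> y) = B.kick s r0 (\<lambda>v. h (a v)) t (h \<sigma>) (h y)"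
proof -
  have "2 * r0 \<le> 1/8" using small_radiusD(6)[OF small] by simp
  then have "norm (point s r0 t \<sigma> y) \<le> 1/8" "norm (point s r0 (- t) \<sigma> (- y)) \<le> 1/8"
    using norm_point_le[OF small assms(1), of y t] norm_point_le[OF small assms(1), of "- y" "- t"] assms(2)
    by auto
  then show ?thesis
    unfolding kick_def B.kick_def
    by (subst double_series_homomorphism[OF h(1-3) a]) (simp_all add: point_hom linear_simps[OF h(1)])
qed

lemma defect_hom:
  assumes "\<And>m. m \<le> Suc q \<Longrightarrow> norm (\<xi> m) \<le> 1/8" "n < q"
  shows "h (defect s r0 \<beta> x a \<xi> n) = B.defect s r0 \<beta> x (\<lambda>v. h (a v)) (\<lambda>m. h (\<xi> m)) n"
proof -
  have "h (twist s r0 \<sigma>) = B.twist s r0 (h \<sigma>)" for \<sigma>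
    unfolding twist_def B.twist_def
    by (simp add: linear_simps[OF h(1)] h exp_homomorphism[of h, OF h(1-3)])
  then show ?thesis
    using norm_angle_le[of s q r0 \<xi> n, OF small assms] assms(1)[of 0]
    unfolding defect_def B.defect_def by (simp add: linear_simps[OF h(1)] kick_hom)
qed

text \<open>All ingredients are convergent series in ring operations and complex scalars, so a
  norm-nonincreasing homomorphism that respects the scalars carries solutions to solutions. It is
  applied to evaluation and to the constant coefficient.\<close>

lemma orbit_solution_hom:
  assumes "\<And>x. norm (h x) \<le> norm x" and sol: "orbit_solution s r0 \<beta> x q a \<xi>"
  shows "B.orbit_solution s r0 \<beta> x q (\<lambda>v. h (a v)) (\<lambda>m. h (\<xi> m))"
proof -
  have ball: "\<And>m. m \<le> Suc q \<Longrightarrow> norm (\<xi> m) \<le> 1/8"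
    and fp: "\<And>m. m \<le> Suc q \<Longrightarrow> orbit_map s r0 \<beta> x q a \<xi> m = \<xi> m"
    using sol by (auto simp: orbit_solution_def)
  have mean: "h (mean_defect s r0 \<beta> x q a \<xi>) = B.mean_defect s r0 \<beta> x q (\<lambda>v. h (a v)) (\<lambda>m. h (\<xi> m))"
    unfolding mean_defect_def B.mean_defect_def
    by (simp add: linear_simps[OF h(1)] linear_sum[OF bounded_linear.linear[OF h(1)]] defect_hom[OF ball])
  have "B.orbit_map s r0 \<beta> x q (\<lambda>v. h (a v)) (\<lambda>m. h (\<xi> m)) m = h (\<xi> m)" if m: "m \<le> Suc q" for m
  proof (cases m)
    case 0
    then show ?thesis
      using arg_cong[OF fp[OF m], of h]
      by (simp add: orbit_map_def B.orbit_map_def linear_simps[OF h(1)] mean h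
          exp_homomorphism[of h, OF h(1-3)])
  next
    case (Suc n)
    then have "h (orbit_map s r0 \<beta> x q a \<xi> m) = (\<Sum>k<n. h (defect s r0 \<beta> x a \<xi> k) - h (mean_defect s r0 \<beta> x q a \<xi>))"
      by (simp add: orbit_map_def linear_simps[OF h(1)] linear_sum[OF bounded_linear.linear[OF h(1)]])
    also have "\<dots> = B.orbit_map s r0 \<beta> x q (\<lambda>v. h (a v)) (\<lambda>m. h (\<xi> m)) m"
      using m Suc by (simp add: B.orbit_map_def mean defect_hom[OF ball])
    finally show ?thesis using fp[OF m] by simp
  qed
  then show ?thesis
    using ball assms(1) unfolding B.orbit_solution_def by (meson order_trans)
qed

end

lemma orbit_solution_zero: "orbit_solution s r0 \<beta> x q (\<lambda>_. 0) (\<lambda>_. 0)"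
proof -
  have "kick s r0 (\<lambda>_. 0) t \<sigma> y = 0" for t \<sigma> y
    by (simp add: kick_def double_series_def case_prod_unfold)
  then show ?thesis
    by (simp add: orbit_solution_def orbit_map_def mean_defect_def defect_def split: nat.split)
qed

end

interpretation scalar: complex_scalars "\<lambda>c::complex. c"
  by unfold_locales auto

subsection \<open>Power series in the coefficients\<close>

type_synonym monomial = "(nat \<times> nat) \<Rightarrow>\<^sub>0 nat"

definition X_var :: "nat \<times> nat \<Rightarrow> monomial" where "X_var v = Poly_Mapping.single v 1"

lemma lookup_X_var: "Poly_Mapping.lookup (X_var v) u = (if u = v then 1 else 0)"
  by (simp add: X_var_def lookup_single when_def)

lemma X_var_eq_iff [simp]: "X_var u = X_var v \<longleftrightarrow> u = v"
  by (metis lookup_X_var zero_neq_one)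

interpretation series: complex_scalars "delta (0 :: monomial)"
  by unfold_locales simp

text \<open>The generic coefficients: solving the equations once for \<open>gen\<close> solves them
  for every a, since \<open>evaluation a\<close> sends \<open>gen v\<close> to
  \<open>a v\<close>.\<close>

definition gen :: "nat \<times> nat \<Rightarrow> monomial ell1" where "gen v = delta (X_var v) 1"

lemma norm_gen: "norm (gen v) \<le> 1"
  by (simp add: gen_def)

lemma monomial_add_eq_zero: "p + p' = 0 \<longleftrightarrow> p = 0 \<and> p' = (0 :: monomial)"
  by (metis add_cancel_left_right add_is_0 lookup_add lookup_zero poly_mapping_eqI)

lemma monomial_add_eq_var:
  "p + p' = X_var v \<longleftrightarrow> p = 0 \<and> p' = X_var v \<or> p = X_var v \<and> p' = (0 :: monomial)"
proof
  assume *: "p + p' = X_var v"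
  have l: "Poly_Mapping.lookup p u + Poly_Mapping.lookup p' u = (if u = v then 1 else 0)" for u
    using arg_cong[OF *, of "\<lambda>m. Poly_Mapping.lookup m u"]
    by (simp add: lookup_add lookup_X_var)
  have other: "Poly_Mapping.lookup p u = 0" "Poly_Mapping.lookup p' u = 0" if "u \<noteq> v" for u
    using l[of u] that by auto
  from l[of v] consider "Poly_Mapping.lookup p v = 0" "Poly_Mapping.lookup p' v = 1"
    | "Poly_Mapping.lookup p v = 1" "Poly_Mapping.lookup p' v = 0" by fastforce
  then show "p = 0 \<and> p' = X_var v \<or> p = X_var v \<and> p' = 0"
  proof cases
    case 1
    then have "Poly_Mapping.lookup p u = 0" "Poly_Mapping.lookup p' u = Poly_Mapping.lookup (X_var v) u" for u
      using other[of u] by (cases "u = v"; simp add: lookup_X_var)+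
    then show ?thesis by (intro disjI1 conjI poly_mapping_eqI) simp_all
  next
    case 2
    then have "Poly_Mapping.lookup p' u = 0" "Poly_Mapping.lookup p u = Poly_Mapping.lookup (X_var v) u" for u
      using other[of u] by (cases "u = v"; simp add: lookup_X_var)+
    then show ?thesis by (intro disjI2 conjI poly_mapping_eqI) simp_all
  qed
qed auto

lemma var_neq_zero: "X_var v \<noteq> 0"
  by (metis lookup_X_var lookup_zero zero_neq_one)

lemma coeff_zero_hom:
  "bounded_linear (\<lambda>f :: monomial ell1. coeff f 0)"
  "coeff (f * g) (0 :: monomial) = coeff f 0 * coeff g 0"
  "coeff 1 (0 :: monomial) = 1"
  "coeff (delta (0 :: monomial) c) 0 = c"
  using coeff_times_zero[of f g] monomial_add_eq_zero
  by (simp_all add: bounded_linear_coeff one_ell1_def delta.rep_eq)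

lemma coeff_times_var:
  "coeff (f * g) (X_var v) = coeff f 0 * coeff g (X_var v) + coeff f (X_var v) * coeff g 0"
  by (rule coeff_times_atom) (simp_all only: monomial_add_eq_var var_neq_zero not_False_eq_True)

lemma coeff_power_zero: "coeff (f ^ n) (0 :: monomial) = coeff f 0 ^ n"
  by (induction n) (simp_all add: coeff_zero_hom)

text \<open>When the constant term is zero, the powers of f from the second on have no linear
  part.\<close>

lemma coeff_exp_var:
  assumes "coeff f 0 = 0"
  shows "coeff (exp f) (X_var v) = coeff f (X_var v)"
proof -
  have "coeff (f ^ n) (X_var v) = (if n = 1 then coeff f (X_var v) else 0)" for n
    using var_neq_zero[of v] assms
    by (cases n) (auto simp: coeff_times_var coeff_power_zero one_ell1_def delta.rep_eq power_0_left)
  then have *: "coeff (f ^ n /\<^sub>R fact n) (X_var v) = (if n = 1 then coeff f (X_var v) else 0)" for n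
    by (simp add: scaleR_ell1.rep_eq)
  have "(\<lambda>n. coeff (f ^ n /\<^sub>R fact n) (X_var v)) sums coeff (exp f) (X_var v)"
    unfolding exp_def
    by (intro bounded_linear.sums[OF bounded_linear_coeff] summable_sums summable_exp_generic)
  moreover have "(\<lambda>n. coeff (f ^ n /\<^sub>R fact n) (X_var v)) sums coeff f (X_var v)"
    unfolding * by (rule sums_single)
  ultimately show ?thesis by (rule sums_unique2)
qed

text \<open>Each \<open>gen u\<close> has constant term zero, so by the Leibniz rule the dependence
  of Z and W on the variables does not enter at first order; only the explicit factor at (i, j)
  counts.\<close>

lemma coeff_double_series_var:
  assumes "norm Z \<le> 1/8" "norm W \<le> 1/8" "2 * s < i + j"
  shows "coeff (double_series s gen Z W) (X_var (i, j)) = coeff Z 0 ^ i * coeff W 0 ^ j"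
proof -
  let ?f = "\<lambda>(k,l). gen (k,l) * Z ^ k * W ^ l"
  have g0: "coeff (gen u) 0 = 0" and g1: "coeff (gen u) (X_var (i, j)) = (if u = (i, j) then 1 else 0)" for u
    using var_neq_zero[of u] by (auto simp: gen_def delta.rep_eq)
  have "((\<lambda>u. coeff (?f u) (X_var (i, j))) has_sum coeff (double_series s gen Z W) (X_var (i, j))) {(i,j). 2 * s < i + j}"
    unfolding double_series_def
    by (intro has_sum_bounded_linear[OF bounded_linear_coeff] has_sum_infsum double_series_summable norm_gen assms)
  moreover have "coeff (?f u) (X_var (i, j)) = (if u = (i, j) then coeff Z 0 ^ i * coeff W 0 ^ j else 0)" for u
    by (cases u) (simp add: mult.assoc coeff_times_var coeff_zero_hom coeff_power_zero g0 g1)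
  ultimately have "((\<lambda>u. if u = (i, j) then coeff Z 0 ^ i * coeff W 0 ^ j else 0) has_sum
      coeff (double_series s gen Z W) (X_var (i, j))) {(i,j). 2 * s < i + j}" by simp
  moreover have "((\<lambda>u. if u = (i, j) then coeff Z 0 ^ i * coeff W 0 ^ j else 0) has_sum
      (coeff Z 0 ^ i * coeff W 0 ^ j)) {(i,j). 2 * s < i + j}"
    by (rule has_sum_finite_neutralI[of "{(i, j)}"]) (use assms in auto)
  ultimately show ?thesis by (rule has_sum_unique)
qed

text \<open>Taking constant coefficients sets all variables to 0. There the zero tuple solves the
  equations, and uniqueness applies.\<close>

lemma solution_coeff_zero:
  assumes "small_radius s q r0" "series.orbit_solution s r0 \<beta> x q gen \<xi>" "m \<le> Suc q"
  shows "coeff (\<xi> m) 0 = 0"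
proof -
  have "scalar.orbit_solution s r0 \<beta> x q (\<lambda>v. coeff (gen v) 0) (\<lambda>m. coeff (\<xi> m) 0)"
    by (rule series.orbit_solution_hom[OF scalar.complex_scalars_axioms coeff_zero_hom assms(1) norm_gen
          norm_coeff_le assms(2)])
  also have "(\<lambda>v. coeff (gen v) 0) = (\<lambda>_. 0)"
    using var_neq_zero by (auto simp: gen_def delta.rep_eq)
  finally show ?thesis
    using scalar.orbit_solution_unique[OF assms(1) _ _ scalar.orbit_solution_zero assms(3)] by simp
qed

text \<open>To first order a kick is evaluated along the unperturbed rotation. The reflected kick
  contributes the conjugate value, so the two add up to a cosine.\<close>

lemma coeff_defect_var:
  assumes small: "small_radius s q r0" and sol: "series.orbit_solution s r0 \<beta> x q gen \<xi>"
    and n: "n < q" and l: "2 * s < l"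
  shows "coeff (series.defect s r0 \<beta> x gen \<xi> n) (X_var (l, 0)) =
    of_real (r0 ^ l * (2 * cos (real l * (x + real (Suc n) * \<beta>))))"
proof -
  have ball: "\<And>m. m \<le> Suc q \<Longrightarrow> norm (\<xi> m) \<le> 1/8"
    using sol by (simp add: series.orbit_solution_def)
  have point0: "coeff (series.point s r0 t \<sigma> y) 0 = of_real r0 * cis t" if "coeff \<sigma> 0 = 0" "coeff y 0 = 0" for t \<sigma> y
    using that series.point_hom[OF scalar.complex_scalars_axioms coeff_zero_hom small norm_gen, of t \<sigma> y]
    by (simp add: scalar.point_def scaleR_conv_of_real)
  have kick0: "coeff (series.kick s r0 gen t \<sigma> y) (X_var (l, 0)) = of_real r0 ^ l * cis (real l * t)"
    if "norm \<sigma> \<le> 1/8" "norm y \<le> 1/4" "coeff \<sigma> 0 = 0" "coeff y 0 = 0" for t \<sigma> y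
  proof -
    have "2 * r0 \<le> 1/8" using small_radiusD(6)[OF small] by simp
    then have "norm (series.point s r0 t \<sigma> y) \<le> 1/8" "norm (series.point s r0 (- t) \<sigma> (- y)) \<le> 1/8"
      using series.norm_point_le[OF small that(1), of y t] series.norm_point_le[OF small that(1), of "- y" "- t"] that(2)
      by auto
    then show ?thesis
      unfolding series.kick_def using l that
      by (simp add: coeff_double_series_var point0 power_mult_distrib) (simp only: Complex.DeMoivre simp_thms)
  qed
  have z: "coeff (\<xi> m) 0 = 0" if "m \<le> Suc q" for m
    by (rule solution_coeff_zero[OF small sol that])
  have "coeff (series.twist s r0 (\<xi> 0)) 0 = 0"
    using z[of 0] exp_homomorphism[of "\<lambda>f. coeff f 0", OF coeff_zero_hom(1-3), of "\<xi> 0"]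
    by (simp add: series.twist_def scaleR_ell1.rep_eq minus_ell1.rep_eq coeff_zero_hom)
  then have z1: "coeff (\<xi> (Suc n) + series.twist s r0 (\<xi> 0)) 0 = 0"
    using z[of "Suc n"] n by (simp add: plus_ell1.rep_eq)
  have z2: "coeff (- \<xi> (Suc (Suc n))) 0 = 0"
    using z[of "Suc (Suc n)"] n by (simp add: uminus_ell1.rep_eq)
  have "coeff (series.defect s r0 \<beta> x gen \<xi> n) (X_var (l, 0)) =
      of_real r0 ^ l * (cis (real l * (x + real (Suc n) * \<beta>)) + cis (real l * - (x + real (Suc n) * \<beta>)))"
    unfolding series.defect_def plus_ell1.rep_eq
    using kick0[OF ball[of 0] series.norm_angle_le(1)[of s q r0 \<xi> n, OF small ball n] z z1]
      kick0[OF ball[of 0] series.norm_angle_le(2)[of s q r0 \<xi> n, OF small ball n] z z2]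
    by (simp only: distrib_left)
  also have "cis t + cis (- t) = of_real (2 * cos t)" for t
    by (simp add: complex_eq_iff)
  then have "cis (real l * (x + real (Suc n) * \<beta>)) + cis (real l * - (x + real (Suc n) * \<beta>)) =
      of_real (2 * cos (real l * (x + real (Suc n) * \<beta>)))" by (metis mult_minus_right)
  finally show ?thesis by simp
qed

text \<open>In the equation at index 0 the remainder exp \<xi> - 1 - \<xi> has no linear part, so
  only the mean defect over r0^(2s) is left.\<close>

lemma coeff_solution_var:
  assumes small: "small_radius s q r0" and sol: "series.orbit_solution s r0 \<beta> x q gen \<xi>"
    and l: "2 * s < l"
  shows "coeff (\<xi> 0) (X_var (l, 0)) =
    of_real (- (r0 ^ l / r0 ^ (2 * s) / real q * (\<Sum>n<q. 2 * cos (real l * (x + real (Suc n) * \<beta>)))))"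
proof -
  let ?d = "\<lambda>f. coeff f (X_var (l, 0))"
  have "\<xi> 0 = - (series.mean_defect s r0 \<beta> x q gen \<xi> /\<^sub>R r0 ^ (2 * s)) - (exp (\<xi> 0) - 1 - \<xi> 0)"
    using sol unfolding series.orbit_solution_def
    by (auto simp: series.orbit_map_def dest: spec[of _ 0])
  then have "?d (\<xi> 0) = ?d (- (series.mean_defect s r0 \<beta> x q gen \<xi> /\<^sub>R r0 ^ (2 * s)) - (exp (\<xi> 0) - 1 - \<xi> 0))"
    by (rule arg_cong)
  also have "\<dots> = - (?d (series.mean_defect s r0 \<beta> x q gen \<xi>) /\<^sub>R r0 ^ (2 * s))"
    using coeff_exp_var[OF solution_coeff_zero[OF small sol]] var_neq_zero
    by (simp add: uminus_ell1.rep_eq minus_ell1.rep_eq scaleR_ell1.rep_eq one_ell1_def delta.rep_eq)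
  also have "?d (series.mean_defect s r0 \<beta> x q gen \<xi>) =
      (\<Sum>n<q. of_real (r0 ^ l * (2 * cos (real l * (x + real (Suc n) * \<beta>))))) /\<^sub>R real q"
    unfolding series.mean_defect_def
    by (simp add: scaleR_ell1.rep_eq linear_sum[OF bounded_linear.linear[OF bounded_linear_coeff]]
        coeff_defect_var[OF small sol _ l])
  also have "(\<Sum>n<q. complex_of_real (r0 ^ l * (2 * cos (real l * (x + real (Suc n) * \<beta>))))) =
      of_real (r0 ^ l * (\<Sum>n<q. 2 * cos (real l * (x + real (Suc n) * \<beta>))))"
    unfolding sum_distrib_left of_real_sum ..
  finally show ?thesis
    by (simp only: scaleR_conv_of_real of_real_mult[symmetric] of_real_minus[symmetric] divide_inverse)
      (simp only: mult_ac)
qed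

subsection \<open>Evaluation\<close>

definition admissible :: "nat \<Rightarrow> monom \<Rightarrow> bool" where
  "admissible s m \<longleftrightarrow> fin_monom m \<and> (\<forall>v. m v \<noteq> 0 \<longrightarrow> 2 * s < fst v + snd v)"

text \<open>The algebra has variables for all indices, also those with i + j <= 2s. Monomials
  containing such a variable are cut off; they vanish on \<open>Sigma_set s\<close>, so values there
  do not change.\<close>

definition to_pseries :: "nat \<Rightarrow> monomial ell1 \<Rightarrow> pseries" where
  "to_pseries s f m = (if admissible s m then coeff f (Abs_poly_mapping m) else 0)"

definition evaluation :: "(nat \<times> nat \<Rightarrow> complex) \<Rightarrow> monomial ell1 \<Rightarrow> complex" where
  "evaluation a f = pairing f (\<lambda>M. monom_val a (Poly_Mapping.lookup M))"

lemma is_pseries_to_pseries: "is_pseries s (to_pseries s f)"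
  by (auto simp: is_pseries_def to_pseries_def admissible_def split: if_splits)

lemma bij_betw_lookup: "bij_betw Poly_Mapping.lookup UNIV {m. fin_monom m}"
proof (rule bij_betwI[where g = Abs_poly_mapping])
  show "Poly_Mapping.lookup (Abs_poly_mapping m) = m" if "m \<in> {m. fin_monom m}" for m :: monom
    using that by (simp add: fin_monom_def)
qed (auto simp: fin_monom_def lookup_inverse)

lemma Sigma_norm_le:
  assumes "a \<in> Sigma_set s"
  shows "cmod (a v) \<le> 1"
proof (cases v)
  case (Pair i j)
  have "a (i,j) = 0 \<or> cmod (a (i,j)) < 1"
    using assms unfolding Sigma_set_def mem_Collect_eq by (meson not_less)
  then show ?thesis using Pair by auto
qed

lemma monom_val_lookup:
  assumes "finite V" "Poly_Mapping.keys M \<subseteq> V"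
  shows "monom_val a (Poly_Mapping.lookup M) = (\<Prod>v\<in>V. a v ^ Poly_Mapping.lookup M v)"
  unfolding monom_val_def
  by (rule prod.mono_neutral_left) (use assms in \<open>auto simp: in_keys_iff\<close>)

lemma monom_val_add:
  "monom_val a (Poly_Mapping.lookup (M + N)) =
    monom_val a (Poly_Mapping.lookup M) * monom_val a (Poly_Mapping.lookup N)"
proof -
  let ?V = "Poly_Mapping.keys M \<union> Poly_Mapping.keys N"
  have "Poly_Mapping.keys (M + N) \<subseteq> ?V" by (rule Poly_Mapping.keys_add)
  then show ?thesis
    by (simp add: monom_val_lookup[of ?V] lookup_add power_add prod.distrib)
qed

lemma norm_monom_val_le:
  assumes "\<And>v. cmod (a v) \<le> 1"
  shows "cmod (monom_val a (Poly_Mapping.lookup M)) \<le> 1"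
  unfolding monom_val_def prod_norm[symmetric] norm_power
  by (intro prod_le_1) (use assms in \<open>auto intro: power_le_one\<close>)

lemma evaluation_hom:
  assumes "\<And>v. cmod (a v) \<le> 1"
  shows "bounded_linear (evaluation a)" "evaluation a (f * g) = evaluation a f * evaluation a g"
    "evaluation a 1 = 1" "evaluation a (delta 0 c) = c" "cmod (evaluation a f) \<le> norm f"
    "evaluation a (gen v) = a v"
proof -
  note w = norm_monom_val_le[of a, OF assms]
  have 0: "monom_val a (Poly_Mapping.lookup 0) = 1" by (simp add: monom_val_def)
  show "bounded_linear (evaluation a)"
    unfolding evaluation_def[abs_def] by (rule bounded_linear_pairing[OF w])
  show "evaluation a (f * g) = evaluation a f * evaluation a g"
    unfolding evaluation_def by (rule pairing_character[OF w monom_val_add])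
  show "evaluation a 1 = 1" "evaluation a (delta 0 c) = c"
    by (simp_all add: evaluation_def pairing_one pairing_delta 0)
  show "cmod (evaluation a f) \<le> norm f"
    unfolding evaluation_def using norm_pairing_le[of _ 1 f, OF w] by simp
  have "monom_val a (Poly_Mapping.lookup (X_var v)) = (\<Prod>u\<in>{v}. a u ^ Poly_Mapping.lookup (X_var v) u)"
    by (rule monom_val_lookup) (simp_all add: X_var_def)
  then show "evaluation a (gen v) = a v"
    by (simp add: evaluation_def gen_def pairing_delta lookup_X_var)
qed

lemma ps_eval_to_pseries:
  assumes a: "a \<in> Sigma_set s"
  shows "ps_converges (to_pseries s f) a" "ps_eval (to_pseries s f) a = evaluation a f"
proof -
  have *: "to_pseries s f (Poly_Mapping.lookup M) * monom_val a (Poly_Mapping.lookup M) =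
      coeff f M * monom_val a (Poly_Mapping.lookup M)" for M
  proof (cases "admissible s (Poly_Mapping.lookup M)")
    case True
    then show ?thesis by (simp add: to_pseries_def lookup_inverse)
  next
    case False
    then obtain v where v: "Poly_Mapping.lookup M v \<noteq> 0" "\<not> 2 * s < fst v + snd v"
      by (auto simp: admissible_def fin_monom_def)
    have "\<forall>i j. i + j \<le> 2 * s \<longrightarrow> a (i,j) = 0" using a by (simp add: Sigma_set_def)
    with v(2) have "a v = 0" by (cases v) simp
    then have "monom_val a (Poly_Mapping.lookup M) = 0"
      unfolding monom_val_def using v by (intro prod_zero bexI[of _ v]) auto
    then show ?thesis by simp
  qed
  note w = norm_monom_val_le[of a, OF Sigma_norm_le[OF a]]
  show "ps_converges (to_pseries s f) a"
    unfolding ps_converges_def summable_on_reindex_bij_betw[OF bij_betw_lookup, symmetric] *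
    by (rule pairing_abs_summable[OF w])
  show "ps_eval (to_pseries s f) a = evaluation a f"
    unfolding ps_eval_def infsum_reindex_bij_betw[OF bij_betw_lookup, symmetric] * evaluation_def pairing_def ..
qed

subsection \<open>Functional independence\<close>

lemma ps_mul_constant_term: "ps_mul f g (\<lambda>_. 0) = f (\<lambda>_. 0) * g (\<lambda>_. 0)"
proof -
  have "{p :: monom. \<forall>v. p v \<le> 0} = {\<lambda>_. 0}" by auto
  then show ?thesis by (simp add: ps_mul_def)
qed

text \<open>Taking constant terms is multiplicative. It therefore suffices to examine the Jacobian
  at the origin, whose entries are the linear coefficients of the series.\<close>

lemma ps_det_constant_term:
  "ps_det n M (\<lambda>_. 0) = (\<Sum>\<sigma> | \<sigma> permutes {..<n}. of_int (sign \<sigma>) * (\<Prod>i<n. M i (\<sigma> i) (\<lambda>_. 0)))"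
proof -
  have fold: "foldr (\<lambda>i. ps_mul (M i (\<sigma> i))) is ps_one (\<lambda>_. 0) = (\<Prod>i\<leftarrow>is. M i (\<sigma> i) (\<lambda>_. 0))" for \<sigma> "is"
    by (induction "is") (simp_all add: ps_mul_constant_term ps_one_def)
  have list: "(\<Prod>i\<leftarrow>[0..<n]. g i) = (\<Prod>i<n. g i)" for g :: "nat \<Rightarrow> complex"
    using prod.distinct_set_conv_list[of "[0..<n]" g] by (simp add: atLeast0LessThan)
  show ?thesis unfolding ps_det_def fold list ..
qed

text \<open>A permutation with a nonvanishing product in the Jacobian increases \<open>w\<close> pointwise, and hence,
  preserving its sum, fixes it.\<close>

lemma func_indep_triangular:
  assumes diag: "\<And>k. H k ((\<lambda>_. 0)(V k := 1)) \<noteq> 0"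
    and tri: "\<And>k l. H k ((\<lambda>_. 0)(V l := 1)) \<noteq> 0 \<Longrightarrow> w k \<le> (w l :: nat)" and inj: "inj w"
  shows "func_indep H"
  unfolding func_indep_def
proof (intro allI impI)
  fix ks :: "nat list" assume dist: "distinct ks"
  define n where "n = length ks"
  define M where "M = (\<lambda>i j. ps_deriv (map V ks ! j) (H (ks ! i)))"
  have M: "M i j (\<lambda>_. 0) = H (ks ! i) ((\<lambda>_. 0)(V (ks ! j) := 1))" if "j < n" for i j
    using that by (simp add: M_def ps_deriv_def n_def)
  have "(\<Prod>i<n. M i (\<sigma> i) (\<lambda>_. 0)) = 0" if \<sigma>: "\<sigma> permutes {..<n}" "\<sigma> \<noteq> id" for \<sigma>
  proof (rule ccontr)
    assume "(\<Prod>i<n. M i (\<sigma> i) (\<lambda>_. 0)) \<noteq> 0"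
    then have nz: "M i (\<sigma> i) (\<lambda>_. 0) \<noteq> 0" if "i < n" for i using that by auto
    have lt: "\<sigma> i < n" if "i < n" for i using permutes_in_image[OF \<sigma>(1), of i] that by simp
    have le: "w (ks ! i) \<le> w (ks ! \<sigma> i)" if "i < n" for i
      using tri nz[OF that] lt[OF that] by (simp add: M)
    have "(\<Sum>i<n. w (ks ! \<sigma> i)) = (\<Sum>i<n. w (ks ! i))"
      using sum.permute[OF \<sigma>(1), of "\<lambda>i. w (ks ! i)"] by (simp add: o_def)
    then have eq: "w (ks ! \<sigma> i) = w (ks ! i)" if "i < n" for i
      using sum_mono_inv[of "\<lambda>i. w (ks ! i)" "{..<n}" "\<lambda>i. w (ks ! \<sigma> i)" i] le that by simp
    have "\<sigma> i = i" for i
    proof (cases "i < n")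
      case True
      then have "ks ! \<sigma> i = ks ! i" using eq inj by (simp add: inj_eq)
      then show ?thesis using dist True lt by (simp add: nth_eq_iff_index_eq n_def)
    next
      case False
      then show ?thesis using permutes_not_in[OF \<sigma>(1)] by simp
    qed
    then show False using \<sigma>(2) by auto
  qed
  then have "ps_det n M (\<lambda>_. 0) = (\<Sum>\<sigma>\<in>{id}. of_int (sign \<sigma>) * (\<Prod>i<n. M i (\<sigma> i) (\<lambda>_. 0)))"
    unfolding ps_det_constant_term
    by (intro sum.mono_neutral_right) (auto simp: finite_permutations permutes_id)
  also have "\<dots> \<noteq> 0" using diag by (simp add: M)
  finally have "ps_det n M \<noteq> (\<lambda>_. 0)" by metis
  then show "\<exists>vs. length vs = length ks \<and>
      ps_det (length ks) (\<lambda>i j. ps_deriv (vs ! j) (H (ks ! i))) \<noteq> (\<lambda>_. 0)"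
    by (intro exI[of _ "map V ks"]) (simp add: M_def n_def)
qed

subsection \<open>The obstructions\<close>

definition solution :: "nat \<Rightarrow> real \<Rightarrow> real \<Rightarrow> real \<Rightarrow> nat \<Rightarrow> nat \<Rightarrow> monomial ell1" where
  "solution s r0 \<beta> x q = (SOME \<xi>. series.orbit_solution s r0 \<beta> x q gen \<xi>)"

definition obstruction :: "nat \<Rightarrow> real \<Rightarrow> real \<Rightarrow> nat \<Rightarrow> monomial ell1" where
  "obstruction s r0 \<beta> q = solution s r0 \<beta> 0 q 0 - solution s r0 \<beta> (pi / real q) q 0"

lemma solution:
  "small_radius s q r0 \<Longrightarrow> series.orbit_solution s r0 \<beta> x q gen (solution s r0 \<beta> x q)"
  unfolding solution_def by (rule someI_ex[OF series.orbit_solution_exists[OF _ norm_gen]])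

text \<open>A full geometric sum over the powers of exp(2 pi i l p/q), a q-th root of unity other
  than 1 because p is prime to q.\<close>

lemma sum_cos_zero:
  fixes p :: int
  assumes q: "0 < q" "coprime p (int q)" and l: "\<not> q dvd l"
  shows "(\<Sum>n<q. 2 * cos (real l * (x + real (Suc n) * (2 * pi * of_int p / real q)))) = 0"
proof -
  define \<omega> where "\<omega> = cis (real l * (2 * pi * of_int p / real q))"
  have "\<omega> ^ q = cis (2 * pi * of_int (int l * p))"
    using q by (simp add: \<omega>_def Complex.DeMoivre field_simps)
  then have \<omega>q: "\<omega> ^ q = 1" by (simp add: cis_multiple_2pi)
  have \<omega>1: "\<omega> \<noteq> 1"
  proof
    assume "\<omega> = 1"
    then have "cos (real l * (2 * pi * of_int p / real q)) = 1" by (simp add: \<omega>_def complex_eq_iff)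
    then obtain k :: int where "real l * (2 * pi * of_int p / real q) = of_int k * 2 * pi"
      unfolding cos_one_2pi_int by blast
    then have "real l * of_int p = of_int k * real q" using q by (simp add: field_simps)
    then have "of_int (int l * p) = (of_int (k * int q) :: real)" by simp
    then have "int l * p = k * int q" by (simp only: of_int_eq_iff)
    then have "int q dvd int l * p" by simp
    then have "int q dvd int l" using q by (simp add: coprime_dvd_mult_left_iff coprime_commute)
    with l show False by simp
  qed
  have "(\<Sum>n<q. cis (real l * (x + real (Suc n) * (2 * pi * of_int p / real q)))) =
      cis (real l * x) * \<omega> * (\<Sum>n<q. \<omega> ^ n)"
    unfolding sum_distrib_left \<omega>_def Complex.DeMoivre cis_mult
    by (intro sum.cong refl arg_cong[where f = cis]) (simp add: algebra_simps add_divide_distrib)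
  also have "\<dots> = 0" using \<omega>q \<omega>1 by (simp add: geometric_sum)
  finally have "Re (\<Sum>n<q. cis (real l * (x + real (Suc n) * (2 * pi * of_int p / real q)))) = 0" by simp
  then show ?thesis by (simp flip: sum_distrib_left)
qed

lemma sum_cos_resonant:
  fixes p :: int
  assumes q: "0 < q"
  shows "(\<Sum>n<q. 2 * cos (real q * (x + real (Suc n) * (2 * pi * of_int p / real q)))) = 2 * real q * cos (real q * x)"
proof -
  have "cos (real q * (x + real (Suc n) * (2 * pi * of_int p / real q))) = cos (real q * x)" for n
  proof -
    have "real q * (x + real (Suc n) * (2 * pi * of_int p / real q)) = real q * x + of_int (int (Suc n) * p) * (2 * pi)"
      using q by (simp add: field_simps)
    then show ?thesis by (simp only: cos_add cos_int_2pin sin_int_2pin mult.commute[of _ "2 * pi"])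
  qed
  then show ?thesis by simp
qed

lemma to_pseries_var:
  assumes "2 * s < fst v + snd v"
  shows "to_pseries s f ((\<lambda>_. 0)(v := 1)) = coeff f (X_var v)"
proof -
  have "(\<lambda>_. 0)(v := 1) = Poly_Mapping.lookup (X_var v)"
    by (auto simp: lookup_X_var fun_eq_iff)
  moreover have "admissible s ((\<lambda>_. 0)(v := 1))"
    using assms by (auto simp: admissible_def fin_monom_def split: if_splits)
  ultimately show ?thesis by (simp add: to_pseries_def lookup_inverse)
qed

text \<open>Off resonance the cosine sums vanish at both starting angles. For l = q the coefficient
  of the solution is -2 r0^(q-2s) cos(q x), so the difference between x = 0 and x = pi/q is -4
  r0^(q-2s).\<close>

lemma coeff_obstruction:
  fixes p :: int
  assumes small: "small_radius s q r0" and cop: "coprime p (int q)" and l: "2 * s < l"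
  shows "\<not> q dvd l \<Longrightarrow> coeff (obstruction s r0 (2 * pi * of_int p / real q) q) (X_var (l, 0)) = 0"
    and "q = l \<Longrightarrow> coeff (obstruction s r0 (2 * pi * of_int p / real q) q) (X_var (l, 0)) \<noteq> 0"
proof -
  note r = small_radiusD[OF small]
  note c = coeff_solution_var[OF small solution[OF small] l]
  show "coeff (obstruction s r0 (2 * pi * of_int p / real q) q) (X_var (l, 0)) = 0" if "\<not> q dvd l"
    unfolding obstruction_def minus_ell1.rep_eq c sum_cos_zero[OF r(2) cop that] by simp
  show "coeff (obstruction s r0 (2 * pi * of_int p / real q) q) (X_var (l, 0)) \<noteq> 0" if "q = l"
    unfolding obstruction_def minus_ell1.rep_eq c unfolding that[symmetric] sum_cos_resonant[OF r(2)]
    using r that by simp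
qed

text \<open>The evaluated formal solutions solve the equations over the complex numbers, so by
  uniqueness they are the given ones. With solutions read off from real orbits, this makes the value
  of the series a difference of actual radius parameters.\<close>

lemma evaluation_obstruction:
  assumes small: "small_radius s q r0" and a: "\<And>v. cmod (a v) \<le> 1"
    and "scalar.orbit_solution s r0 \<beta> 0 q a \<xi>" "scalar.orbit_solution s r0 \<beta> (pi / real q) q a \<xi>'"
  shows "evaluation a (obstruction s r0 \<beta> q) = \<xi> 0 - \<xi>' 0"
proof -
  have *: "scalar.orbit_solution s r0 \<beta> x q a (\<lambda>m. evaluation a (solution s r0 \<beta> x q m))" for x
    using series.orbit_solution_hom[OF scalar.complex_scalars_axioms evaluation_hom(1-4)[OF a] small norm_gen
        evaluation_hom(5)[OF a] solution[OF small]] by (simp add: evaluation_hom(6)[OF a])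
  show ?thesis
    unfolding obstruction_def linear_simps[OF evaluation_hom(1)[of a, OF a]]
    using scalar.orbit_solution_unique[OF small a * assms(3)] scalar.orbit_solution_unique[OF small a * assms(4)]
    by simp
qed

subsection \<open>Approximation from above\<close>

text \<open>Kronecker density supplies fractions h/k just above \<theta> with h - k \<theta> as
  small as desired, and cancelling a common factor only shrinks this gap. Finitely many denominators
  have a positive least gap.\<close>

lemma infinite_close_denominators:
  fixes \<theta> :: real
  assumes irr: "\<theta> \<notin> \<rat>" and "\<eta> > 0"
  shows "infinite {q. \<exists>p. 0 < q \<and> coprime p (int q) \<and> 0 < of_int p - real q * \<theta> \<and> of_int p - real q * \<theta> < \<eta>}"
    (is "infinite ?S")
proof
  assume fin: "finite ?S"
  have ex: "\<exists>q p. 0 < q \<and> coprime p (int q) \<and> 0 < of_int p - real q * \<theta> \<and> of_int p - real q * \<theta> < e"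
    if e: "e > 0" for e
  proof -
    \<comment> \<open>Target -e/2 with tolerance e/2 places k \<theta> - h strictly between -e and
      0.\<close>
    obtain h k where hk: "k > 0" "\<bar>of_int k * \<theta> - of_int h - (- e / 2)\<bar> < e / 2"
      using sequence_of_fractional_parts_is_dense[OF irr, of "e / 2" "- e / 2"] e by (metis half_gt_zero)
    define d where "d = gcd h k"
    have d: "d > 0" using hk by (simp add: d_def)
    obtain p q where pq: "h = d * p" "k = d * q" "coprime p q"
      using gcd_coprime_exists[of h k] hk unfolding d_def by (metis gcd_eq_0_iff less_irrefl mult.commute)
    have "0 < q" using hk d pq by (simp add: zero_less_mult_iff)
    have v: "of_int h - of_int k * \<theta> = of_int d * (of_int p - of_int q * \<theta>)"
      by (simp add: pq algebra_simps)
    have b: "0 < of_int h - of_int k * \<theta>" "of_int h - of_int k * \<theta> < e" using hk(2) by linarith+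
    then have pos: "0 < of_int p - of_int q * \<theta>" using v d by (simp add: zero_less_mult_iff)
    have "1 * (of_int p - of_int q * \<theta>) \<le> of_int d * (of_int p - of_int q * \<theta>)"
      using pos d by (intro mult_right_mono) auto
    then have "of_int p - of_int q * \<theta> < e" using v b by simp
    with pos \<open>0 < q\<close> pq(3) show ?thesis
      by (intro exI[of _ "nat q"] exI[of _ p]) simp
  qed
  \<comment> \<open>The least positive value of p - q \<theta> that the denominator q
    allows.\<close>
  define gap where "gap q = of_int \<lceil>real q * \<theta>\<rceil> - real q * \<theta>" for q
  have gap: "gap q > 0" if "0 < q" for q
  proof -
    have "real q * \<theta> \<noteq> of_int \<lceil>real q * \<theta>\<rceil>"
    proof
      assume "real q * \<theta> = of_int \<lceil>real q * \<theta>\<rceil>"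
      then have "\<theta> = of_int \<lceil>real q * \<theta>\<rceil> / of_nat q" using that by (simp add: field_simps)
      then show False using irr by (metis Rats_divide Rats_of_int Rats_of_nat)
    qed
    then show ?thesis unfolding gap_def using le_of_int_ceiling[of "real q * \<theta>"] by linarith
  qed
  define e where "e = Min (insert \<eta> (gap ` ?S))"
  have "e > 0" unfolding e_def using fin \<open>\<eta> > 0\<close> gap by (subst Min_gr_iff) auto
  then obtain q p where pq: "0 < q" "coprime p (int q)" "0 < of_int p - real q * \<theta>" "of_int p - real q * \<theta> < e"
    using ex by blast
  have "e \<le> \<eta>" unfolding e_def using fin by simp
  with pq have "q \<in> ?S" by (auto intro!: exI[of _ p])
  then have "e \<le> gap q" unfolding e_def using fin by simp
  moreover have "\<lceil>real q * \<theta>\<rceil> \<le> p" using pq(3) by (simp add: ceiling_le_iff)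
  then have "gap q \<le> of_int p - real q * \<theta>" by (simp add: gap_def)
  ultimately show False using pq(4) by simp
qed

subsection \<open>Circle maps\<close>

lemma contraction_root:
  fixes f :: "real \<Rightarrow> real"
  assumes "\<And>x y. \<bar>f x - f y\<bar> \<le> \<bar>x - y\<bar> / 2"
  shows "\<exists>!x. x - f x = y"
proof -
  have "\<exists>!x. y + f x = x"
    by (rule banach_fix_type[where c = "1/2"]) (use assms in \<open>auto simp: dist_real_def\<close>)
  moreover have "y + f x = x \<longleftrightarrow> x - f x = y" for x by linarith
  ultimately show ?thesis by simp
qed

lemma cis_diff_le: "cmod (cis x - cis y) \<le> \<bar>x - y\<bar>"
proof -
  have "cis x - cis y = cis ((x + y) / 2) * (cis ((x - y) / 2) - cis (- ((x - y) / 2)))"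
    by (simp add: cis_mult right_diff_distrib diff_divide_distrib[symmetric] add_divide_distrib[symmetric] field_simps)
  also have "cis ((x - y) / 2) - cis (- ((x - y) / 2)) = 2 * \<i> * of_real (sin ((x - y) / 2))"
    by (simp add: complex_eq_iff)
  finally have "cmod (cis x - cis y) = 2 * \<bar>sin ((x - y) / 2)\<bar>"
    by (simp add: norm_mult)
  also have "\<dots> \<le> 2 * \<bar>(x - y) / 2\<bar>" by (intro mult_left_mono abs_sin_x_le_abs_x) auto
  finally show ?thesis by simp
qed


text \<open>On this disc \<open>a_tilde\<close> has Lipschitz constant at most 1/16 for every a in
  Sigma, which makes \<open>phi_map\<close> and the angle maps invertible there.\<close>

definition radius_bound :: "nat \<Rightarrow> real" where "radius_bound s = 1 / (16 * kick_const s)"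

lemma radius_bound: "0 < radius_bound s" "radius_bound s \<le> 1/16"
  using kick_const_ge[of s] by (auto simp: radius_bound_def field_simps)

locale reversible_map =
  fixes s :: nat and \<alpha> :: real and a :: "nat \<times> nat \<Rightarrow> complex"
  assumes s: "0 < s" and a: "a \<in> Sigma_set s"
begin

abbreviation R :: real where "R \<equiv> radius_bound s"

definition disp :: "real \<Rightarrow> real \<Rightarrow> real" where
  "disp r X = Re (a_tilde s a (of_real r * cis X))"

lemma a_le: "cmod (a v) \<le> 1"
  by (rule Sigma_norm_le[OF a])

lemma a_tilde_eq: "a_tilde s a z = double_series s a z (cnj z)"
  by (simp add: a_tilde_def double_series_def)

text \<open>Conjugating each term and exchanging i with j leaves the sum unchanged.\<close>

lemma a_tilde_real: "a_tilde s a z = of_real (Re (a_tilde s a z))"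
proof -
  let ?A = "{(i,j). 2 * s < i + j}"
  have sym: "a (j,i) = cnj (a (i,j))" if "2 * s < i + j" for i j
    using a that unfolding Sigma_set_def by blast
  have "cnj (a_tilde s a z) = (\<Sum>\<^sub>\<infinity>(i,j)\<in>?A. cnj (a (i,j) * z ^ i * cnj z ^ j))"
    unfolding a_tilde_def infsum_cnj[symmetric] by (simp add: case_prod_unfold)
  also have "\<dots> = (\<Sum>\<^sub>\<infinity>(i,j)\<in>?A. a (i,j) * z ^ i * cnj z ^ j)"
  proof (rule infsum_reindex_bij_witness[where i = prod.swap and j = prod.swap])
    fix x assume "x \<in> ?A"
    then show "(case prod.swap x of (i,j) \<Rightarrow> a (i,j) * z ^ i * cnj z ^ j) =
        (case x of (i,j) \<Rightarrow> cnj (a (i,j) * z ^ i * cnj z ^ j))"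
      using sym[of "fst x" "snd x"] by (auto simp: prod.swap_def)
  qed auto
  finally have "cnj (a_tilde s a z) = a_tilde s a z" by (simp add: a_tilde_def)
  then show ?thesis by (simp add: complex_eq_iff)
qed

lemma disp: "a_tilde s a (of_real r * cis X) = of_real (disp r X)"
  unfolding disp_def by (rule a_tilde_real)

lemma a_tilde_diff_le:
  assumes "cmod z \<le> R" "cmod w \<le> R"
  shows "cmod (a_tilde s a z - a_tilde s a w) \<le> cmod (z - w) / 16"
proof -
  note R = radius_bound[of s]
  have "cmod (a_tilde s a z - a_tilde s a w) \<le> lip_const s * R ^ (2 * s) * (cmod (z - w) + cmod (cnj z - cnj w))"
    unfolding a_tilde_eq using assms R by (intro double_series_diff_le a_le) auto
  also have "cmod (cnj z - cnj w) = cmod (z - w)" by (metis complex_cnj_diff complex_mod_cnj)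
  also have "lip_const s * R ^ (2 * s) * (cmod (z - w) + cmod (z - w)) =
      (2 * lip_const s) * R ^ (2 * s) * cmod (z - w)" by simp
  also have "\<dots> \<le> kick_const s * R * cmod (z - w)"
  proof (intro mult_right_mono mult_mono)
    have "2 * lip_const s \<le> (24 * 4 ^ s) * lip_const s"
      using lip_const_pos[of s] one_le_power[of "4::real" s] by (intro mult_right_mono) linarith+
    then show "2 * lip_const s \<le> kick_const s" by (simp add: kick_const_def)
    have "R ^ (2 * s) \<le> R ^ 1" using R s by (intro power_decreasing) auto
    then show "R ^ (2 * s) \<le> R" by simp
  qed (use R kick_const_ge[of s] in auto)
  also have "kick_const s * R = 1/16" using kick_const_ge[of s] by (simp add: radius_bound_def)
  finally show ?thesis by simp
qed

lemma a_tilde_zero: "a_tilde s a 0 = 0"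
  by (simp add: a_tilde_eq)

lemma a_tilde_le: "cmod z \<le> R \<Longrightarrow> cmod (a_tilde s a z) \<le> 1/2"
  using a_tilde_diff_le[of z 0] radius_bound[of s] by (simp add: a_tilde_zero)

lemma disp_diff_le:
  assumes "0 \<le> r" "r \<le> R"
  shows "\<bar>disp r X - disp r Y\<bar> \<le> \<bar>X - Y\<bar> / 2"
proof -
  have "\<bar>disp r X - disp r Y\<bar> = cmod (a_tilde s a (of_real r * cis X) - a_tilde s a (of_real r * cis Y))"
    unfolding disp by (simp flip: of_real_diff)
  also have "\<dots> \<le> cmod (of_real r * cis X - of_real r * cis Y) / 16"
    using assms by (intro a_tilde_diff_le) (auto simp: norm_mult)
  also have "of_real r * cis X - of_real r * cis Y = of_real r * (cis X - cis Y)" by (simp add: algebra_simps)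
  also have "cmod (of_real r * (cis X - cis Y)) / 16 \<le> (1 * \<bar>X - Y\<bar>) / 16"
    unfolding norm_mult using assms radius_bound[of s] cis_diff_le
    by (intro divide_right_mono mult_mono) auto
  finally show ?thesis by linarith
qed

lemma disp_minus_diff_le:
  assumes "0 \<le> r" "r \<le> R"
  shows "\<bar>disp r (- X) - disp r (- Y)\<bar> \<le> \<bar>X - Y\<bar> / 2"
  using disp_diff_le[OF assms, of "- X" "- Y"] by (simp add: abs_minus_commute)

lemma disp_periodic: "disp r (X + 2 * pi * of_int k) = disp r X"
  by (simp add: disp_def flip: cis_mult)

section \<open>Joint continuity of the circle maps in radius and angle\<close>

lemma continuous_compose_pair:
  assumes "continuous_on ({0..R} \<times> UNIV) (\<lambda>x. f (fst x) (snd x :: real))"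
    and "continuous_on A g" "continuous_on A h" "g ` A \<subseteq> {0..R}"
  shows "continuous_on A (\<lambda>x. f (g x) (h x))"
proof -
  have "(\<lambda>x. (g x, h x)) ` A \<subseteq> {0..R} \<times> UNIV" using assms(4) by auto
  from continuous_on_compose2[OF assms(1) continuous_on_Pair[OF assms(2,3)] this] show ?thesis by simp
qed

lemma continuous_disp: "continuous_on ({0..R} \<times> UNIV) (\<lambda>x. disp (fst x) (snd x))"
proof -
  have "continuous_on (cball 0 R) (a_tilde s a)"
    by (rule lipschitz_on_continuous_on[of "1/16"], rule lipschitz_onI)
      (use a_tilde_diff_le in \<open>auto simp: dist_norm\<close>)
  moreover have "continuous_on ({0..R} \<times> UNIV) (\<lambda>x. of_real (fst x) * cis (snd x))"
    by (intro continuous_intros)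
  moreover have "(\<lambda>x. of_real (fst x) * cis (snd x)) ` ({0..R} \<times> UNIV) \<subseteq> cball 0 R"
    by (auto simp: norm_mult)
  ultimately have "continuous_on ({0..R} \<times> UNIV) (\<lambda>x. a_tilde s a (of_real (fst x) * cis (snd x)))"
    by (rule continuous_on_compose2)
  then show ?thesis
    unfolding disp_def by (rule continuous_on_Re)
qed

definition angle :: "real \<Rightarrow> real" where "angle r = \<alpha> + r ^ (2 * s)"

text \<open>The angular form of \<open>cnj \<circ> \<psi> \<circ> cnj\<close>: conjugation negates
  angles, so the map inverted is X - disp r (-X).\<close>

definition reflect_inv :: "real \<Rightarrow> real \<Rightarrow> real" where
  "reflect_inv r Y = (THE X. X - disp r (- X) = Y)"

text \<open>\<open>varphi_map\<close> conjugated by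
  \<open>cnj \<circ> phi_map s a \<circ> cnj\<close>. This puts the inverse last, so that its
  defining equation expresses the step through two displacements, one of them at the new
  angle.\<close>

definition step :: "real \<Rightarrow> real \<Rightarrow> real" where
  "step r X = reflect_inv r (X + angle r + disp r (X + angle r))"

lemma reflect_inv:
  assumes "0 \<le> r" "r \<le> R"
  shows "reflect_inv r Y - disp r (- reflect_inv r Y) = Y"
  unfolding reflect_inv_def
  using theI'[OF contraction_root[of "\<lambda>X. disp r (- X)", OF disp_minus_diff_le[OF assms]]] .

lemma step:
  assumes "0 \<le> r" "r \<le> R"
  shows "step r X = X + angle r + (disp r (X + angle r) + disp r (- step r X))"
  using reflect_inv[OF assms, of "X + angle r + disp r (X + angle r)"]
  by (simp add: step_def)

text \<open>The Lipschitz constant 1/2 in X lets half of the difference of two roots be absorbed,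
  leaving twice the change of the data.\<close>

lemma continuous_reflect_inv: "continuous_on ({0..R} \<times> UNIV) (\<lambda>x. reflect_inv (fst x) (snd x))"
  unfolding continuous_on_def
proof safe
  fix r1 Y1 :: real assume r1: "r1 \<in> {0..R}"
  define X1 where "X1 = reflect_inv r1 Y1"
  let ?F = "at (r1, Y1) within {0..R} \<times> UNIV"
  let ?g = "\<lambda>x. 2 * (\<bar>snd x - Y1\<bar> + \<bar>disp (fst x) (- X1) - disp r1 (- X1)\<bar>)"
  have "((\<lambda>x. reflect_inv (fst x) (snd x) - X1) \<longlongrightarrow> 0) ?F"
  proof (rule Lim_null_comparison)
    have "\<bar>reflect_inv r Y - X1\<bar> \<le> ?g (r, Y)" if r: "r \<in> {0..R}" for r Y
    proof -
      let ?X = "reflect_inv r Y"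
      have "?X - disp r (- ?X) = Y" using r by (intro reflect_inv) auto
      moreover have "X1 - disp r1 (- X1) = Y1" using r1 unfolding X1_def by (intro reflect_inv) auto
      moreover have "\<bar>disp r (- ?X) - disp r (- X1)\<bar> \<le> \<bar>?X - X1\<bar> / 2"
        using r by (intro disp_minus_diff_le) auto
      moreover have "\<bar>?X - X1\<bar> \<le> \<bar>Y - Y1\<bar> + \<bar>disp r (- ?X) - disp r (- X1)\<bar> + \<bar>disp r (- X1) - disp r1 (- X1)\<bar>"
        using calculation(1,2) by arith
      ultimately show ?thesis unfolding fst_conv snd_conv by argo
    qed
    then show "\<forall>\<^sub>F x in ?F. norm (reflect_inv (fst x) (snd x) - X1) \<le> ?g x"
      unfolding eventually_at_filter by (auto intro!: always_eventually)
    have "continuous_on ({0..R} \<times> (UNIV :: real set)) (\<lambda>x. disp (fst x) (- X1))"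
      by (rule continuous_compose_pair[OF continuous_disp]) (auto intro!: continuous_intros)
    then have "continuous_on ({0..R} \<times> UNIV) ?g"
      by (intro continuous_intros)
    then have "(?g \<longlongrightarrow> ?g (r1, Y1)) ?F"
      using r1 unfolding continuous_on_def by blast
    then show "(?g \<longlongrightarrow> 0) ?F" by simp
  qed
  then have "((\<lambda>x. reflect_inv (fst x) (snd x)) \<longlongrightarrow> X1) ?F"
    by (simp add: LIM_zero_iff)
  then show "((\<lambda>x. reflect_inv (fst x) (snd x)) \<longlongrightarrow> reflect_inv (fst (r1, Y1)) (snd (r1, Y1))) ?F"
    by (simp add: X1_def)
qed

lemma continuous_step: "continuous_on ({0..R} \<times> UNIV) (\<lambda>x. step (fst x) (snd x))"
proof -
  have 0: "continuous_on ({0..R} \<times> UNIV) (\<lambda>x :: real \<times> real. angle (fst x))"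
    unfolding angle_def by (intro continuous_intros)
  have 1: "continuous_on ({0..R} \<times> UNIV) (\<lambda>x. disp (fst x) (snd x + angle (fst x)))"
    by (rule continuous_compose_pair[OF continuous_disp]) (auto intro!: continuous_intros 0)
  show ?thesis
    unfolding step_def
    by (rule continuous_compose_pair[OF continuous_reflect_inv]) (auto intro!: continuous_intros 0 1)
qed

lemma continuous_step_iter: "continuous_on ({0..R} \<times> UNIV) (\<lambda>x. (step (fst x) ^^ n) (snd x))"
proof (induction n)
  case (Suc n)
  show ?case
    unfolding funpow.simps o_apply
    by (rule continuous_compose_pair[OF continuous_step]) (auto intro!: continuous_intros Suc)
qed (auto intro!: continuous_intros)

lemma continuous_step_iter_radius: "continuous_on {0..R} (\<lambda>r. (step r ^^ n) X)"
  by (rule continuous_compose_pair[OF continuous_step_iter]) (auto intro!: continuous_intros)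

lemma continuous_step_iter_angle:
  assumes "0 \<le> r" "r \<le> R"
  shows "continuous_on A (\<lambda>X. (step r ^^ n) X)"
  by (rule continuous_compose_pair[OF continuous_step_iter]) (use assms in \<open>auto intro!: continuous_intros\<close>)

subsection \<open>The planar map\<close>

abbreviation \<phi> where "\<phi> \<equiv> phi_map s a"

definition \<psi> :: "complex \<Rightarrow> complex" where "\<psi> = inv_into (ball 0 R) \<phi>"

lemma phi_polar: "\<phi> (of_real r * cis X) = of_real r * cis (X + disp r X)"
  by (simp add: phi_map_def disp cis_conv_exp[symmetric] mult.assoc cis_mult)

lemma norm_phi: "cmod (\<phi> z) = cmod z"
  by (subst phi_map_def, subst a_tilde_real) (simp add: norm_mult)

text \<open>Injectivity: preimages of v solve z = v exp(-i a_tilde z), whose right side has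
  Lipschitz constant at most 1/8 on the disc. Surjectivity: the angle equation X + disp r X = Arg w
  is solved on each circle.\<close>

lemma bij_phi: "bij_betw \<phi> (ball 0 R) (ball 0 R)"
  unfolding bij_betw_def
proof
  show "inj_on \<phi> (ball 0 R)"
  proof (rule inj_onI)
    fix z w assume z: "z \<in> ball 0 R" and w: "w \<in> ball 0 R" and eq: "\<phi> z = \<phi> w"
    define v where "v = \<phi> z"
    have zv: "z = v * exp (- (\<i> * a_tilde s a z))"
      by (simp add: v_def phi_map_def exp_minus)
    have wv: "w = v * exp (- (\<i> * a_tilde s a w))"
      unfolding v_def eq by (simp add: phi_map_def exp_minus)
    have "cmod (exp (- (\<i> * a_tilde s a z)) - exp (- (\<i> * a_tilde s a w)))
        \<le> exp (1/2) * cmod (- (\<i> * a_tilde s a z) - - (\<i> * a_tilde s a w))"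
      using z w a_tilde_le[of z] a_tilde_le[of w] by (intro norm_exp_diff_le) (auto simp: norm_mult)
    also have "- (\<i> * a_tilde s a z) - - (\<i> * a_tilde s a w) = - \<i> * (a_tilde s a z - a_tilde s a w)"
      by (simp add: algebra_simps)
    also have "exp (1/2) * cmod \<dots> \<le> 2 * (cmod (z - w) / 16)"
      unfolding norm_mult using z w a_tilde_diff_le[of z w] exp_half_le[of "1/2"]
      by (intro mult_mono) auto
    finally have e: "cmod (exp (- (\<i> * a_tilde s a z)) - exp (- (\<i> * a_tilde s a w))) \<le> 2 * (cmod (z - w) / 16)" .
    have v1: "cmod v \<le> 1" using z radius_bound[of s] by (simp add: v_def norm_phi)
    have "z - w = v * (exp (- (\<i> * a_tilde s a z)) - exp (- (\<i> * a_tilde s a w)))"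
      using zv wv by (simp add: right_diff_distrib)
    then have "cmod (z - w) = cmod v * cmod (exp (- (\<i> * a_tilde s a z)) - exp (- (\<i> * a_tilde s a w)))"
      by (simp only: norm_mult)
    also have "\<dots> \<le> 1 * (2 * (cmod (z - w) / 16))" using v1 e by (intro mult_mono) auto
    finally have "cmod (z - w) \<le> 0" by linarith
    then show "z = w" by simp
  qed
  show "\<phi> ` ball 0 R = ball 0 R"
  proof
    show "ball 0 R \<subseteq> \<phi> ` ball 0 R"
    proof
      fix w :: complex assume w: "w \<in> ball 0 R"
      have "\<exists>X. X - - disp (cmod w) X = Arg w"
      proof (rule ex1_implies_ex[OF contraction_root])
        show "\<bar>- disp (cmod w) x - - disp (cmod w) y\<bar> \<le> \<bar>x - y\<bar> / 2" for x y
          using disp_diff_le[of "cmod w" x y] w by (simp add: abs_minus_commute)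
      qed
      then obtain X where X: "X + disp (cmod w) X = Arg w" by auto
      have "\<phi> (of_real (cmod w) * cis X) = w"
        unfolding phi_polar X using rcis_cmod_Arg[of w] by (simp add: rcis_def)
      moreover have "of_real (cmod w) * cis X \<in> ball 0 R" using w by (simp add: norm_mult)
      ultimately show "w \<in> \<phi> ` ball 0 R" by (metis image_eqI)
    qed
  qed (auto simp: norm_phi)
qed

lemma local_inverse_phi: "local_inverse \<phi> \<psi> R"
  unfolding local_inverse_def \<psi>_def
  using bij_phi bij_betw_inv_into_left[OF bij_phi] bij_betw_inv_into_right[OF bij_phi]
    bij_betwE[OF bij_phi] bij_betwE[OF bij_betw_inv_into[OF bij_phi]] by blast

text \<open>The chart X - disp r (-X) is the angular form of the reflected \<open>phi_map\<close>,
  the conjugacy built into \<open>step\<close>.\<close>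

lemma varphi_polar:
  assumes r: "0 \<le> r" "r < R"
  shows "varphi_map s \<alpha> a \<psi> (of_real r * cis (X - disp r (- X))) =
    of_real r * cis (step r X - disp r (- step r X))"
proof -
  let ?z = "of_real r * cis (- X)"
  have "cnj (of_real r * cis (X - disp r (- X))) = \<phi> ?z"
    by (simp add: phi_polar cis_cnj)
  moreover have "\<psi> (\<phi> ?z) = ?z"
    using local_inverse_phi r by (simp add: local_inverse_def norm_mult)
  moreover have "T_map s \<alpha> (of_real r * cis X) = of_real r * cis (X + angle r)"
  proof -
    have "of_real r * cis X * cnj (of_real r * cis X) = of_real (r ^ 2)"
      by (simp add: cis_cnj cis_mult power2_eq_square mult_ac)
    then have "(of_real r * cis X * cnj (of_real r * cis X)) ^ s = of_real (r ^ (2 * s))"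
      by (simp add: power_mult)
    then show ?thesis
      unfolding T_map_def angle_def by (simp add: cis_conv_exp algebra_simps flip: exp_add)
  qed
  ultimately have "varphi_map s \<alpha> a \<psi> (of_real r * cis (X - disp r (- X))) =
      of_real r * cis (X + angle r + disp r (X + angle r))"
    by (simp add: varphi_map_def phi_polar cis_cnj)
  also have "X + angle r + disp r (X + angle r) = step r X - disp r (- step r X)"
    using step[of r X] r by linarith
  finally show ?thesis .
qed

lemma varphi_iter_polar:
  assumes "0 \<le> r" "r < R"
  shows "(varphi_map s \<alpha> a \<psi> ^^ n) (of_real r * cis (X - disp r (- X))) =
    of_real r * cis ((step r ^^ n) X - disp r (- (step r ^^ n) X))"
  by (induction n) (simp_all add: varphi_polar[OF assms])

lemma periodic_point_polar:
  fixes p :: int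
  assumes "0 \<le> r" "r < R" "0 < q" and "(step r ^^ q) X = X + 2 * pi * of_int p"
  shows "periodic_point (varphi_map s \<alpha> a \<psi>) (of_real r * cis (X - disp r (- X)))"
proof -
  have "disp r (- (X + 2 * pi * of_int p)) = disp r (- X)"
    using disp_periodic[of r "- X" "- p"] by (simp add: algebra_simps)
  then have "(varphi_map s \<alpha> a \<psi> ^^ q) (of_real r * cis (X - disp r (- X))) =
      of_real r * cis (X - disp r (- X) + 2 * pi * of_int p)"
    unfolding varphi_iter_polar[OF assms(1,2)] assms(4) by (simp add: algebra_simps)
  also have "\<dots> = of_real r * cis (X - disp r (- X))"
    by (simp add: cis_multiple_2pi flip: cis_mult)
  finally show ?thesis using assms(3) unfolding periodic_point_def by (intro exI[of _ q]) simp
qed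

subsection \<open>Resonant circles\<close>

context
  fixes q :: nat and p :: int and r0 \<beta> :: real
  assumes small: "small_radius s q r0" and r0_R: "2 * r0 < R"
    and \<beta>: "\<beta> = 2 * pi * of_int p / real q" and r0_eq: "r0 ^ (2 * s) = \<beta> - \<alpha>"
begin

definition radius :: "real \<Rightarrow> real" where "radius \<sigma> = r0 * exp (\<sigma> / (2 * real s))"

lemmas r0 = small_radiusD[OF small]

lemma radius_power: "radius \<sigma> ^ (2 * s) = r0 ^ (2 * s) * exp \<sigma>"
proof -
  have "exp (\<sigma> / (2 * real s)) ^ (2 * s) = exp (real (2 * s) * (\<sigma> / (2 * real s)))"
    by (rule exp_of_nat_mult[symmetric])
  then show ?thesis using s by (simp add: radius_def power_mult_distrib)
qed

lemma radius_pos: "0 < radius \<sigma>"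
  using r0 by (simp add: radius_def)

lemma radius_le:
  assumes "\<sigma> \<le> 1/8"
  shows "radius \<sigma> \<le> 2 * r0"
proof -
  have "\<sigma> / (2 * real s) \<le> 1/2"
  proof (cases "\<sigma> \<le> 0")
    case True
    then have "\<sigma> / (2 * real s) \<le> 0" using s by (simp add: divide_nonpos_pos)
    then show ?thesis by simp
  next
    case False
    then have "\<sigma> / (2 * real s) \<le> \<sigma> / 1" using s by (intro divide_left_mono) auto
    then show ?thesis using assms by simp
  qed
  then have "exp (\<sigma> / (2 * real s)) \<le> 2" by (rule exp_half_le)
  then show ?thesis using r0 by (simp add: radius_def)
qed

lemma radius_less_R: "\<sigma> \<le> 1/8 \<Longrightarrow> radius \<sigma> < R"
  using radius_le r0_R by fastforce

lemma radius_strict_mono: "radius \<sigma> < radius \<tau> \<longleftrightarrow> \<sigma> < \<tau>"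
  using r0 s by (simp add: radius_def divide_less_cancel)

lemma angle_radius: "angle (radius \<sigma>) = \<beta> + r0 ^ (2 * s) * (exp \<sigma> - 1)"
  unfolding angle_def radius_power using r0_eq by (simp add: algebra_simps)

lemma disp_le:
  assumes "\<sigma> \<le> 1/8"
  shows "\<bar>disp (radius \<sigma>) X\<bar> \<le> kick_const s * r0 ^ (2 * s + 1) / 6"
proof -
  let ?z = "of_real (radius \<sigma>) * cis X"
  have "cmod ?z \<le> 2 * r0" "cmod (cnj ?z) \<le> 2 * r0"
    using radius_le[OF assms] radius_pos[of \<sigma>] by (simp_all add: norm_mult)
  then have "cmod (a_tilde s a ?z) \<le> 2 * lip_const s * (2 * r0) ^ (2 * s + 1)"
    unfolding a_tilde_eq using r0 by (intro norm_double_series_le a_le) auto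
  also have "\<dots> = kick_const s * r0 ^ (2 * s + 1) / 6"
    by (simp add: kick_const_def power_mult_distrib power_mult)
  finally show ?thesis by (simp add: disp)
qed

definition kicks :: "real \<Rightarrow> real \<Rightarrow> nat \<Rightarrow> real" where
  "kicks r x n = disp r ((step r ^^ n) x + angle r) + disp r (- (step r ^^ Suc n) x)"

lemma kicks_le:
  assumes "\<sigma> \<le> 1/8"
  shows "\<bar>kicks (radius \<sigma>) x n\<bar> \<le> kick_const s * r0 ^ (2 * s + 1) / 3"
  unfolding kicks_def by (rule abs_triangle_ineq[THEN order_trans])
    (use disp_le[OF assms, of "(step (radius \<sigma>) ^^ n) x + angle (radius \<sigma>)"]
      disp_le[OF assms, of "- (step (radius \<sigma>) ^^ Suc n) x"] in linarith)

lemma step_iter_sum: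
  assumes "\<sigma> \<le> 1/8"
  shows "(step (radius \<sigma>) ^^ n) x = x + real n * \<beta> +
    (\<Sum>k<n. r0 ^ (2 * s) * (exp \<sigma> - 1) + kicks (radius \<sigma>) x k)"
proof (induction n)
  case (Suc n)
  have "(step (radius \<sigma>) ^^ Suc n) x = (step (radius \<sigma>) ^^ n) x + angle (radius \<sigma>) + kicks (radius \<sigma>) x n"
    using step[of "radius \<sigma>" "(step (radius \<sigma>) ^^ n) x"] radius_pos[of \<sigma>] radius_less_R[OF assms]
    by (simp add: kicks_def)
  then show ?case by (simp only: Suc angle_radius) (simp add: algebra_simps)
qed simp

text \<open>The passage from dynamics to algebra: the deviations of a closed real orbit from the
  rigid rotation form a fixed point of \<open>orbit_map\<close>, so that the uniqueness proved there
  applies to real radii.\<close>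

lemma resonant_orbit_solution:
  assumes \<sigma>: "\<bar>\<sigma>\<bar> \<le> 1/8" and closed: "(step (radius \<sigma>) ^^ q) x = x + real q * \<beta>"
  shows "\<exists>\<xi>. \<xi> 0 = of_real \<sigma> \<and> scalar.orbit_solution s r0 \<beta> x q a \<xi>"
proof -
  let ?X = "\<lambda>n. (step (radius \<sigma>) ^^ n) x" and ?g = "kicks (radius \<sigma>) x"
  define b where "b = r0 ^ (2 * s) * (exp \<sigma> - 1)"
  have \<sigma>': "\<sigma> \<le> 1/8" using \<sigma> by linarith
  define \<delta> where "\<delta> n = ?X n - x - real n * \<beta>" for n
  define \<xi> where "\<xi> m = (case m of 0 \<Rightarrow> complex_of_real \<sigma> | Suc n \<Rightarrow> of_real (\<delta> n))" for m
  define mean where "mean = (\<Sum>k<q. ?g k) / real q"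
  have \<delta>: "\<delta> n = (\<Sum>k<n. b + ?g k)" for n
    using step_iter_sum[OF \<sigma>', of n x] by (simp add: \<delta>_def b_def)
  have "\<delta> q = 0" using closed by (simp add: \<delta>_def)
  \<comment> \<open>The total deviation q b plus the sum of the kicks is zero.\<close>
  then have b: "b = - mean"
    using r0(2) by (simp add: \<delta> mean_def sum.distrib field_simps)
  have twist: "scalar.twist s r0 (of_real \<sigma>) = of_real b"
    by (simp add: scalar.twist_def b_def scaleR_conv_of_real exp_of_real)
  have point: "scalar.point s r0 t (of_real \<sigma>) (of_real y) = of_real (radius \<sigma>) * cis (t + y)" for t y
  proof -
    have "complex_of_real \<sigma> /\<^sub>R (2 * real s) = of_real (\<sigma> / (2 * real s))"
      by (simp only: scaleR_conv_of_real divide_inverse of_real_mult mult.commute)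
    then have "exp (complex_of_real \<sigma> /\<^sub>R (2 * real s) + \<i> * of_real y) = of_real (exp (\<sigma> / (2 * real s))) * cis y"
      by (simp only: exp_add exp_of_real cis_conv_exp)
    then show ?thesis
      unfolding scalar.point_def radius_def cis_mult[symmetric] of_real_mult scaleR_conv_of_real
      by (simp only: mult_ac)
  qed
  have kick: "scalar.kick s r0 a t (of_real \<sigma>) (of_real y) = of_real (disp (radius \<sigma>) (t + y))" for t y
  proof -
    have "scalar.kick s r0 a t (of_real \<sigma>) (of_real y) =
        double_series s a (of_real (radius \<sigma>) * cis (t + y)) (cnj (of_real (radius \<sigma>) * cis (t + y)))"
      unfolding scalar.kick_def point of_real_minus[symmetric] by (simp add: cis_cnj add.commute)
    then show ?thesis unfolding a_tilde_eq[symmetric] disp .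
  qed
  have defect: "scalar.defect s r0 \<beta> x a \<xi> n = of_real (?g n)" for n
  proof -
    have 1: "x + real (Suc n) * \<beta> + (\<delta> n + b) = ?X n + angle (radius \<sigma>)"
      by (simp add: \<delta>_def angle_radius b_def algebra_simps)
    have 2: "- (x + real (Suc n) * \<beta>) + - \<delta> (Suc n) = - ?X (Suc n)"
      by (simp add: \<delta>_def algebra_simps del: funpow.simps)
    have "scalar.defect s r0 \<beta> x a \<xi> n =
        scalar.kick s r0 a (x + real (Suc n) * \<beta>) (of_real \<sigma>) (of_real (\<delta> n + b)) +
        scalar.kick s r0 a (- (x + real (Suc n) * \<beta>)) (of_real \<sigma>) (of_real (- \<delta> (Suc n)))"
      by (simp add: scalar.defect_def \<xi>_def twist)
    then show ?thesis unfolding kick 1 2 by (simp add: kicks_def del: funpow.simps)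
  qed
  have mean: "scalar.mean_defect s r0 \<beta> x q a \<xi> = of_real mean"
    by (simp add: scalar.mean_defect_def defect mean_def scaleR_conv_of_real divide_inverse mult.commute)
  have "scalar.orbit_map s r0 \<beta> x q a \<xi> m = \<xi> m" for m
  proof (cases m)
    case 0
    have "mean = - (r0 ^ (2 * s) * (exp \<sigma> - 1))" using b by (simp add: b_def)
    then have "mean / r0 ^ (2 * s) = 1 - exp \<sigma>" using r0(3) by (simp add: field_simps)
    moreover have "scalar.orbit_map s r0 \<beta> x q a \<xi> m =
        of_real (- (mean / r0 ^ (2 * s)) - (exp \<sigma> - 1 - \<sigma>))"
      by (simp add: 0 scalar.orbit_map_def mean scaleR_conv_of_real divide_inverse mult.commute exp_of_real \<xi>_def
         )
    ultimately show ?thesis by (simp add: 0 \<xi>_def)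
  next
    case (Suc n)
    have "scalar.orbit_map s r0 \<beta> x q a \<xi> m = of_real (\<Sum>k<n. ?g k - mean)"
      by (simp add: Suc scalar.orbit_map_def mean defect)
    also have "(\<Sum>k<n. ?g k - mean) = \<delta> n" by (simp add: \<delta> b)
    also have "of_real (\<delta> n) = \<xi> m" by (simp add: Suc \<xi>_def)
    finally show ?thesis .
  qed
  \<comment> \<open>Uniqueness holds only inside the ball, so an a priori bound is due. Closing up
    turns each increment b + kick into a kick minus the mean kick, and these stay small in
    sum.\<close>
  moreover have "cmod (\<xi> m) \<le> 1/8" if "m \<le> Suc q" for m
  proof (cases m)
    case 0
    then show ?thesis using \<sigma> by (simp add: \<xi>_def)
  next
    case (Suc n)
    let ?k = "kick_const s * r0 ^ (2 * s + 1)"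
    have g: "\<bar>?g k\<bar> \<le> ?k" for k
      using kicks_le[OF \<sigma>', of x k] by linarith
    have "\<bar>mean\<bar> \<le> ?k"
    proof -
      have "\<bar>\<Sum>k<q. ?g k\<bar> \<le> (\<Sum>k<q. ?k)" using g by (intro order_trans[OF sum_abs sum_mono])
      then show ?thesis using r0(2) by (simp add: mean_def field_simps)
    qed
    then have "\<bar>b + ?g k\<bar> \<le> 2 * (?k * 1)" for k using g[of k] unfolding b by linarith
    then have "\<bar>\<delta> n\<bar> \<le> (\<Sum>k<n. 2 * (?k * 1))"
      unfolding \<delta> by (intro order_trans[OF sum_abs sum_mono])
    also have "\<dots> \<le> 1 / 8" using scalar.kick_sum_le[OF small, of 1 n] that Suc by simp
    finally show ?thesis by (simp add: Suc \<xi>_def)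
  qed
  ultimately have "scalar.orbit_solution s r0 \<beta> x q a \<xi>"
    by (simp add: scalar.orbit_solution_def)
  then show ?thesis by (intro exI[of _ \<xi>]) (simp add: \<xi>_def)
qed

lemma resonant_unique:
  assumes "\<bar>\<sigma>\<bar> \<le> 1/8" "(step (radius \<sigma>) ^^ q) x = x + real q * \<beta>"
    and "\<bar>\<tau>\<bar> \<le> 1/8" "(step (radius \<tau>) ^^ q) x = x + real q * \<beta>"
  shows "\<sigma> = \<tau>"
proof -
  obtain \<xi> \<xi>' where \<xi>: "\<xi> 0 = of_real \<sigma>" "scalar.orbit_solution s r0 \<beta> x q a \<xi>"
    "\<xi>' 0 = of_real \<tau>" "scalar.orbit_solution s r0 \<beta> x q a \<xi>'"
    using resonant_orbit_solution assms by metis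
  have "\<xi> 0 = \<xi>' 0"
    by (rule scalar.orbit_solution_unique[OF small a_le \<xi>(2,4)]) simp
  then show ?thesis using \<xi>(1,3) by simp
qed

lemma kick_small: "kick_const s * r0 ^ (2 * s + 1) / 3 \<le> r0 ^ (2 * s) / 48"
proof -
  have "kick_const s * r0 ^ (2 * s + 1) / 3 = (kick_const s * r0) * r0 ^ (2 * s) / 3" by simp
  also have "\<dots> \<le> 1/16 * r0 ^ (2 * s) / 3"
    using r0 by (intro divide_right_mono mult_right_mono) auto
  finally show ?thesis by simp
qed

text \<open>At \<sigma> = -1/8 the twist is at most -r0^(2s)/9 per step and outweighs the kicks,
  which are at most r0^(2s)/48. At \<sigma> = 1/8 the twist is at least r0^(2s)/8.\<close>

lemma winding_below: "(step (radius (- (1/8))) ^^ q) x < x + real q * \<beta>"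
proof -
  have e: "exp (- (1/8)) \<le> (8/9 :: real)"
    using exp_ge_add_one_self[of "1/8 :: real"] by (simp add: exp_minus field_simps)
  have "r0 ^ (2 * s) * (exp (- (1/8)) - 1) \<le> r0 ^ (2 * s) * (- (1/9))"
    using e r0 by (intro mult_left_mono) auto
  then have "r0 ^ (2 * s) * (exp (- (1/8)) - 1) + kicks (radius (- (1/8))) x k < 0" for k
    using kicks_le[of "- (1/8)" x k] kick_small zero_less_power[OF r0(3), of "2 * s"] by linarith
  then have "(\<Sum>k<q. r0 ^ (2 * s) * (exp (- (1/8)) - 1) + kicks (radius (- (1/8))) x k) < (\<Sum>k<q. 0)"
    using r0(2) by (intro sum_strict_mono) auto
  then show ?thesis by (simp add: step_iter_sum)
qed

lemma winding_above: "(step (radius (1/8)) ^^ q) x > x + real q * \<beta>"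
proof -
  have e: "exp (1/8) \<ge> (9/8 :: real)"
    using exp_ge_add_one_self[of "1/8 :: real"] by simp
  have "r0 ^ (2 * s) * (exp (1/8) - 1) \<ge> r0 ^ (2 * s) * (1/8)"
    using e r0 by (intro mult_left_mono) auto
  then have "0 < r0 ^ (2 * s) * (exp (1/8) - 1) + kicks (radius (1/8)) x k" for k
    using kicks_le[of "1/8" x k] kick_small zero_less_power[OF r0(3), of "2 * s"] by linarith
  then have "(\<Sum>k<q. 0) < (\<Sum>k<q. r0 ^ (2 * s) * (exp (1/8) - 1) + kicks (radius (1/8)) x k)"
    using r0(2) by (intro sum_strict_mono) auto
  then show ?thesis by (simp add: step_iter_sum)
qed

lemma continuous_winding: "continuous_on {.. 1/8} (\<lambda>\<sigma>. (step (radius \<sigma>) ^^ q) x)"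
proof (rule continuous_on_compose2[OF continuous_step_iter_radius])
  show "continuous_on {..1/8} radius"
    unfolding radius_def using s by (intro continuous_intros) auto
  show "radius ` {..1/8} \<subseteq> {0..R}"
    using radius_pos radius_less_R by (force simp: less_imp_le)
qed

text \<open>A root exists by the intermediate value theorem between the two winding bounds. The
  signs on either side follow from uniqueness: a wrong sign would force a root beyond \<sigma> as
  seen from \<tau>.\<close>

lemma resonant_level:
  obtains \<tau> where "\<bar>\<tau>\<bar> \<le> 1/8" "(step (radius \<tau>) ^^ q) x = x + real q * \<beta>"
    "\<And>\<sigma>. \<bar>\<sigma>\<bar> \<le> 1/8 \<Longrightarrow> \<sigma> \<le> \<tau> \<Longrightarrow> (step (radius \<sigma>) ^^ q) x \<le> x + real q * \<beta>"
    "\<And>\<sigma>. \<bar>\<sigma>\<bar> \<le> 1/8 \<Longrightarrow> \<tau> \<le> \<sigma> \<Longrightarrow> x + real q * \<beta> \<le> (step (radius \<sigma>) ^^ q) x"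
proof -
  let ?F = "\<lambda>\<sigma>. (step (radius \<sigma>) ^^ q) x"
  have cont: "continuous_on {u..v} ?F" if "v \<le> 1/8" for u v
    by (rule continuous_on_subset[OF continuous_winding]) (use that in auto)
  have "\<exists>\<tau>\<ge>- (1/8). \<tau> \<le> 1/8 \<and> ?F \<tau> = x + real q * \<beta>"
    by (rule IVT') (use winding_below[of x] winding_above[of x] in \<open>auto intro: cont less_imp_le\<close>)
  then obtain \<tau> where \<tau>: "- (1/8) \<le> \<tau>" "\<tau> \<le> 1/8" "?F \<tau> = x + real q * \<beta>" by blast
  show ?thesis
  proof (rule that[of \<tau>])
    show "?F \<sigma> \<le> x + real q * \<beta>" if \<sigma>: "\<bar>\<sigma>\<bar> \<le> 1/8" "\<sigma> \<le> \<tau>" for \<sigma>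
    proof (rule ccontr)
      assume n: "\<not> ?F \<sigma> \<le> x + real q * \<beta>"
      have "\<exists>\<sigma>'\<ge>- (1/8). \<sigma>' \<le> \<sigma> \<and> ?F \<sigma>' = x + real q * \<beta>"
        by (rule IVT') (use n \<sigma> winding_below[of x] in \<open>auto intro: cont less_imp_le\<close>)
      then obtain \<sigma>' where \<sigma>': "- (1/8) \<le> \<sigma>'" "\<sigma>' \<le> \<sigma>" "?F \<sigma>' = x + real q * \<beta>" by blast
      then have "\<sigma>' = \<tau>" using resonant_unique[of \<sigma>' x \<tau>] \<tau> \<sigma> by auto
      with \<sigma>' \<sigma> n \<tau> show False by auto
    qed
    show "x + real q * \<beta> \<le> ?F \<sigma>" if \<sigma>: "\<bar>\<sigma>\<bar> \<le> 1/8" "\<tau> \<le> \<sigma>" for \<sigma>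
    proof (rule ccontr)
      assume n: "\<not> x + real q * \<beta> \<le> ?F \<sigma>"
      have "\<exists>\<sigma>'\<ge>\<sigma>. \<sigma>' \<le> 1/8 \<and> ?F \<sigma>' = x + real q * \<beta>"
        by (rule IVT') (use n \<sigma> winding_above[of x] in \<open>auto intro: cont less_imp_le\<close>)
      then obtain \<sigma>' where \<sigma>': "\<sigma> \<le> \<sigma>'" "\<sigma>' \<le> 1/8" "?F \<sigma>' = x + real q * \<beta>" by blast
      then have "\<sigma>' = \<tau>" using resonant_unique[of \<sigma>' x \<tau>] \<tau> \<sigma> by auto
      with \<sigma>' \<sigma> n \<tau> show False by auto
    qed
  qed (use \<tau> in auto)
qed

text \<open>The displacement over q steps is continuous in the starting angle, so between x and y it
  takes the value q \<beta> = 2 pi p, at which the planar orbit closes up.\<close>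

lemma periodic_between:
  assumes \<sigma>: "\<sigma> \<le> 1/8"
    and "(step (radius \<sigma>) ^^ q) x \<le> x + real q * \<beta>" "y + real q * \<beta> \<le> (step (radius \<sigma>) ^^ q) y"
  shows "\<exists>z. cmod z = radius \<sigma> \<and> periodic_point (varphi_map s \<alpha> a \<psi>) z"
proof -
  let ?D = "\<lambda>X. (step (radius \<sigma>) ^^ q) X - X"
  have R: "0 \<le> radius \<sigma>" "radius \<sigma> \<le> R" "radius \<sigma> < R"
    using radius_pos[of \<sigma>] radius_less_R[OF \<sigma>] by auto
  have cont: "continuous_on A ?D" for A
    by (intro continuous_intros continuous_step_iter_angle R)
  have "\<exists>X. ?D X = real q * \<beta>"
  proof (cases "x \<le> y")
    case True
    then show ?thesis using IVT'[of ?D x "real q * \<beta>" y] cont assms(2,3) by auto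
  next
    case False
    then show ?thesis using IVT2'[of ?D x "real q * \<beta>" y] cont assms(2,3) by auto
  qed
  then obtain X where "?D X = real q * \<beta>" by blast
  then have "(step (radius \<sigma>) ^^ q) X = X + 2 * pi * of_int p" using r0(2) by (simp add: \<beta>)
  from periodic_point_polar[OF R(1,3) r0(2) this] show ?thesis
    using R(1) by (intro exI) (auto simp: norm_mult)
qed

lemma periodic_interval:
  assumes "evaluation a (obstruction s r0 \<beta> q) \<noteq> 0"
  shows "\<exists>c d. c < d \<and> {c..d} \<subseteq> {0<..2 * r0} \<and>
    (\<forall>r\<in>{c..d}. \<exists>z. cmod z = r \<and> periodic_point (varphi_map s \<alpha> a \<psi>) z)"
proof -
  obtain \<tau> where \<tau>: "\<bar>\<tau>\<bar> \<le> 1/8" "(step (radius \<tau>) ^^ q) 0 = 0 + real q * \<beta>"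
    "\<And>\<sigma>. \<bar>\<sigma>\<bar> \<le> 1/8 \<Longrightarrow> \<sigma> \<le> \<tau> \<Longrightarrow> (step (radius \<sigma>) ^^ q) 0 \<le> 0 + real q * \<beta>"
    "\<And>\<sigma>. \<bar>\<sigma>\<bar> \<le> 1/8 \<Longrightarrow> \<tau> \<le> \<sigma> \<Longrightarrow> 0 + real q * \<beta> \<le> (step (radius \<sigma>) ^^ q) 0"
    using resonant_level[of 0] by blast
  let ?y = "pi / real q"
  obtain \<tau>' where \<tau>': "\<bar>\<tau>'\<bar> \<le> 1/8" "(step (radius \<tau>') ^^ q) ?y = ?y + real q * \<beta>"
    "\<And>\<sigma>. \<bar>\<sigma>\<bar> \<le> 1/8 \<Longrightarrow> \<sigma> \<le> \<tau>' \<Longrightarrow> (step (radius \<sigma>) ^^ q) ?y \<le> ?y + real q * \<beta>"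
    "\<And>\<sigma>. \<bar>\<sigma>\<bar> \<le> 1/8 \<Longrightarrow> \<tau>' \<le> \<sigma> \<Longrightarrow> ?y + real q * \<beta> \<le> (step (radius \<sigma>) ^^ q) ?y"
    using resonant_level[of ?y] by blast
  obtain \<xi> \<xi>' where "\<xi> 0 = of_real \<tau>" "scalar.orbit_solution s r0 \<beta> 0 q a \<xi>"
    "\<xi>' 0 = of_real \<tau>'" "scalar.orbit_solution s r0 \<beta> ?y q a \<xi>'"
    using resonant_orbit_solution \<tau>(1,2) \<tau>'(1,2) by metis
  then have "evaluation a (obstruction s r0 \<beta> q) = of_real \<tau> - of_real \<tau>'"
    using evaluation_obstruction[OF small a_le] by simp
  then have ne: "\<tau> \<noteq> \<tau>'" using assms by auto
  have per: "\<exists>z. cmod z = radius \<sigma> \<and> periodic_point (varphi_map s \<alpha> a \<psi>) z"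
    if "min \<tau> \<tau>' \<le> \<sigma>" "\<sigma> \<le> max \<tau> \<tau>'" for \<sigma>
  proof -
    have b: "\<bar>\<sigma>\<bar> \<le> 1/8" using that \<tau>(1) \<tau>'(1) by linarith
    show ?thesis
    proof (cases "\<tau> \<le> \<tau>'")
      case True
      then have "\<tau> \<le> \<sigma>" "\<sigma> \<le> \<tau>'" using that by auto
      then show ?thesis using periodic_between[of \<sigma> ?y 0] \<tau>(4) \<tau>'(3) b by auto
    next
      case False
      then have "\<tau>' \<le> \<sigma>" "\<sigma> \<le> \<tau>" using that by auto
      then show ?thesis using periodic_between[of \<sigma> 0 ?y] \<tau>(3) \<tau>'(4) b by auto
    qed
  qed
  show ?thesis
  proof (rule exI[of _ "radius (min \<tau> \<tau>')"], rule exI[of _ "radius (max \<tau> \<tau>')"], intro conjI ballI)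
    show "radius (min \<tau> \<tau>') < radius (max \<tau> \<tau>')" using ne by (auto simp: radius_strict_mono)
    show "{radius (min \<tau> \<tau>')..radius (max \<tau> \<tau>')} \<subseteq> {0<..2 * r0}"
    proof -
      have "max \<tau> \<tau>' \<le> 1/8" using \<tau>(1) \<tau>'(1) by linarith
      then show ?thesis using radius_pos[of "min \<tau> \<tau>'"] radius_le[of "max \<tau> \<tau>'"] by auto
    qed
    fix r assume r: "r \<in> {radius (min \<tau> \<tau>')..radius (max \<tau> \<tau>')}"
    define \<sigma> where "\<sigma> = 2 * real s * ln (r / r0)"
    have "0 < r" using r radius_pos[of "min \<tau> \<tau>'"] by auto
    then have rs: "r = radius \<sigma>" using s r0(3) by (simp add: \<sigma>_def radius_def)
    then have "min \<tau> \<tau>' \<le> \<sigma>" "\<sigma> \<le> max \<tau> \<tau>'"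
      using r radius_strict_mono[of \<sigma> "min \<tau> \<tau>'"] radius_strict_mono[of "max \<tau> \<tau>'" \<sigma>] by auto
    then show "\<exists>z. cmod z = r \<and> periodic_point (varphi_map s \<alpha> a \<psi>) z"
      using per[of \<sigma>] rs by simp
  qed
qed

end

end

text \<open>For r^(2s) = 2 pi p/q - \<alpha> the product q r^(2s) is 2 pi times p - q \<alpha>/(2
  pi), and \<eta> is chosen to keep it below (R/2)^(2s), with R = \<open>radius_bound s\<close>;
  this also gives r < R/2. Restricting to q > 2s makes (q, 0) the index of a variable.\<close>

lemma resonance_sequence:
  fixes s :: nat and \<alpha> :: real
  assumes s: "0 < s" and irr: "\<alpha> / (2 * pi) \<notin> \<rat>"
  shows "\<exists>(q :: nat \<Rightarrow> nat) (p :: nat \<Rightarrow> int) r. strict_mono q \<and>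
    (\<forall>k. 2 * s < q k \<and> coprime (p k) (int (q k)) \<and> small_radius s (q k) (r k) \<and> 2 * r k < radius_bound s \<and>
      r k ^ (2 * s) = 2 * pi * of_int (p k) / real (q k) - \<alpha>)"
proof -
  let ?\<theta> = "\<alpha> / (2 * pi)" and ?R = "radius_bound s"
  define \<eta> where "\<eta> = (?R / 2) ^ (2 * s) / (2 * pi)"
  note R = radius_bound[of s]
  have "\<eta> > 0" using R by (simp add: \<eta>_def)
  have R1: "(?R / 2) ^ (2 * s) \<le> 1" using R by (intro power_le_one) auto
  define Q where "Q = {q. \<exists>p. 0 < q \<and> coprime p (int q) \<and> 0 < of_int p - real q * ?\<theta> \<and> of_int p - real q * ?\<theta> < \<eta>} - {..2 * s}"
  have inf: "infinite Q"
    unfolding Q_def using infinite_close_denominators[OF irr \<open>\<eta> > 0\<close>] by (rule Diff_infinite_finite[rotated]) simp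
  define q where "q = enumerate Q"
  have Q: "q k \<in> Q" for k unfolding q_def by (rule enumerate_in_set[OF inf])
  then have "\<forall>k. \<exists>p. coprime p (int (q k)) \<and> 0 < of_int p - real (q k) * ?\<theta> \<and> of_int p - real (q k) * ?\<theta> < \<eta>"
    unfolding Q_def by blast
  then obtain p where p: "\<And>k. coprime (p k) (int (q k))"
    "\<And>k. 0 < of_int (p k) - real (q k) * ?\<theta>" "\<And>k. of_int (p k) - real (q k) * ?\<theta> < \<eta>"
    by metis
  have q: "2 * s < q k" for k using Q[of k] by (simp add: Q_def)
  define r where "r k = root (2 * s) (2 * pi * of_int (p k) / real (q k) - \<alpha>)" for k
  have q_eq: "real (q k) * (2 * pi * of_int (p k) / real (q k) - \<alpha>) = 2 * pi * (of_int (p k) - real (q k) * ?\<theta>)" for k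
    using q[of k] by (simp add: field_simps)
  have pos: "0 < 2 * pi * of_int (p k) / real (q k) - \<alpha>" for k
  proof -
    have "0 < real (q k) * (2 * pi * of_int (p k) / real (q k) - \<alpha>)"
      unfolding q_eq using p(2)[of k] by simp
    then show ?thesis using q[of k] by (simp add: zero_less_mult_iff)
  qed
  have rpow: "r k ^ (2 * s) = 2 * pi * of_int (p k) / real (q k) - \<alpha>" and rpos: "0 < r k" for k
    using pos[of k] s by (simp_all add: r_def real_root_pow_pos2 real_root_gt_zero)
  have qr: "real (q k) * r k ^ (2 * s) < (?R / 2) ^ (2 * s)" for k
  proof -
    have "2 * pi * (of_int (p k) - real (q k) * ?\<theta>) < 2 * pi * \<eta>"
      using p(3)[of k] by (intro mult_strict_left_mono) auto
    then show ?thesis unfolding rpow q_eq by (simp add: \<eta>_def)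
  qed
  have rR: "2 * r k < ?R" for k
  proof -
    have "1 * r k ^ (2 * s) \<le> real (q k) * r k ^ (2 * s)"
      using q[of k] rpos[of k] by (intro mult_right_mono) auto
    then have "r k ^ (2 * s) < (?R / 2) ^ (2 * s)" using qr[of k] by linarith
    then have "r k < ?R / 2" by (rule power_less_imp_less_base) (use R in simp)
    then show ?thesis by simp
  qed
  have small: "small_radius s (q k) (r k)" for k
  proof -
    have "r k \<le> 1 / (16 * kick_const s)" using rR[of k] rpos[of k] by (simp add: radius_bound_def)
    then have "16 * kick_const s * r k \<le> 1" using kick_const_ge[of s] by (simp add: field_simps)
    then show ?thesis
      using s q[of k] rpos[of k] qr[of k] R1 by (simp add: small_radius_def)
  qed
  have "strict_mono q" unfolding q_def by (rule strict_mono_enumerate[OF inf])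
  with q p(1) small rR rpow show ?thesis by blast
qed

theorem theorem1p2:
  fixes s :: nat and \<alpha> :: real
  assumes "0 < s" and "\<alpha> / (2 * pi) \<notin> \<rat>"
  shows "\<exists>H :: nat \<Rightarrow> pseries.
    (\<forall>k. is_pseries s (H k)) \<and> func_indep H \<and>
    (\<forall>k. \<forall>a\<in>Sigma_set s. ps_converges (H k) a) \<and>
    (\<forall>a\<in>Sigma_set s. \<exists>\<rho>>0. \<exists>\<psi>. local_inverse (phi_map s a) \<psi> \<rho> \<and>
       (\<exists>I :: nat \<Rightarrow> real set.
          (\<forall>k. ps_eval (H k) a \<noteq> 0 \<longrightarrow>
             (\<exists>c d. c < d \<and> I k = {c..d} \<and> I k \<subseteq> {0<..<\<rho>} \<and>
                (\<forall>r\<in>I k. \<exists>z. cmod z = r \<and> periodic_point (varphi_map s \<alpha> a \<psi>) z))) \<and>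
          (\<forall>\<epsilon>>0. \<exists>K. \<forall>k\<ge>K. ps_eval (H k) a \<noteq> 0 \<longrightarrow> I k \<subseteq> {0<..<\<epsilon>})))"
proof -
  obtain q :: "nat \<Rightarrow> nat" and p :: "nat \<Rightarrow> int" and r where q_mono: "strict_mono q"
    and *: "\<forall>k. 2 * s < q k \<and> coprime (p k) (int (q k)) \<and> small_radius s (q k) (r k) \<and> 2 * r k < radius_bound s \<and>
      r k ^ (2 * s) = 2 * pi * of_int (p k) / real (q k) - \<alpha>"
    using resonance_sequence[OF assms] by blast
  from * have q: "\<And>k. 2 * s < q k" and p: "\<And>k. coprime (p k) (int (q k))"
    and r: "\<And>k. small_radius s (q k) (r k)" "\<And>k. 2 * r k < radius_bound s"
      "\<And>k. r k ^ (2 * s) = 2 * pi * of_int (p k) / real (q k) - \<alpha>" by blast+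
  define ob where "ob k = obstruction s (r k) (2 * pi * of_int (p k) / real (q k)) (q k)" for k
  define H where "H k = to_pseries s (ob k)" for k
  have var: "H k ((\<lambda>_. 0)((q l, 0) := 1)) = coeff (ob k) (X_var (q l, 0))" for k l
    unfolding H_def using q[of l] by (intro to_pseries_var) simp
  have "func_indep H"
  \<comment> \<open>A nonzero first-order coefficient of a(q l, 0) in H k forces q k to divide q l,
    which supplies the required order.\<close>
  proof (rule func_indep_triangular[where V = "\<lambda>k. (q k, 0)" and w = q])
    show "H k ((\<lambda>_. 0)((q k, 0) := 1)) \<noteq> 0" for k
      unfolding var ob_def by (rule coeff_obstruction(2)[OF r(1) p q refl])
    show "q k \<le> q l" if "H k ((\<lambda>_. 0)((q l, 0) := 1)) \<noteq> 0" for k l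
    proof (rule dvd_imp_le)
      show "q k dvd q l"
        using that coeff_obstruction(1)[OF r(1) p q] unfolding var ob_def by blast
      show "0 < q l" using q[of l] by simp
    qed
    show "inj q" using q_mono by (rule strict_mono_imp_inj_on)
  qed
  moreover have "\<exists>\<rho>>0. \<exists>\<psi>. local_inverse (phi_map s a) \<psi> \<rho> \<and>
       (\<exists>I :: nat \<Rightarrow> real set.
          (\<forall>k. ps_eval (H k) a \<noteq> 0 \<longrightarrow>
             (\<exists>c d. c < d \<and> I k = {c..d} \<and> I k \<subseteq> {0<..<\<rho>} \<and>
                (\<forall>r\<in>I k. \<exists>z. cmod z = r \<and> periodic_point (varphi_map s \<alpha> a \<psi>) z))) \<and>
          (\<forall>\<epsilon>>0. \<exists>K. \<forall>k\<ge>K. ps_eval (H k) a \<noteq> 0 \<longrightarrow> I k \<subseteq> {0<..<\<epsilon>}))"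
    if a: "a \<in> Sigma_set s" for a
  proof -
    interpret reversible_map s \<alpha> a by unfold_locales (use assms a in auto)
    \<comment> \<open>The condition stands inside the existential so that choice yields a total
      sequence; the interval is arbitrary where the series vanishes.\<close>
    have "\<forall>k. \<exists>J. ps_eval (H k) a \<noteq> 0 \<longrightarrow> (\<exists>c d. c < d \<and> J = {c..d} \<and> J \<subseteq> {0<..2 * r k} \<and>
        (\<forall>r\<in>J. \<exists>z. cmod z = r \<and> periodic_point (varphi_map s \<alpha> a \<psi>) z))"
      using periodic_interval[OF r(1,2) refl r(3)]
      unfolding H_def ob_def ps_eval_to_pseries(2)[OF a] by metis
    from choice[OF this] obtain I where "\<forall>k. ps_eval (H k) a \<noteq> 0 \<longrightarrow>
        (\<exists>c d. c < d \<and> I k = {c..d} \<and> I k \<subseteq> {0<..2 * r k} \<and>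
          (\<forall>r\<in>I k. \<exists>z. cmod z = r \<and> periodic_point (varphi_map s \<alpha> a \<psi>) z))" ..
    then have I: "\<exists>c d. c < d \<and> I k = {c..d} \<and> I k \<subseteq> {0<..2 * r k} \<and>
        (\<forall>r\<in>I k. \<exists>z. cmod z = r \<and> periodic_point (varphi_map s \<alpha> a \<psi>) z)"
      if "ps_eval (H k) a \<noteq> 0" for k
      using that by blast
    have sub: "I k \<subseteq> {0<..<e}" if "ps_eval (H k) a \<noteq> 0" "2 * r k < e" for k e
      using I[OF that(1)] that(2) by fastforce
    have "\<exists>K. \<forall>k\<ge>K. 2 * r k < \<epsilon>" if "\<epsilon> > 0" for \<epsilon>
    proof -
      \<comment> \<open>The radii tend to 0 because q k r k^(2s) <= 1 and q k >= k; this K makes K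
        (\<epsilon>/2)^(2s) exceed 1.\<close>
      obtain K :: nat where K: "1 / (\<epsilon> / 2) ^ (2 * s) < real K" using reals_Archimedean2 by blast
      have "2 * r k < \<epsilon>" if "k \<ge> K" for k
      proof -
        have "K \<le> q k" using that strict_mono_imp_increasing[OF q_mono, of k] by simp
        then have "1 / (\<epsilon> / 2) ^ (2 * s) < real (q k)" using K by linarith
        then have "1 < real (q k) * (\<epsilon> / 2) ^ (2 * s)" using \<open>\<epsilon> > 0\<close> by (simp add: divide_less_eq)
        with small_radiusD(5)[OF r(1)[of k]] have "real (q k) * r k ^ (2 * s) < real (q k) * (\<epsilon> / 2) ^ (2 * s)"
          by linarith
        then have "r k ^ (2 * s) < (\<epsilon> / 2) ^ (2 * s)" by (rule mult_left_less_imp_less) simp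
        then have "r k < \<epsilon> / 2" by (rule power_less_imp_less_base) (use \<open>\<epsilon> > 0\<close> in simp)
        then show ?thesis by simp
      qed
      then show ?thesis by blast
    qed
    then have "\<forall>\<epsilon>>0. \<exists>K. \<forall>k\<ge>K. ps_eval (H k) a \<noteq> 0 \<longrightarrow> I k \<subseteq> {0<..<\<epsilon>}"
      using sub by meson
    moreover have "\<exists>c d. c < d \<and> I k = {c..d} \<and> I k \<subseteq> {0<..<R} \<and>
        (\<forall>r\<in>I k. \<exists>z. cmod z = r \<and> periodic_point (varphi_map s \<alpha> a \<psi>) z)"
      if "ps_eval (H k) a \<noteq> 0" for k
      using I[OF that] sub[OF that r(2)] by metis
    ultimately show ?thesis
      using radius_bound(1)[of s] local_inverse_phi by blast
  qed
  moreover have "\<forall>k. is_pseries s (H k)" "\<forall>k. \<forall>a\<in>Sigma_set s. ps_converges (H k) a"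
    unfolding H_def using is_pseries_to_pseries ps_eval_to_pseries(1) by auto
  ultimately show ?thesis by (intro exI[of _ H] conjI ballI) auto
qed

end
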